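(* Let $G$ be a simple complex Lie group with Weyl group $W$, let $P\subset G$ be a parabolic subgroup with associated parabolic subgroup $W_P\subset W$, let $\omega_0\in W$ be the longest word, and let $a_P$ be the number of cosets $\omega W_P\in W/W_P$ for which $\omega^{-1}\omega_0\omega\in W_P$. Then $a_P=0$ except in the following cases, listed according to the types of $W$ and of the parabolic subgroup $W_P$: (1) $W=S_n$ (type $A$) and $W_P=\prod_{i=1}^r S_{n_i}$ with $n_1,\dots,n_r$ positive integers, $n=\sum_{i=1}^r n_i$ and at most one $n_i$ odd; in this case $a_P=\lfloor\frac n2\rfloor!\big/\prod_{i=1}^r\lfloor\frac{n_i}{2}\rfloor!$. (2) $W$ is of type $D_{2n+1}$ and $W_P$ is of type $D_{2n}$ (with $n\ge 2$); in this case $a_P=2$. (3) $W$ is of type $E_6$ and $W_P$ is of type $D_5$; in this case $a_P=3$. (4) $W$ is of type $E_6$ and $W_P$ is of type $D_4$; in this case $a_P=6$.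
   Context: The Weyl group $W$ is generated by a set $\Sigma$ of simple reflections, in bijection with the nodes of the Dynkin diagram of $G$. Fixing a minimal parabolic subgroup $B$ of $G$, parabolic subgroups $P\supset B$ correspond bijectively to subsets $\Sigma_P\subset\Sigma$, and $W_P$ is the subgroup of $W$ generated by $\Sigma_P$. The type of $W_P$ is the Dynkin diagram obtained from that of $G$ by deleting the nodes not in $\Sigma_P$. The length of $\omega\in W$ is the length of a shortest expression of $\omega$ as a product of elements of $\Sigma$; the longest word $\omega_0$ is the unique element of maximal length. In type $A$ the Weyl group is $S_n$, generated by adjacent transpositions, and $\prod_{i=1}^r S_{n_i}$ is the subgroup preserving the consecutive blocks of $\{1,\dots,n\}$ of sizes $n_1,\dots,n_r$. Type $D_3$ coincides with type $A_3$ and is covered by case (1).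
   Formalization: The claim that a_P = 0 outside the listed cases is stated only for P ≠ G: if P = G and W is not of type A, the single coset is always counted and a_P = 1, so the claim as written fails there. *)

theory Defs
  imports
    "HOL-Analysis.Euclidean_Space"
    "HOL-Algebra.Bij"
    "HOL-Algebra.Generated_Groups"
    "HOL-Algebra.Left_Coset"
    "HOL-Algebra.Sym_Groups"
begin

section \<open>Root systems and bases\<close>

text \<open>
  A simple complex Lie group enters only through its Weyl group, its simple reflections and its
  Dynkin diagram, so it is represented by its root system: an irreducible reduced
  crystallographic root system spanning a Euclidean space.  Fixing a minimal parabolic subgroup
  \<open>B\<close> amounts to fixing a base \<open>\<Delta>\<close> (the nodes of the Dynkin diagram), and a parabolic
  subgroup \<open>P\<close> containing \<open>B\<close> to choosing a subset \<open>J\<close> of \<open>\<Delta>\<close>.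
\<close>

definition cartan_int :: "'a::euclidean_space \<Rightarrow> 'a \<Rightarrow> real" where
  "cartan_int a b = 2 * (inner a b) / (inner b b)"

definition reflection :: "'a::euclidean_space \<Rightarrow> 'a \<Rightarrow> 'a" where
  "reflection a x = x - cartan_int x a *\<^sub>R a"

definition root_system :: "'a::euclidean_space set \<Rightarrow> bool" where
  "root_system \<Phi> \<longleftrightarrow>
     finite \<Phi> \<and> 0 \<notin> \<Phi> \<and> span \<Phi> = UNIV \<and>
     (\<forall>a\<in>\<Phi>. reflection a ` \<Phi> = \<Phi>) \<and>
     (\<forall>a\<in>\<Phi>. \<forall>b\<in>\<Phi>. cartan_int a b \<in> \<int>) \<and>
     (\<forall>a\<in>\<Phi>. \<forall>c. c *\<^sub>R a \<in> \<Phi> \<longrightarrow> c = 1 \<or> c = -1)"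

definition irreducible_root_system :: "'a::euclidean_space set \<Rightarrow> bool" where
  "irreducible_root_system \<Phi> \<longleftrightarrow>
     root_system \<Phi> \<and> \<Phi> \<noteq> {} \<and>
     \<not> (\<exists>A B. A \<noteq> {} \<and> B \<noteq> {} \<and> A \<inter> B = {} \<and> A \<union> B = \<Phi> \<and> (\<forall>a\<in>A. \<forall>b\<in>B. inner a b = 0))"

definition root_base :: "'a::euclidean_space set \<Rightarrow> 'a set \<Rightarrow> bool" where
  "root_base \<Phi> \<Delta> \<longleftrightarrow>
     \<Delta> \<subseteq> \<Phi> \<and> independent \<Delta> \<and>
     (\<forall>b\<in>\<Phi>. \<exists>k::'a \<Rightarrow> nat.
        b = (\<Sum>a\<in>\<Delta>. real (k a) *\<^sub>R a) \<or> b = - (\<Sum>a\<in>\<Delta>. real (k a) *\<^sub>R a))"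


section \<open>The Weyl group, its parabolic subgroups and its longest word\<close>

definition weyl_group :: "'a::euclidean_space set \<Rightarrow> ('a \<Rightarrow> 'a) monoid" where
  "weyl_group \<Delta> = subgroup_generated (BijGroup UNIV) (reflection ` \<Delta>)"

definition parabolic_subgroup :: "'a::euclidean_space set \<Rightarrow> 'a set \<Rightarrow> ('a \<Rightarrow> 'a) set" where
  "parabolic_subgroup \<Delta> J = generate (weyl_group \<Delta>) (reflection ` J)"

definition word_length :: "'a::euclidean_space set \<Rightarrow> ('a \<Rightarrow> 'a) \<Rightarrow> nat" where
  "word_length \<Delta> w =
     (LEAST k. \<exists>ss. length ss = k \<and> set ss \<subseteq> reflection ` \<Delta> \<and>
                    foldr (\<otimes>\<^bsub>weyl_group \<Delta>\<^esub>) ss \<one>\<^bsub>weyl_group \<Delta>\<^esub> = w)"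

definition longest_word :: "'a::euclidean_space set \<Rightarrow> 'a \<Rightarrow> 'a" where
  "longest_word \<Delta> =
     (THE w. w \<in> carrier (weyl_group \<Delta>) \<and>
             (\<forall>v\<in>carrier (weyl_group \<Delta>). word_length \<Delta> v \<le> word_length \<Delta> w))"

definition a_P :: "'a::euclidean_space set \<Rightarrow> 'a set \<Rightarrow> nat" where
  "a_P \<Delta> J =
     card {X \<in> lcosets\<^bsub>weyl_group \<Delta>\<^esub> (parabolic_subgroup \<Delta> J).
       \<exists>\<omega>\<in>carrier (weyl_group \<Delta>).
         X = \<omega> <#\<^bsub>weyl_group \<Delta>\<^esub> parabolic_subgroup \<Delta> J \<and>
         inv\<^bsub>weyl_group \<Delta>\<^esub> \<omega> \<otimes>\<^bsub>weyl_group \<Delta>\<^esub> longest_word \<Delta> \<otimes>\<^bsub>weyl_group \<Delta>\<^esub> \<omega>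
           \<in> parabolic_subgroup \<Delta> J}"


section \<open>Dynkin types\<close>

text \<open>
  \<open>simply_laced_labelling \<Delta> n E f\<close>: the map \<open>f\<close> identifies the graph with nodes \<open>1, \<dots>, n\<close> and
  edges \<open>E\<close> with the Dynkin diagram of \<open>\<Delta>\<close>.  Two nodes are joined by a single bond (with no
  arrow) exactly if both Cartan integers equal \<open>-1\<close>, and are not joined exactly if they vanish.
\<close>

definition simply_laced_labelling ::
    "'a::euclidean_space set \<Rightarrow> nat \<Rightarrow> nat set set \<Rightarrow> (nat \<Rightarrow> 'a) \<Rightarrow> bool" where
  "simply_laced_labelling \<Delta> n E f \<longleftrightarrow>
     bij_betw f {1..n} \<Delta> \<and>
     (\<forall>i\<in>{1..n}. \<forall>j\<in>{1..n}. i \<noteq> j \<longrightarrow>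
        cartan_int (f i) (f j) = (if {i, j} \<in> E then -1 else 0))"

definition A_edges :: "nat \<Rightarrow> nat set set" where
  "A_edges n = {{i, i + 1} |i. 1 \<le> i \<and> i + 1 \<le> n}"

text \<open>The nodes of \<open>D\<close> and \<open>E\<close> are numbered as in Bourbaki; the former is used for \<open>n \<ge> 4\<close> only.\<close>

definition D_edges :: "nat \<Rightarrow> nat set set" where
  "D_edges n = {{i, i + 1} |i. 1 \<le> i \<and> i + 1 \<le> n - 1} \<union> {{n - 2, n}}"

definition E6_edges :: "nat set set" where
  "E6_edges = {{1, 3}, {3, 4}, {4, 5}, {5, 6}, {2, 4}}"

definition type_D :: "nat \<Rightarrow> 'a::euclidean_space set \<Rightarrow> bool" where
  "type_D n \<Delta> \<longleftrightarrow> (\<exists>f. simply_laced_labelling \<Delta> n (D_edges n) f)"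

definition type_E6 :: "'a::euclidean_space set \<Rightarrow> bool" where
  "type_E6 \<Delta> \<longleftrightarrow> (\<exists>f. simply_laced_labelling \<Delta> 6 E6_edges f)"

text \<open>
  The subgroup \<open>S\<^bsub>n\<^sub>1\<^esub> \<times> \<dots> \<times> S\<^bsub>n\<^sub>r\<^esub>\<close> of the symmetric group on \<open>{1..n}\<close> that
  preserves the consecutive blocks of sizes \<open>n\<^sub>1, \<dots>, n\<^sub>r\<close>; blocks are indexed from \<open>0\<close>.
\<close>

definition block :: "nat list \<Rightarrow> nat \<Rightarrow> nat set" where
  "block ns k = {sum_list (take k ns)<..sum_list (take (Suc k) ns)}"

definition block_subgroup :: "nat list \<Rightarrow> (nat \<Rightarrow> nat) set" where
  "block_subgroup ns =
     {p \<in> carrier (sym_group (sum_list ns)). \<forall>k<length ns. p ` block ns k = block ns k}"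

text \<open>
  \<open>type_A_with_blocks \<Delta> J ns\<close>: with \<open>n\<close> the sum of \<open>ns\<close>, the diagram is of type
  \<open>A\<^bsub>n-1\<^esub>\<close>, and identifying the Weyl group with \<open>S\<^sub>n\<close> so that the simple reflections become the
  adjacent transpositions, in the order of the diagram, identifies the parabolic subgroup of
  \<open>J\<close> with the block subgroup of \<open>ns\<close>.
\<close>

definition type_A_with_blocks ::
    "'a::euclidean_space set \<Rightarrow> 'a set \<Rightarrow> nat list \<Rightarrow> bool" where
  "type_A_with_blocks \<Delta> J ns \<longleftrightarrow>
     (\<exists>f h. simply_laced_labelling \<Delta> (sum_list ns - 1) (A_edges (sum_list ns - 1)) f \<and>
            h \<in> iso (weyl_group \<Delta>) (sym_group (sum_list ns)) \<and>
            (\<forall>i\<in>{1..sum_list ns - 1}. h (reflection (f i)) = transpose i (i + 1)) \<and>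
            h ` parabolic_subgroup \<Delta> J = block_subgroup ns)"

text \<open>All \<open>n\<^sub>i\<close> are positive and at most one of them is odd.\<close>

definition admissible_blocks :: "nat list \<Rightarrow> bool" where
  "admissible_blocks ns \<longleftrightarrow> (\<forall>m\<in>set ns. 0 < m) \<and> length (filter odd ns) \<le> 1"

end

theory Submission
  imports
    Defs
    "HOL-Analysis.Linear_Algebra"
    "HOL-Combinatorics.Multiset_Permutations"
begin

text \<open>Let \<open>w\<^sub>0\<close> be the longest element. The parabolic subgroup of \<open>J\<close> is the pointwise stabiliser in \<open>W\<close> of
the vectors dual to the simple roots outside \<open>J\<close> (\<open>parabolic_iff_fixes_dual\<close>). Hence the coset of \<open>u\<close>
is determined by the points \<open>u (dual b)\<close> with \<open>b\<close> outside \<open>J\<close>, and it is counted exactly if \<open>w\<^sub>0\<close> fixes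
these points (\<open>a_P_eq_card\<close>). The whole question is therefore which tuples of such points in the
fixed space of \<open>w\<^sub>0\<close> are images of the tuple of dual vectors.

The map \<open>- w\<^sub>0\<close> permutes the simple roots and preserves their inner products, so it is a symmetry of
the Dynkin diagram (\<open>opposite_base\<close>). If this symmetry is trivial, then \<open>w\<^sub>0 = - 1\<close> fixes no nonzero
vector and nothing is counted for a proper \<open>J\<close>. Otherwise the diagram is connected and has a nontrivial
involution, and this leaves only the types \<open>A\<^sub>n\<close>, \<open>D\<^sub>n\<close> and \<open>E\<^sub>6\<close> (\<open>classification\<close>). The reason is
positive definiteness, in the form of \<open>no_subadditive\<close>: no nonzero nonnegative function on the nodes
is bounded, at each node of its support, by half the weighted sum of its values at other nodes.
Cycles, paths with two heavy ends and the affine diagrams of types \<open>E\<^sub>6\<close> and \<open>E\<^sub>7\<close> carry such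
functions. This makes the diagram so rigid around a multiple bond that only the trivial symmetry
survives, and it forces a branch point to be fixed with two of its three arms exchanged.

In type \<open>A\<close> the group permutes the weights of the standard representation and \<open>w\<^sub>0\<close> reverses their
order. Cosets are colourings of \<open>{1..n}\<close> whose colour classes have the given block sizes, and those that
are counted are the palindromes. A palindrome exists only if at most one block is odd, and it
amounts to an arrangement of half of each block on the left half of \<open>{1..n}\<close>, which gives the
multinomial coefficient (\<open>card_left_half\<close>).

In type \<open>D\<^sub>n\<close> the group acts on coordinate vectors \<open>\<epsilon>\<^sub>j\<close> by permutations and even numbers of sign
changes. For even
\<open>n\<close> it contains \<open>- 1\<close>. For odd \<open>n\<close> the fixed space of \<open>w\<^sub>0\<close> is the line of \<open>\<epsilon>\<^sub>n\<close>, which meets the orbit of a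
dual vector only for the first node; the orbit points on it are \<open>\<epsilon>\<^sub>n\<close> and \<open>- \<epsilon>\<^sub>n\<close> up to scaling.

In type \<open>E\<^sub>6\<close> the fixed space is a plane. The group moves a weight only by elements of the root lattice,
so fixed images of three times a fundamental weight have integral coordinates with known residues
modulo three, and their squared length is an even multiple of that of a root. This excludes all nodes but
the two ends of the long arms. For each of these, the length leaves the six vertices of a hexagon and
the residues leave three of them; for both ends together the inner product leaves the six pairs of
neighbouring vertices. All these points and pairs are attained by explicit words.\<close>

section \<open>Words in reflections\<close>

lemma reflection_0 [simp]: "reflection 0 x = x"
  by (simp add: reflection_def cartan_int_def)

lemma orthogonal_transformation_reflection: "orthogonal_transformation (reflection a)"
proof (cases "a = 0")
  case False
  have "linear (reflection a)"
    by (rule linearI)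
       (simp_all add: reflection_def cartan_int_def inner_add_left algebra_simps add_divide_distrib)
  moreover have "inner (reflection a x) (reflection a y) = inner x y" for x y
  proof -
    have "inner (x - k *\<^sub>R a) (y - l *\<^sub>R a) = inner x y"
      if "k * inner a a = 2 * inner x a" "l * inner a a = 2 * inner y a" for k l
    proof -
      have "inner (x - k *\<^sub>R a) (y - l *\<^sub>R a)
          = inner x y - l * inner x a - k * inner y a + l * (k * inner a a)"
        by (simp add: inner_diff_left inner_diff_right inner_commute[of a y] algebra_simps)
      moreover have "2 * (k * inner y a) = k * (l * inner a a)"
        using that by simp
      moreover have "k * (l * inner a a) = l * (2 * inner x a)"
        using that by (metis mult.left_commute)
      ultimately show ?thesis
        by (simp add: that(1))
    qed
    then show ?thesis
      using False by (simp add: reflection_def cartan_int_def)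
  qed
  ultimately show ?thesis
    by (simp add: orthogonal_transformation_def)
qed (simp add: orthogonal_transformation_def linear_iff)

lemma linear_reflection: "linear (reflection a)"
  using orthogonal_transformation_reflection orthogonal_transformation_def by blast

lemma reflection_minus: "reflection a (- x) = - reflection a x"
  by (simp add: linear_neg[OF linear_reflection])

lemma reflection_self: "reflection a a = - a"
  by (cases "a = 0") (simp_all add: reflection_def cartan_int_def scaleR_2)

lemma reflection_reflection [simp]: "reflection a (reflection a x) = x"
proof -
  have "reflection a (x - cartan_int x a *\<^sub>R a) = reflection a x - cartan_int x a *\<^sub>R (- a)"
    using linear_reflection[of a] by (simp add: linear_diff linear_scale reflection_self)
  also have "\<dots> = x"
    by (simp add: reflection_def)
  finally show ?thesis
    by (simp only: reflection_def[of a x])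
qed

lemma reflection_conj:
  assumes "orthogonal_transformation u"
  shows "reflection (u a) (u x) = u (reflection a x)"
  using assms
  by (simp add: reflection_def cartan_int_def orthogonal_transformation_def linear_diff linear_scale)

definition word :: "'a::euclidean_space list \<Rightarrow> 'a \<Rightarrow> 'a" where
  "word ss = foldr (\<lambda>a g. reflection a \<circ> g) ss id"

lemma word_simps [simp]:
  "word [] = id"
  "word (a # ss) = reflection a \<circ> word ss"
  by (simp_all add: word_def)

lemma word_append: "word (xs @ ys) = word xs \<circ> word ys"
  by (induction xs) auto

lemma word_rev: "word (rev ss) (word ss x) = x"
  by (induction ss arbitrary: x) (simp_all add: word_append)

lemma word_rev': "word ss (word (rev ss) x) = x"
  using word_rev[of "rev ss"] by simp

lemma orthogonal_transformation_word: "orthogonal_transformation (word ss)"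
proof (induction ss)
  case Nil
  show ?case by (simp add: orthogonal_transformation_def linear_iff)
next
  case (Cons a ss)
  then show ?case
    unfolding word_simps
    by (intro orthogonal_transformation_compose orthogonal_transformation_reflection)
qed

lemma word_conj: "reflection (word ss a) (word ss x) = word ss (reflection a x)"
  by (rule reflection_conj[OF orthogonal_transformation_word])

text \<open>Reflections are their own inverses, so the generated group consists of the words in the generators
alone. With composition of maps as multiplication, this describes the Weyl group and all its
standard parabolic subgroups at once.\<close>

definition refl_group :: "'a::euclidean_space set \<Rightarrow> ('a \<Rightarrow> 'a) set" where
  "refl_group S = word ` lists S"

lemma refl_groupI: "set ss \<subseteq> S \<Longrightarrow> word ss \<in> refl_group S"
  by (auto simp: refl_group_def)

lemma refl_groupE:
  assumes "w \<in> refl_group S"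
  obtains ss where "set ss \<subseteq> S" "w = word ss"
  using assms by (auto simp: refl_group_def)

lemma refl_group_id: "id \<in> refl_group S"
  using refl_groupI[of "[]"] by simp

lemma refl_group_reflection: "a \<in> S \<Longrightarrow> reflection a \<in> refl_group S"
  using refl_groupI[of "[a]" S] by (simp add: comp_def)

lemma refl_group_comp:
  assumes "u \<in> refl_group S" "v \<in> refl_group S"
  shows "u \<circ> v \<in> refl_group S"
proof -
  obtain xs ys where "set xs \<subseteq> S" "u = word xs" "set ys \<subseteq> S" "v = word ys"
    using assms by (metis refl_groupE)
  then show ?thesis
    using refl_groupI[of "xs @ ys" S] by (simp add: word_append)
qed

lemma refl_group_orthogonal: "w \<in> refl_group S \<Longrightarrow> orthogonal_transformation w"
  using orthogonal_transformation_word by (metis refl_groupE)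

lemma refl_group_linear: "w \<in> refl_group S \<Longrightarrow> linear w"
  using refl_group_orthogonal orthogonal_transformation_def by blast

lemma refl_group_inner: "w \<in> refl_group S \<Longrightarrow> inner (w x) (w y) = inner x y"
  using refl_group_orthogonal orthogonal_transformation_def by blast

lemma refl_group_bij: "w \<in> refl_group S \<Longrightarrow> bij w"
  using refl_group_orthogonal orthogonal_transformation_bij by blast

lemma refl_group_inv:
  assumes "w \<in> refl_group S"
  shows "inv_into UNIV w \<in> refl_group S"
proof -
  obtain ss where ss: "set ss \<subseteq> S" "w = word ss"
    using assms by (rule refl_groupE)
  have "inv_into UNIV w = word (rev ss)"
    by (rule inv_unique_comp) (auto simp: ss word_rev word_rev')
  then show ?thesis
    using ss by (simp add: refl_groupI)
qed

lemma refl_group_inv_cancel [simp]: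
  assumes "w \<in> refl_group S"
  shows "inv_into UNIV w (w x) = x" "w (inv_into UNIV w x) = x"
  using refl_group_bij[OF assms] by (simp_all add: bij_is_inj bij_is_surj surj_f_inv_f)

lemma refl_group_mono: "S \<subseteq> T \<Longrightarrow> refl_group S \<subseteq> refl_group T"
  by (auto simp: refl_group_def)

text \<open>Both the Weyl group and its parabolic subgroups are defined as generated subgroups, the latter inside
the former. The argument uses only that the ambient group multiplies by composition.\<close>

lemma generate_reflections:
  assumes G: "group G"
    and mult: "\<And>f g. f \<in> carrier G \<Longrightarrow> g \<in> carrier G \<Longrightarrow> f \<otimes>\<^bsub>G\<^esub> g = f \<circ> g"
    and one: "\<one>\<^bsub>G\<^esub> = id"
    and S: "reflection ` S \<subseteq> carrier G"
  shows "generate G (reflection ` S) = refl_group S"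
proof
  interpret group G by fact
  have inv_refl: "inv\<^bsub>G\<^esub> reflection a = reflection a" if "a \<in> S" for a
  proof (rule inv_equality)
    have "reflection a \<circ> reflection a = id"
      by auto
    then show "reflection a \<otimes>\<^bsub>G\<^esub> reflection a = \<one>\<^bsub>G\<^esub>"
      using that S mult one by (metis image_subset_iff)
  qed (use that S in auto)
  have gen: "generate G (reflection ` S) \<subseteq> carrier G"
    by (rule generate_incl[OF S])
  show "generate G (reflection ` S) \<subseteq> refl_group S"
  proof
    fix w assume "w \<in> generate G (reflection ` S)"
    then show "w \<in> refl_group S"
    proof induction
      case one
      show ?case using refl_group_id[of S] assms(3) by argo
    next
      case (incl h)
      then show ?case by (auto intro: refl_group_reflection)
    next
      case (inv h)
      then show ?case using inv_refl
        by (auto intro: refl_group_reflection)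
    next
      case (eng h1 h2)
      then have "h1 \<otimes>\<^bsub>G\<^esub> h2 = h1 \<circ> h2"
        using gen mult by blast
      then show ?case using eng refl_group_comp by metis
    qed
  qed
  show "refl_group S \<subseteq> generate G (reflection ` S)"
  proof
    fix w assume "w \<in> refl_group S"
    then obtain ss where "set ss \<subseteq> S" "w = word ss" by (rule refl_groupE)
    then show "w \<in> generate G (reflection ` S)"
    proof (induction ss arbitrary: w)
      case Nil
      then show ?case using generate.one[of G "reflection ` S"] one by (metis word_simps(1))
    next
      case (Cons a ss)
      have 1: "reflection a \<in> generate G (reflection ` S)" "word ss \<in> generate G (reflection ` S)"
        using Cons by (auto intro: generate.incl)
      then have "reflection a \<otimes>\<^bsub>G\<^esub> word ss = reflection a \<circ> word ss"
        using gen mult by blast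
      with 1 show ?case using Cons.prems by (metis generate.eng word_simps(2))
    qed
  qed
qed

lemma mult_BijGroup_UNIV:
  assumes "f \<in> carrier (BijGroup UNIV)" "g \<in> carrier (BijGroup UNIV)"
  shows "f \<otimes>\<^bsub>BijGroup UNIV\<^esub> g = f \<circ> g"
  using assms by (auto simp: BijGroup_def compose_def)

lemma one_BijGroup_UNIV: "\<one>\<^bsub>BijGroup UNIV\<^esub> = id"
  by (auto simp: BijGroup_def)

lemma carrier_BijGroup_UNIV: "f \<in> carrier (BijGroup UNIV) \<longleftrightarrow> bij f"
  by (auto simp: BijGroup_def Bij_def)

lemma group_weyl_group: "group (weyl_group \<Delta>)"
  unfolding weyl_group_def by (intro group.group_subgroup_generated group_BijGroup)

lemma carrier_weyl_group: "carrier (weyl_group \<Delta>) = refl_group \<Delta>"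
proof -
  have "reflection ` \<Delta> \<subseteq> carrier (BijGroup UNIV)"
    using refl_group_bij[OF refl_group_reflection] by (auto simp: carrier_BijGroup_UNIV)
  then show ?thesis
    using generate_reflections[OF group_BijGroup mult_BijGroup_UNIV one_BijGroup_UNIV, of \<Delta>]
    by (simp add: weyl_group_def carrier_subgroup_generated Int_absorb1)
qed

lemma mult_weyl_group:
  assumes "f \<in> refl_group \<Delta>" "g \<in> refl_group \<Delta>"
  shows "f \<otimes>\<^bsub>weyl_group \<Delta>\<^esub> g = f \<circ> g"
proof -
  have "monoid.mult (weyl_group \<Delta>) = monoid.mult (BijGroup UNIV)"
    by (simp add: weyl_group_def subgroup_generated_def)
  then show ?thesis
    using mult_BijGroup_UNIV assms refl_group_bij by (metis carrier_BijGroup_UNIV)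
qed

lemma one_weyl_group: "\<one>\<^bsub>weyl_group \<Delta>\<^esub> = id"
  by (simp add: weyl_group_def one_BijGroup_UNIV)

lemma inv_weyl_group:
  assumes "f \<in> refl_group \<Delta>"
  shows "inv\<^bsub>weyl_group \<Delta>\<^esub> f = inv_into UNIV f"
proof -
  interpret group "weyl_group \<Delta>" by (rule group_weyl_group)
  show ?thesis
    by (rule inv_equality)
       (use assms in \<open>auto simp: carrier_weyl_group mult_weyl_group refl_group_inv one_weyl_group\<close>)
qed

lemma parabolic_eq_refl_group:
  assumes "J \<subseteq> \<Delta>"
  shows "parabolic_subgroup \<Delta> J = refl_group J"
  unfolding parabolic_subgroup_def
proof (rule generate_reflections[OF group_weyl_group])
  show "reflection ` J \<subseteq> carrier (weyl_group \<Delta>)"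
    using assms by (auto simp: carrier_weyl_group intro: refl_group_reflection)
qed (simp_all add: carrier_weyl_group mult_weyl_group one_weyl_group)

lemma foldr_mult_weyl_group:
  assumes "set ss \<subseteq> \<Delta>"
  shows "foldr (\<otimes>\<^bsub>weyl_group \<Delta>\<^esub>) (map reflection ss) \<one>\<^bsub>weyl_group \<Delta>\<^esub> = word ss"
  using assms
proof (induction ss)
  case (Cons a ss)
  then show ?case
    using mult_weyl_group[of "reflection a" \<Delta> "word ss"]
    by (simp add: refl_group_reflection refl_groupI)
qed (simp add: one_weyl_group)

lemma word_length_eq:
  "word_length \<Delta> w = (LEAST k. \<exists>ss. length ss = k \<and> set ss \<subseteq> \<Delta> \<and> word ss = w)"
proof -
  have "(\<exists>ss. length ss = k \<and> set ss \<subseteq> reflection ` \<Delta> \<and>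
            foldr (\<otimes>\<^bsub>weyl_group \<Delta>\<^esub>) ss \<one>\<^bsub>weyl_group \<Delta>\<^esub> = w) \<longleftrightarrow>
        (\<exists>ss. length ss = k \<and> set ss \<subseteq> \<Delta> \<and> word ss = w)" (is "?L \<longleftrightarrow> ?R") for k
  proof
    assume ?L
    then obtain ss where ss: "length ss = k" "set ss \<subseteq> reflection ` \<Delta>"
      "foldr (\<otimes>\<^bsub>weyl_group \<Delta>\<^esub>) ss \<one>\<^bsub>weyl_group \<Delta>\<^esub> = w" by blast
    then have "ss \<in> lists (reflection ` \<Delta>)" by auto
    then obtain ts where "ts \<in> lists \<Delta>" "ss = map reflection ts"
      by (auto simp: lists_image)
    moreover from this have "set ts \<subseteq> \<Delta>" by blast
    ultimately show ?R using ss foldr_mult_weyl_group[of ts \<Delta>] by (intro exI[of _ ts]) simp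
  next
    assume ?R
    then obtain ss where "length ss = k" "set ss \<subseteq> \<Delta>" "word ss = w" by blast
    then show ?L using foldr_mult_weyl_group[of ss \<Delta>]
      by (intro exI[of _ "map reflection ss"]) auto
  qed
  then show ?thesis by (simp add: word_length_def)
qed

section \<open>Positive roots, length and the longest element\<close>

locale root_basis =
  fixes \<Phi> \<Delta> :: "'a::euclidean_space set"
  assumes root_system: "root_system \<Phi>"
    and root_base: "root_base \<Phi> \<Delta>"
begin

abbreviation W :: "('a \<Rightarrow> 'a) set" where "W \<equiv> refl_group \<Delta>"

lemma finite_roots: "finite \<Phi>"
  and root_nonzero: "a \<in> \<Phi> \<Longrightarrow> a \<noteq> 0"
  and span_roots: "span \<Phi> = UNIV"
  and reflection_root: "a \<in> \<Phi> \<Longrightarrow> b \<in> \<Phi> \<Longrightarrow> reflection a b \<in> \<Phi>"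
  and cartan_int_Ints: "a \<in> \<Phi> \<Longrightarrow> b \<in> \<Phi> \<Longrightarrow> cartan_int a b \<in> \<int>"
  and multiple_root: "a \<in> \<Phi> \<Longrightarrow> c *\<^sub>R a \<in> \<Phi> \<Longrightarrow> c = 1 \<or> c = -1"
  using root_system unfolding root_system_def by blast+

lemma base_subset: "\<Delta> \<subseteq> \<Phi>"
  and independent_base: "independent \<Delta>"
  using root_base unfolding root_base_def by blast+

lemma base_root: "a \<in> \<Delta> \<Longrightarrow> a \<in> \<Phi>"
  using base_subset by blast

lemma finite_base: "finite \<Delta>"
  using base_subset finite_roots by (rule finite_subset)

lemma base_nonzero: "a \<in> \<Delta> \<Longrightarrow> a \<noteq> 0"
  using base_root root_nonzero by blast

lemma uminus_root: "a \<in> \<Phi> \<Longrightarrow> - a \<in> \<Phi>"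
  using reflection_root[of a a] by (simp add: reflection_self)

lemma span_base_UNIV: "span \<Delta> = UNIV"
proof -
  have "\<Phi> \<subseteq> span \<Delta>"
  proof
    fix b assume "b \<in> \<Phi>"
    then obtain k :: "'a \<Rightarrow> nat"
      where "b = (\<Sum>a\<in>\<Delta>. real (k a) *\<^sub>R a) \<or> b = - (\<Sum>a\<in>\<Delta>. real (k a) *\<^sub>R a)"
      using root_base unfolding root_base_def by blast
    then show "b \<in> span \<Delta>"
      by (auto intro!: span_neg span_sum span_scale intro: span_base)
  qed
  then show ?thesis
    using span_roots span_minimal[of \<Phi> "span \<Delta>"] by auto
qed

lemma card_base: "card \<Delta> = DIM('a)"
  using independent_base span_base_UNIV
  by (metis dim_UNIV dim_eq_card_independent dim_span)

lemma ex_dual: "\<exists>d. \<forall>a\<in>\<Delta>. \<forall>b\<in>\<Delta>. inner (d a) b = (if a = b then 1 else 0)"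
proof -
  have "\<exists>x. \<forall>b\<in>\<Delta>. inner x b = (if a = b then 1 else 0)" if a: "a \<in> \<Delta>" for a
  proof -
    have "dim (\<Delta> - {a}) \<le> card (\<Delta> - {a})"
      by (rule dim_le_card') (simp add: finite_base)
    also have "\<dots> < DIM('a)"
      using card_base a finite_base by (metis card_Diff1_less)
    finally obtain x where x: "x \<noteq> 0" "\<And>y. y \<in> span (\<Delta> - {a}) \<Longrightarrow> orthogonal x y"
      using orthogonal_to_subspace_exists by metis
    have 0: "inner x b = 0" if "b \<in> \<Delta>" "b \<noteq> a" for b
      using x(2)[of b] that by (simp add: orthogonal_def span_base)
    have "inner x a \<noteq> 0"
    proof
      assume "inner x a = 0"
      with 0 have "\<And>b. b \<in> \<Delta> \<Longrightarrow> orthogonal x b"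
        by (metis orthogonal_def)
      then have "orthogonal x x"
        using orthogonal_to_span[of x \<Delta> x] span_base_UNIV by blast
      then show False using x(1) by (simp add: orthogonal_def)
    qed
    then show ?thesis
      using 0 by (intro exI[of _ "x /\<^sub>R inner x a"]) auto
  qed
  then show ?thesis by metis
qed

text \<open>The basis of the Euclidean space that is dual to the base, that is, the fundamental coweights; they
are positive multiples of the fundamental weights. The coefficient of \<open>x\<close> at a simple root \<open>a\<close> is
\<open>inner (dual a) x\<close>.\<close>

definition dual :: "'a \<Rightarrow> 'a" where
  "dual = (SOME d. \<forall>a\<in>\<Delta>. \<forall>b\<in>\<Delta>. inner (d a) b = (if a = b then 1 else 0))"

lemma inner_dual: "a \<in> \<Delta> \<Longrightarrow> b \<in> \<Delta> \<Longrightarrow> inner (dual a) b = (if a = b then 1 else 0)"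
  using someI_ex[OF ex_dual] unfolding dual_def by blast

lemma inner_dual_sum: 
  assumes "a \<in> \<Delta>"
  shows "inner (dual a) (\<Sum>b\<in>\<Delta>. u b *\<^sub>R b) = u a"
proof -
  have "inner (dual a) (\<Sum>b\<in>\<Delta>. u b *\<^sub>R b) = (\<Sum>b\<in>\<Delta>. if a = b then u b else 0)"
    using assms by (auto simp: inner_sum_right inner_dual intro!: sum.cong)
  then show ?thesis
    using assms finite_base by simp
qed

lemma base_expansion: "x = (\<Sum>a\<in>\<Delta>. inner (dual a) x *\<^sub>R a)"
proof -
  have "x \<in> span \<Delta>"
    using span_base_UNIV by simp
  then obtain u where u: "x = (\<Sum>a\<in>\<Delta>. u a *\<^sub>R a)"
    using span_finite[OF finite_base] by auto
  show ?thesis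
    by (subst u) (auto simp: u inner_dual_sum intro!: sum.cong)
qed

lemma dual_eqI: "(\<And>a. a \<in> \<Delta> \<Longrightarrow> inner (dual a) x = inner (dual a) y) \<Longrightarrow> x = y"
  using base_expansion[of x] base_expansion[of y] by (metis (mono_tags, lifting) sum.cong)

lemma inner_base_expansion: "inner x y = (\<Sum>a\<in>\<Delta>. inner (dual a) y * inner x a)"
  by (subst base_expansion[of y]) (simp add: inner_sum_right)

lemma base_eqI:
  assumes "\<And>a. a \<in> \<Delta> \<Longrightarrow> inner a x = inner a y"
  shows "x = y"
proof -
  have "inner (x - y) a = 0" if "a \<in> \<Delta>" for a
    using assms[OF that] by (simp add: inner_diff_left inner_diff_right inner_commute)
  then have "inner (x - y) (x - y) = 0"
    using inner_base_expansion[of "x - y" "x - y"] by simp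
  then show ?thesis by simp
qed

lemma linear_base_expansion:
  assumes "linear u"
  shows "u x = (\<Sum>a\<in>\<Delta>. inner (dual a) x *\<^sub>R u a)"
  by (subst base_expansion[of x]) (simp add: assms linear_sum linear_scale)

lemma linear_eq_on_base:
  assumes "linear u" "linear v" "\<And>a. a \<in> \<Delta> \<Longrightarrow> u a = v a"
  shows "u = v"
proof
  fix x
  have "(\<Sum>a\<in>\<Delta>. inner (dual a) x *\<^sub>R u a) = (\<Sum>a\<in>\<Delta>. inner (dual a) x *\<^sub>R v a)"
    by (intro sum.cong) (simp_all add: assms)
  then show "u x = v x"
    by (simp only: linear_base_expansion[OF assms(1), of x] linear_base_expansion[OF assms(2), of x])
qed

definition pos_roots :: "'a set" where
  "pos_roots = {b \<in> \<Phi>. \<forall>a\<in>\<Delta>. 0 \<le> inner (dual a) b}"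

lemma finite_pos_roots: "finite pos_roots"
  using finite_roots by (simp add: pos_roots_def)

lemma pos_root: "b \<in> pos_roots \<Longrightarrow> b \<in> \<Phi>"
  by (simp add: pos_roots_def)

lemma coef_root:
  assumes "b \<in> \<Phi>"
  shows "(\<forall>a\<in>\<Delta>. inner (dual a) b \<in> \<nat>) \<or> (\<forall>a\<in>\<Delta>. inner (dual a) (- b) \<in> \<nat>)"
proof -
  obtain k :: "'a \<Rightarrow> nat"
    where "b = (\<Sum>a\<in>\<Delta>. real (k a) *\<^sub>R a) \<or> b = - (\<Sum>a\<in>\<Delta>. real (k a) *\<^sub>R a)"
    using root_base assms unfolding root_base_def by blast
  then show ?thesis
  proof
    assume "b = (\<Sum>a\<in>\<Delta>. real (k a) *\<^sub>R a)"
    then show ?thesis by (simp add: inner_dual_sum)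
  next
    assume "b = - (\<Sum>a\<in>\<Delta>. real (k a) *\<^sub>R a)"
    then show ?thesis by (simp add: inner_dual_sum)
  qed
qed

lemma root_cases: "b \<in> \<Phi> \<Longrightarrow> b \<in> pos_roots \<or> - b \<in> pos_roots"
  using coef_root[of b] uminus_root[of b] Nats_altdef2 by (fastforce simp: pos_roots_def Nats_def)

lemma pos_not_neg: "b \<in> pos_roots \<Longrightarrow> - b \<notin> pos_roots"
proof
  assume b: "b \<in> pos_roots" "- b \<in> pos_roots"
  have "b = 0"
    by (rule dual_eqI) (use b in \<open>force simp: pos_roots_def\<close>)
  then show False
    using b pos_root root_nonzero by blast
qed

lemma coef_pos_root: "b \<in> pos_roots \<Longrightarrow> a \<in> \<Delta> \<Longrightarrow> inner (dual a) b \<in> \<nat>"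
proof -
  assume b: "b \<in> pos_roots" "a \<in> \<Delta>"
  consider "inner (dual a) b \<in> \<nat>" | "\<forall>a\<in>\<Delta>. inner (dual a) (- b) \<in> \<nat>"
    using coef_root[OF pos_root[OF b(1)]] b by blast
  then show ?thesis
  proof cases
    case 2
    then have "- b \<in> pos_roots"
      using uminus_root[OF pos_root[OF b(1)]] by (force simp: pos_roots_def Nats_def)
    then show ?thesis using b pos_not_neg by blast
  qed
qed

lemma base_pos: "a \<in> \<Delta> \<Longrightarrow> a \<in> pos_roots"
  by (simp add: pos_roots_def base_root inner_dual)

lemma pos_if_coef: "b \<in> \<Phi> \<Longrightarrow> a \<in> \<Delta> \<Longrightarrow> 0 < inner (dual a) b \<Longrightarrow> b \<in> pos_roots"
  using root_cases[of b] unfolding pos_roots_def by (smt (verit) inner_minus_right mem_Collect_eq)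

text \<open>As \<open>b\<close> is not a multiple of \<open>a\<close>, it has a positive coefficient at some other simple root, and the
reflection leaves that coefficient unchanged. A single positive coefficient makes a root positive.\<close>

lemma reflection_pos:
  assumes a: "a \<in> \<Delta>" and b: "b \<in> pos_roots" "b \<noteq> a"
  shows "reflection a b \<in> pos_roots"
proof -
  have "\<exists>c\<in>\<Delta>. c \<noteq> a \<and> 0 < inner (dual c) b"
  proof (rule ccontr)
    assume "\<not> ?thesis"
    then have "\<And>c. c \<in> \<Delta> \<Longrightarrow> c \<noteq> a \<Longrightarrow> inner (dual c) b = 0"
      using b by (force simp: pos_roots_def)
    then have eq: "b = inner (dual a) b *\<^sub>R a"
      using a by (intro dual_eqI) (auto simp: inner_dual)
    then have "inner (dual a) b = 1 \<or> inner (dual a) b = -1"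
      using multiple_root[of a "inner (dual a) b"] a b base_root pos_root by metis
    moreover have "0 \<le> inner (dual a) b"
      using a b by (simp add: pos_roots_def)
    ultimately show False using eq b(2) by auto
  qed
  then obtain c where c: "c \<in> \<Delta>" "c \<noteq> a" "0 < inner (dual c) b" by blast
  then have "0 < inner (dual c) (reflection a b)"
    using a by (simp add: reflection_def inner_diff_right inner_dual)
  then show ?thesis
    using pos_if_coef c a b base_root pos_root reflection_root by blast
qed

lemma word_root:
  assumes "set ss \<subseteq> \<Phi>" "b \<in> \<Phi>"
  shows "word ss b \<in> \<Phi>"
  using assms by (induction ss) (auto intro: reflection_root)

lemma W_root: "w \<in> W \<Longrightarrow> b \<in> \<Phi> \<Longrightarrow> w b \<in> \<Phi>"
  using base_subset word_root by (metis refl_groupE subset_trans)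

lemma W_minus: "w \<in> W \<Longrightarrow> w (- x) = - w x"
  by (simp add: linear_neg refl_group_linear)

lemma W_neg_if_base_neg:
  assumes w: "w \<in> W" and base: "\<And>a. a \<in> \<Delta> \<Longrightarrow> - w a \<in> pos_roots" and b: "b \<in> pos_roots"
  shows "- w b \<in> pos_roots"
proof -
  have "inner (dual c) (w b) \<le> 0" if c: "c \<in> \<Delta>" for c
    using base b c
    by (subst linear_base_expansion[OF refl_group_linear[OF w]])
       (auto simp: inner_sum_right pos_roots_def intro!: sum_nonpos mult_nonneg_nonpos)
  then show ?thesis
    using uminus_root[OF W_root[OF w pos_root[OF b]]] by (simp add: pos_roots_def)
qed

text \<open>The inversions of \<open>w\<close> provide a formula for its length that does not refer to words.\<close>

definition inversions :: "('a \<Rightarrow> 'a) \<Rightarrow> 'a set" where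
  "inversions w = {b \<in> pos_roots. - w b \<in> pos_roots}"

lemma finite_inversions: "finite (inversions w)"
  by (simp add: inversions_def finite_pos_roots)

lemma inversions_le: "card (inversions w) \<le> card pos_roots"
  by (rule card_mono) (auto simp: inversions_def finite_pos_roots)

text \<open>The reflection permutes the positive roots other than \<open>a\<close>, so only the status of \<open>a\<close> itself changes.\<close>

lemma inversions_up:
  assumes w: "w \<in> W" and a: "a \<in> \<Delta>" and wa: "w a \<in> pos_roots"
  shows "card (inversions (w \<circ> reflection a)) = Suc (card (inversions w))"
proof -
  have "inversions (w \<circ> reflection a) = insert a (reflection a ` inversions w)" (is "?L = ?R")
  proof
    show "?L \<subseteq> ?R"
    proof
      fix b assume b: "b \<in> ?L"
      show "b \<in> ?R"
      proof (cases "b = a")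
        case False
        then have "reflection a b \<in> inversions w"
          using b a reflection_pos by (simp add: inversions_def)
        then show ?thesis
          by (metis image_eqI insertI2 reflection_reflection)
      qed simp
    qed
    have "a \<in> ?L"
      using a wa w base_pos W_minus[OF w] by (simp add: inversions_def reflection_self)
    moreover have "reflection a c \<in> ?L" if "c \<in> inversions w" for c
    proof -
      have "c \<noteq> a"
        using that wa pos_not_neg by (auto simp: inversions_def)
      then show ?thesis
        using that a reflection_pos by (simp add: inversions_def)
    qed
    ultimately show "?R \<subseteq> ?L" by blast
  qed
  moreover have "a \<notin> reflection a ` inversions w"
  proof
    assume "a \<in> reflection a ` inversions w"
    then obtain c where c: "c \<in> pos_roots" "a = reflection a c"
      by (auto simp: inversions_def)
    then have "c = - a"
      by (metis reflection_reflection reflection_self)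
    then show False using c a base_pos pos_not_neg by blast
  qed
  moreover have "card (reflection a ` inversions w) = card (inversions w)"
    by (rule card_image) (metis inj_onI reflection_reflection)
  ultimately show ?thesis
    by (simp add: finite_inversions)
qed

lemma inversions_down:
  assumes w: "w \<in> W" and a: "a \<in> \<Delta>" and wa: "- w a \<in> pos_roots"
  shows "card (inversions w) = Suc (card (inversions (w \<circ> reflection a)))"
proof -
  have "w \<circ> reflection a \<in> W" "(w \<circ> reflection a) a \<in> pos_roots"
    using w a wa W_minus[OF w] by (auto simp: refl_group_comp refl_group_reflection reflection_self)
  from inversions_up[OF this(1) a this(2)] show ?thesis
    by (simp add: comp_def)
qed

text \<open>Apply the letters of the word to \<open>a\<close> one after the other, beginning with the last. When the root
turns negative, it must have been equal to the simple root of the letter just applied, and that letter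
can be deleted.\<close>

lemma exchange:
  assumes "set ss \<subseteq> \<Delta>" "a \<in> \<Delta>" "- word ss a \<in> pos_roots"
  shows "\<exists>ts. set ts \<subseteq> \<Delta> \<and> Suc (length ts) = length ss \<and> word ts = word ss \<circ> reflection a"
  using assms
proof (induction ss)
  case Nil
  then show ?case using base_pos pos_not_neg by force
next
  case (Cons c ss)
  have root: "word ss a \<in> \<Phi>"
    using Cons.prems base_subset base_root by (intro word_root) auto
  show ?case
  proof (cases "word ss a \<in> pos_roots")
    case True
    have "word ss a = c"
    proof (rule ccontr)
      assume "word ss a \<noteq> c"
      then have "word (c # ss) a \<in> pos_roots"
        using reflection_pos True Cons.prems by simp
      then show False using Cons.prems pos_not_neg by blast
    qed
    then have "word ss b = reflection c (word ss (reflection a b))" for b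
      using arg_cong[OF word_conj[of ss a b], of "reflection c"] by simp
    then have eq: "word ss = word (c # ss) \<circ> reflection a"
      unfolding word_simps comp_def by (rule ext)
    show ?thesis
      using Cons.prems(1) by (intro exI[of _ ss] conjI eq) simp_all
  next
    case False
    then have "- word ss a \<in> pos_roots"
      using root root_cases by blast
    then obtain ts where "set ts \<subseteq> \<Delta>" "Suc (length ts) = length ss"
        "word ts = word ss \<circ> reflection a"
      using Cons.IH Cons.prems(1,2) by (metis insert_subset list.set(2))
    then show ?thesis
      using Cons.prems by (intro exI[of _ "c # ts"]) (auto simp: comp_assoc)
  qed
qed

lemma W_shortest_word:
  assumes "w \<in> W"
  obtains ss where "set ss \<subseteq> \<Delta>" "word ss = w"
    "\<And>ts. set ts \<subseteq> \<Delta> \<Longrightarrow> word ts = w \<Longrightarrow> length ss \<le> length ts"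
proof -
  obtain ss0 where ss0: "set ss0 \<subseteq> \<Delta> \<and> word ss0 = w"
    using assms by (metis refl_groupE)
  from ex_has_least_nat[of "\<lambda>ss. set ss \<subseteq> \<Delta> \<and> word ss = w", OF ss0, of length] that
  show ?thesis by blast
qed

text \<open>Otherwise \<open>w\<close> has a shortest word with a last letter \<open>a\<close>, and the rest of the word makes \<open>a\<close>
negative; by the exchange property the rest can be shortened while the last letter is dropped.\<close>

lemma id_if_base_pos:
  assumes w: "w \<in> W" and pos: "\<And>a. a \<in> \<Delta> \<Longrightarrow> w a \<in> pos_roots"
  shows "w = id"
proof -
  obtain ss where ss: "set ss \<subseteq> \<Delta>" "word ss = w"
    "\<And>ts. set ts \<subseteq> \<Delta> \<Longrightarrow> word ts = w \<Longrightarrow> length ss \<le> length ts"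
    using W_shortest_word[OF w] by blast
  show ?thesis
  proof (cases ss rule: rev_cases)
    case Nil
    then show ?thesis using ss by simp
  next
    case (snoc bs a)
    have ba: "set bs \<subseteq> \<Delta>" "a \<in> \<Delta>" "w = word bs \<circ> reflection a"
      using ss snoc by (auto simp: word_append)
    then have "w a = - word bs a"
      using W_minus[of "word bs" a] by (simp add: reflection_self refl_groupI)
    then obtain ts where "set ts \<subseteq> \<Delta>" "Suc (length ts) = length bs" "word ts = w"
      using exchange[OF ba(1,2)] ba pos by metis
    then show ?thesis
      using ss(3)[of ts] snoc by simp
  qed
qed

lemma ex_descent:
  assumes "w \<in> W" "w \<noteq> id"
  obtains a where "a \<in> \<Delta>" "- w a \<in> pos_roots"
  using id_if_base_pos[OF assms(1)] assms root_cases W_root base_root by metis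

lemma inversions_le_length:
  assumes "set ss \<subseteq> \<Delta>"
  shows "card (inversions (word ss)) \<le> length ss"
  using assms
proof (induction ss rule: rev_induct)
  case Nil
  have "inversions (word []) = {}" using pos_not_neg by (auto simp: inversions_def)
  then show ?case by (simp del: word_simps)
next
  case (snoc a ss)
  have W: "word ss \<in> W" "a \<in> \<Delta>"
    using snoc by (auto intro: refl_groupI)
  have eq: "word (ss @ [a]) = word ss \<circ> reflection a"
    by (simp add: word_append)
  have "word ss a \<in> pos_roots \<or> - word ss a \<in> pos_roots"
    using W root_cases W_root base_root by blast
  then have "card (inversions (word (ss @ [a]))) \<le> Suc (card (inversions (word ss)))"
    using inversions_up[OF W] inversions_down[OF W] unfolding eq by fastforce
  then show ?case using snoc by simp
qed

text \<open>Descents can be removed one at a time, and each removes one inversion.\<close>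

lemma ex_word_of_inversions:
  assumes "w \<in> W"
  shows "\<exists>ss. set ss \<subseteq> \<Delta> \<and> word ss = w \<and> length ss = card (inversions w)"
  using assms
proof (induction "card (inversions w)" arbitrary: w)
  case 0
  have "w = id"
  proof (rule ccontr)
    assume "w \<noteq> id"
    then obtain a where "a \<in> \<Delta>" "- w a \<in> pos_roots"
      using ex_descent 0 by blast
    then have "a \<in> inversions w" using base_pos by (simp add: inversions_def)
    then show False using 0 finite_inversions by (metis card_0_eq empty_iff)
  qed
  then show ?case using 0 by (intro exI[of _ "[]"]) simp
next
  case (Suc n)
  have "w \<noteq> id"
  proof
    assume "w = id"
    then have "inversions w = {}" using pos_not_neg by (auto simp: inversions_def)
    then show False using Suc by simp
  qed
  then obtain a where a: "a \<in> \<Delta>" "- w a \<in> pos_roots"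
    using ex_descent Suc by blast
  let ?v = "w \<circ> reflection a"
  have "n = card (inversions ?v)" "?v \<in> W"
    using inversions_down[OF Suc.prems a] Suc a by (simp_all add: refl_group_comp refl_group_reflection)
  then obtain ss where "set ss \<subseteq> \<Delta>" "word ss = ?v" "length ss = n"
    using Suc.hyps(1) by metis
  then show ?case using a Suc.hyps(2)
    by (intro exI[of _ "ss @ [a]"]) (auto simp: word_append fun_eq_iff)
qed

lemma word_length_eq_inversions:
  assumes "w \<in> W"
  shows "word_length \<Delta> w = card (inversions w)"
  unfolding word_length_eq
  by (rule Least_equality) (use ex_word_of_inversions[OF assms] inversions_le_length in auto)

lemma ex_longest: "\<exists>w\<in>W. \<forall>a\<in>\<Delta>. - w a \<in> pos_roots"
proof -
  obtain w where w: "w \<in> W" "\<And>v. v \<in> W \<Longrightarrow> card (inversions v) \<le> card (inversions w)"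
    using ex_has_greatest_nat[of "\<lambda>w. w \<in> W" id "\<lambda>w. card (inversions w)" "Suc (card pos_roots)"]
      refl_group_id inversions_le by (metis le_imp_less_Suc)
  have "- w a \<in> pos_roots" if a: "a \<in> \<Delta>" for a
  proof (rule ccontr)
    assume "- w a \<notin> pos_roots"
    then have "w a \<in> pos_roots"
      using W_root[OF w(1)] base_root a root_cases by blast
    from inversions_up[OF w(1) a this] w(2)[of "w \<circ> reflection a"] show False
      using w(1) a by (simp add: refl_group_comp refl_group_reflection)
  qed
  then show ?thesis using w by blast
qed

lemma longest_unique:
  assumes w: "w \<in> W" "\<And>a. a \<in> \<Delta> \<Longrightarrow> - w a \<in> pos_roots"
    and v: "v \<in> W" "\<And>a. a \<in> \<Delta> \<Longrightarrow> - v a \<in> pos_roots"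
  shows "w = v"
proof -
  let ?u = "inv_into UNIV v \<circ> w"
  have "?u a \<in> pos_roots" if a: "a \<in> \<Delta>" for a
  proof (rule ccontr)
    assume "?u a \<notin> pos_roots"
    moreover have "?u a \<in> \<Phi>"
      using W_root[OF refl_group_inv[OF v(1)] W_root[OF w(1) base_root[OF a]]] by simp
    ultimately have "- ?u a \<in> pos_roots"
      using root_cases by blast
    then have "- v (- ?u a) \<in> pos_roots"
      using W_neg_if_base_neg v by blast
    then have "w a \<in> pos_roots"
      using v(1) W_minus[OF v(1)] by simp
    then show False using w a pos_not_neg by blast
  qed
  then have "?u = id"
    using id_if_base_pos[of ?u] w v by (simp add: refl_group_comp refl_group_inv)
  then have "v (?u x) = v x" for x by simp
  then show ?thesis using v by auto
qed

text \<open>An element that makes all simple roots negative inverts all positive roots, so its length is maximal.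
This is the criterion by which the longest element is recognised in each type.\<close>

lemma longest_word_eqI:
  assumes w: "w \<in> W" "\<And>a. a \<in> \<Delta> \<Longrightarrow> - w a \<in> pos_roots"
  shows "longest_word \<Delta> = w"
  unfolding longest_word_def carrier_weyl_group
proof (rule the_equality)
  have all: "inversions w = pos_roots"
    using W_neg_if_base_neg[OF w] by (auto simp: inversions_def)
  then show "w \<in> W \<and> (\<forall>v\<in>W. word_length \<Delta> v \<le> word_length \<Delta> w)"
    using w inversions_le by (simp add: word_length_eq_inversions)
  fix v assume v: "v \<in> W \<and> (\<forall>u\<in>W. word_length \<Delta> u \<le> word_length \<Delta> v)"
  then have "card pos_roots \<le> card (inversions v)"
    using w all by (metis word_length_eq_inversions)
  then have "inversions v = pos_roots"
    using card_subset_eq[OF finite_pos_roots, of "inversions v"] inversions_le[of v]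
    by (force simp: inversions_def)
  then have "- v a \<in> pos_roots" if "a \<in> \<Delta>" for a
    using base_pos[OF that] by (auto simp: inversions_def)
  then show "v = w"
    using longest_unique w v by blast
qed

abbreviation w0 :: "'a \<Rightarrow> 'a" where "w0 \<equiv> longest_word \<Delta>"

lemma w0_in_W: "w0 \<in> W" and w0_neg: "a \<in> \<Delta> \<Longrightarrow> - w0 a \<in> pos_roots"
proof -
  obtain w where w: "w \<in> W" "\<And>a. a \<in> \<Delta> \<Longrightarrow> - w a \<in> pos_roots"
    using ex_longest by blast
  with longest_word_eqI[OF w] show "w0 \<in> W" "a \<in> \<Delta> \<Longrightarrow> - w0 a \<in> pos_roots" by auto
qed

lemma w0_pos: "b \<in> pos_roots \<Longrightarrow> - w0 b \<in> pos_roots"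
  using W_neg_if_base_neg[OF w0_in_W] w0_neg by blast

lemma w0_involution: "w0 (w0 x) = x"
proof -
  have "- inv_into UNIV w0 a \<in> pos_roots" if a: "a \<in> \<Delta>" for a
  proof (rule ccontr)
    assume "- inv_into UNIV w0 a \<notin> pos_roots"
    then have "inv_into UNIV w0 a \<in> pos_roots"
      using W_root[OF refl_group_inv[OF w0_in_W]] base_root a root_cases by blast
    from w0_pos[OF this] show False
      using a w0_in_W base_pos pos_not_neg by simp
  qed
  then have "inv_into UNIV w0 = w0"
    using longest_unique w0_in_W w0_neg refl_group_inv by metis
  then show ?thesis
    using w0_in_W by (metis refl_group_inv_cancel(1))
qed

lemma w0_eq_minus:
  assumes "w \<in> W" "\<And>x. w x = - x"
  shows "w0 x = - x"
  using longest_word_eqI[of w] assms base_pos by simp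

text \<open>Write the positive root \<open>- w0 a\<close> in terms of the base. Applying \<open>- w0\<close> again expresses \<open>a\<close>, whose height
is one, as a combination of positive roots with the same coefficients. As positive roots have height
at least one, these coefficients sum to at most one, which makes \<open>- w0 a\<close> simple.\<close>

lemma opposite_base:
  assumes a: "a \<in> \<Delta>"
  shows "- w0 a \<in> \<Delta>"
proof -
  define ht where "ht x = (\<Sum>c\<in>\<Delta>. inner (dual c) x)" for x
  have ex1: "\<exists>c\<in>\<Delta>. 1 \<le> inner (dual c) b" if b: "b \<in> pos_roots" for b
  proof (rule ccontr)
    assume none: "\<not> ?thesis"
    have "inner (dual c) b = 0" if c: "c \<in> \<Delta>" for c
    proof -
      obtain n where "inner (dual c) b = real n"
        using coef_pos_root[OF b c] by (auto simp: Nats_def)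
      then show ?thesis using none c by (cases n) force+
    qed
    then have "b = 0" by (intro dual_eqI) simp
    then show False using b pos_root root_nonzero by blast
  qed
  have nonneg: "0 \<le> inner (dual c) b" if "b \<in> pos_roots" "c \<in> \<Delta>" for b c
    using that by (simp add: pos_roots_def)
  have ht1: "1 \<le> ht b" if b: "b \<in> pos_roots" for b
  proof -
    obtain c where "c \<in> \<Delta>" "1 \<le> inner (dual c) b" using ex1 b by blast
    then show ?thesis
      unfolding ht_def
      using member_le_sum[of c \<Delta> "\<lambda>c. inner (dual c) b"] nonneg[OF b] finite_base by force
  qed
  let ?b = "- w0 a"
  have b: "?b \<in> pos_roots" using a w0_neg by blast
  have "a = - w0 ?b"
    using W_minus[OF w0_in_W, of "w0 a"] by (simp add: w0_involution)
  also have "\<dots> = (\<Sum>c\<in>\<Delta>. inner (dual c) ?b *\<^sub>R (- w0 c))"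
    by (subst linear_base_expansion[OF refl_group_linear[OF w0_in_W], of ?b])
       (simp only: sum_negf[symmetric] scaleR_minus_right)
  finally have "ht a = ht (\<Sum>c\<in>\<Delta>. inner (dual c) ?b *\<^sub>R (- w0 c))" by simp
  also have "\<dots> = (\<Sum>c\<in>\<Delta>. inner (dual c) ?b * ht (- w0 c))"
    unfolding ht_def inner_sum_right sum_distrib_left inner_scaleR_right
    by (rule sum.swap)
  also have "\<dots> \<ge> (\<Sum>c\<in>\<Delta>. inner (dual c) ?b * 1)"
    using nonneg[OF b] ht1 w0_neg by (intro sum_mono mult_left_mono) auto
  finally have "ht ?b \<le> ht a" by (simp add: ht_def)
  also have "ht a = 1"
    using a finite_base by (simp add: ht_def inner_dual)
  finally have le1: "ht ?b \<le> 1" .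
  obtain c where c: "c \<in> \<Delta>" "1 \<le> inner (dual c) ?b" using ex1 b by blast
  have split: "ht ?b = inner (dual c) ?b + (\<Sum>d\<in>\<Delta> - {c}. inner (dual d) ?b)"
    unfolding ht_def using c finite_base by (subst sum.remove[of _ c]) auto
  have "0 \<le> (\<Sum>d\<in>\<Delta> - {c}. inner (dual d) ?b)"
    by (intro sum_nonneg) (use nonneg[OF b] in auto)
  then have "(\<Sum>d\<in>\<Delta> - {c}. inner (dual d) ?b) = 0" and c1: "inner (dual c) ?b = 1"
    using split le1 c by linarith+
  then have "\<forall>d\<in>\<Delta> - {c}. inner (dual d) ?b = 0"
    using finite_base nonneg[OF b] by (subst (asm) sum_nonneg_eq_0_iff) auto
  with c1 c have "?b = c"
    by (intro dual_eqI) (auto simp: inner_dual)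
  then show ?thesis using c by simp
qed

section \<open>Parabolic subgroups as stabilisers\<close>

text \<open>If \<open>a\<close> is a descent of \<open>w\<close>, then \<open>inner a x = inner (w a) x\<close> is both nonnegative and nonpositive because
\<open>x\<close> is dominant. So the reflection in \<open>a\<close> fixes \<open>x\<close>, and it can be split off from \<open>w\<close>.\<close>

lemma stabiliser_of_dominant:
  assumes "w \<in> W" "w x = x" and dom: "\<And>a. a \<in> \<Delta> \<Longrightarrow> 0 \<le> inner a x"
  shows "w \<in> refl_group {a \<in> \<Delta>. inner a x = 0}"
  using assms(1,2)
proof (induction "card (inversions w)" arbitrary: w rule: less_induct)
  case less
  show ?case
  proof (cases "w = id")
    case True
    then show ?thesis using refl_group_id by blast
  next
    case False
    then obtain a where a: "a \<in> \<Delta>" "- w a \<in> pos_roots"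
      using ex_descent less.prems by blast
    have "inner a x = inner (w a) x"
      using refl_group_inner[OF less.prems(1), of a x] less.prems(2) by simp
    also have "- inner (w a) x = (\<Sum>c\<in>\<Delta>. inner (dual c) (- w a) * inner x c)"
      using inner_base_expansion[of x "- w a"] by (simp add: inner_commute)
    moreover have "0 \<le> (\<Sum>c\<in>\<Delta>. inner (dual c) (- w a) * inner x c)"
      using a dom by (intro sum_nonneg mult_nonneg_nonneg) (auto simp: pos_roots_def inner_commute)
    ultimately have a0: "inner a x = 0"
      using dom[OF a(1)] by linarith
    then have "reflection a x = x"
      by (simp add: reflection_def cartan_int_def inner_commute)
    moreover have "card (inversions (w \<circ> reflection a)) < card (inversions w)"
      using inversions_down[OF less.prems(1) a] by simp
    moreover have "w \<circ> reflection a \<in> W"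
      using less.prems a by (simp add: refl_group_comp refl_group_reflection)
    ultimately have 1: "w \<circ> reflection a \<in> refl_group {a \<in> \<Delta>. inner a x = 0}"
      using less by simp
    have "reflection a \<in> refl_group {a \<in> \<Delta>. inner a x = 0}"
      using a a0 by (intro refl_group_reflection) simp
    from refl_group_comp[OF 1 this] show ?thesis
      by (simp add: comp_def)
  qed
qed

text \<open>The sum of the dual vectors outside \<open>J\<close> is dominant and orthogonal to exactly those simple roots that
lie in \<open>J\<close>.\<close>

lemma parabolic_iff_fixes_dual:
  assumes J: "J \<subseteq> \<Delta>"
  shows "w \<in> refl_group J \<longleftrightarrow> w \<in> W \<and> (\<forall>b\<in>\<Delta> - J. w (dual b) = dual b)"
proof
  assume "w \<in> refl_group J"
  then obtain ss where ss: "set ss \<subseteq> J" "w = word ss" by (rule refl_groupE)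
  have "word ss (dual b) = dual b" if b: "b \<in> \<Delta> - J" for b
    using ss(1)
  proof (induction ss)
    case (Cons a ss)
    then have "inner (dual b) a = 0" using J b by (auto simp: inner_dual)
    then show ?case using Cons by (simp add: reflection_def cartan_int_def)
  qed simp
  then show "w \<in> W \<and> (\<forall>b\<in>\<Delta> - J. w (dual b) = dual b)"
    using ss J by (auto intro!: refl_groupI)
next
  assume w: "w \<in> W \<and> (\<forall>b\<in>\<Delta> - J. w (dual b) = dual b)"
  define x where "x = (\<Sum>b\<in>\<Delta> - J. dual b)"
  have "w x = x"
    unfolding x_def using w linear_sum[OF refl_group_linear[OF conjunct1[OF w]], of dual] by simp
  moreover have ax: "inner a x = (if a \<in> J then 0 else 1)" if "a \<in> \<Delta>" for a
  proof -
    have "inner a x = (\<Sum>b\<in>\<Delta> - J. if b = a then 1 else 0)"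
      unfolding x_def inner_sum_right using that
      by (intro sum.cong) (auto simp: inner_commute[of a] inner_dual)
    then show ?thesis using that finite_base by simp
  qed
  ultimately have "w \<in> refl_group {a \<in> \<Delta>. inner a x = 0}"
    using w by (intro stabiliser_of_dominant) auto
  also have "{a \<in> \<Delta>. inner a x = 0} = J"
    using ax J by (auto split: if_splits)
  finally show "w \<in> refl_group J" .
qed

text \<open>The representatives of the cosets that are counted: as \<open>inv u w0 u\<close> lies in the parabolic subgroup iff
it fixes the dual vectors outside \<open>J\<close>, the condition says that \<open>w0\<close> fixes their images under \<open>u\<close>.\<close>

definition fixed_reps :: "'a set \<Rightarrow> ('a \<Rightarrow> 'a) set" where
  "fixed_reps J = {u \<in> W. \<forall>b\<in>\<Delta> - J. w0 (u (dual b)) = u (dual b)}"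

lemma inv_comp_parabolic_iff:
  assumes "J \<subseteq> \<Delta>" "u \<in> W" "v \<in> W"
  shows "inv_into UNIV u \<circ> v \<in> refl_group J \<longleftrightarrow> (\<forall>b\<in>\<Delta> - J. v (dual b) = u (dual b))"
proof -
  have "inv_into UNIV u \<circ> v \<in> W"
    using assms by (simp add: refl_group_comp refl_group_inv)
  moreover have "(inv_into UNIV u \<circ> v) x = x \<longleftrightarrow> v x = u x" for x
    using assms by (metis comp_apply refl_group_inv_cancel)
  ultimately show ?thesis
    by (simp add: parabolic_iff_fixes_dual[OF assms(1)])
qed

lemma l_coset_weyl_group:
  assumes "J \<subseteq> \<Delta>" "u \<in> W"
  shows "u <#\<^bsub>weyl_group \<Delta>\<^esub> refl_group J = (\<lambda>p. u \<circ> p) ` refl_group J"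
proof -
  have "u \<otimes>\<^bsub>weyl_group \<Delta>\<^esub> p = u \<circ> p" if "p \<in> refl_group J" for p
    using that mult_weyl_group[OF assms(2)] refl_group_mono[OF assms(1)] by blast
  then show ?thesis
    unfolding l_coset_def image_def by blast
qed

lemma l_coset_eq_iff:
  assumes J: "J \<subseteq> \<Delta>" and u: "u \<in> W" and v: "v \<in> W"
  shows "u <#\<^bsub>weyl_group \<Delta>\<^esub> refl_group J = v <#\<^bsub>weyl_group \<Delta>\<^esub> refl_group J \<longleftrightarrow>
    (\<forall>b\<in>\<Delta> - J. u (dual b) = v (dual b))" (is "?L \<longleftrightarrow> ?R")
proof
  assume ?L
  then have "v \<circ> id \<in> (\<lambda>p. u \<circ> p) ` refl_group J"
    unfolding l_coset_weyl_group[OF J u] l_coset_weyl_group[OF J v]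
    using refl_group_id by blast
  then obtain p where "p \<in> refl_group J" "v = u \<circ> p" by auto
  then show ?R
    using parabolic_iff_fixes_dual[OF J] by auto
next
  assume R: ?R
  have sub: "(\<lambda>p. u \<circ> p) ` refl_group J \<subseteq> (\<lambda>p. v \<circ> p) ` refl_group J"
    if u: "u \<in> W" and v: "v \<in> W" and R: "\<forall>b\<in>\<Delta> - J. u (dual b) = v (dual b)" for u v
  proof
    fix w assume "w \<in> (\<lambda>p. u \<circ> p) ` refl_group J"
    then obtain p where p: "p \<in> refl_group J" "w = u \<circ> p" by auto
    have "inv_into UNIV v \<circ> u \<in> refl_group J"
      using inv_comp_parabolic_iff[OF J v u] R by simp
    then have "(inv_into UNIV v \<circ> u) \<circ> p \<in> refl_group J"
      using p refl_group_comp by blast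
    moreover have "w = v \<circ> ((inv_into UNIV v \<circ> u) \<circ> p)"
      using v p by (auto simp: fun_eq_iff)
    ultimately show "w \<in> (\<lambda>p. v \<circ> p) ` refl_group J" by blast
  qed
  show ?L
    unfolding l_coset_weyl_group[OF J u] l_coset_weyl_group[OF J v]
    using sub[OF u v R] sub[OF v u] R by auto
qed

text \<open>Any function \<open>F\<close> that separates cosets may be used to count them. In the different types it will be
the image of a vector, a pair of images, or a colouring.\<close>

lemma a_P_eq_card:
  assumes J: "J \<subseteq> \<Delta>"
    and F: "\<And>u v. u \<in> fixed_reps J \<Longrightarrow> v \<in> fixed_reps J \<Longrightarrow>
      F u = F v \<longleftrightarrow> (\<forall>b\<in>\<Delta> - J. u (dual b) = v (dual b))"
  shows "a_P \<Delta> J = card (F ` fixed_reps J)"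
proof -
  let ?C = "\<lambda>u. u <#\<^bsub>weyl_group \<Delta>\<^esub> refl_group J"
  have cond: "inv\<^bsub>weyl_group \<Delta>\<^esub> u \<otimes>\<^bsub>weyl_group \<Delta>\<^esub> w0 \<otimes>\<^bsub>weyl_group \<Delta>\<^esub> u \<in> refl_group J
      \<longleftrightarrow> u \<in> fixed_reps J" if u: "u \<in> W" for u
  proof -
    have "inv\<^bsub>weyl_group \<Delta>\<^esub> u \<otimes>\<^bsub>weyl_group \<Delta>\<^esub> w0 \<otimes>\<^bsub>weyl_group \<Delta>\<^esub> u = inv_into UNIV u \<circ> (w0 \<circ> u)"
      using u w0_in_W by (simp add: inv_weyl_group mult_weyl_group refl_group_inv refl_group_comp comp_assoc)
    then show ?thesis
      using inv_comp_parabolic_iff[OF J u refl_group_comp[OF w0_in_W u]] u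
      by (simp add: fixed_reps_def)
  qed
  have "{X \<in> lcosets\<^bsub>weyl_group \<Delta>\<^esub> (refl_group J). \<exists>u\<in>W. X = ?C u \<and>
      inv\<^bsub>weyl_group \<Delta>\<^esub> u \<otimes>\<^bsub>weyl_group \<Delta>\<^esub> w0 \<otimes>\<^bsub>weyl_group \<Delta>\<^esub> u \<in> refl_group J}
      = ?C ` fixed_reps J"
    using cond by (fastforce simp: LCOSETS_def carrier_weyl_group fixed_reps_def)
  then have "a_P \<Delta> J = card (?C ` fixed_reps J)"
    by (simp add: a_P_def parabolic_eq_refl_group[OF J] carrier_weyl_group)
  also have "\<dots> = card (F ` fixed_reps J)"
  proof -
    have iff: "?C u = ?C v \<longleftrightarrow> F u = F v" if "u \<in> fixed_reps J" "v \<in> fixed_reps J" for u v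
      using that F[OF that] l_coset_eq_iff[OF J] by (simp add: fixed_reps_def)
    let ?g = "inv_into (fixed_reps J) ?C"
    have g: "?g X \<in> fixed_reps J" "?C (?g X) = X" if "X \<in> ?C ` fixed_reps J" for X
      using that inv_into_into f_inv_into_f by metis+
    have "bij_betw (F \<circ> ?g) (?C ` fixed_reps J) (F ` fixed_reps J)"
      unfolding bij_betw_def
    proof
      show "inj_on (F \<circ> ?g) (?C ` fixed_reps J)"
      proof (rule inj_onI)
        fix X Y assume XY: "X \<in> ?C ` fixed_reps J" "Y \<in> ?C ` fixed_reps J"
          and "(F \<circ> ?g) X = (F \<circ> ?g) Y"
        then have "?C (?g X) = ?C (?g Y)"
          using iff[OF g(1)[OF XY(1)] g(1)[OF XY(2)]] by simp
        then show "X = Y"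
          using g(2)[OF XY(1)] g(2)[OF XY(2)] by simp
      qed
      show "(F \<circ> ?g) ` ?C ` fixed_reps J = F ` fixed_reps J"
      proof
        show "F ` fixed_reps J \<subseteq> (F \<circ> ?g) ` ?C ` fixed_reps J"
        proof
          fix y assume "y \<in> F ` fixed_reps J"
          then obtain u where u: "u \<in> fixed_reps J" "y = F u" by blast
          then have "F (?g (?C u)) = F u"
            using g[of "?C u"] iff by blast
          then show "y \<in> (F \<circ> ?g) ` ?C ` fixed_reps J"
            using u by (metis comp_apply imageI)
        qed
      qed (use g in auto)
    qed
    then show ?thesis by (rule bij_betw_same_card)
  qed
  finally show ?thesis .
qed

corollary a_P_nonzero:
  assumes J: "J \<subseteq> \<Delta>" and "a_P \<Delta> J \<noteq> 0"
  shows "fixed_reps J \<noteq> {}"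
  using a_P_eq_card[OF J, of "\<lambda>u. ()"] assms(2) by auto

section \<open>The Dynkin diagram\<close>

lemma base_obtuse:
  assumes "a \<in> \<Delta>" "b \<in> \<Delta>" "a \<noteq> b"
  shows "inner a b \<le> 0"
proof -
  have "reflection a b \<in> pos_roots"
    using assms reflection_pos base_pos by blast
  then have "0 \<le> inner (dual a) (reflection a b)"
    using assms by (simp add: pos_roots_def)
  then have "cartan_int b a \<le> 0"
    using assms by (simp add: reflection_def inner_diff_right inner_dual)
  moreover have "0 < inner a a"
    using assms base_nonzero by simp
  ultimately show ?thesis
    by (simp add: cartan_int_def inner_commute divide_le_0_iff)
qed

definition adj :: "'a \<Rightarrow> 'a \<Rightarrow> bool" where
  "adj a b \<longleftrightarrow> a \<in> \<Delta> \<and> b \<in> \<Delta> \<and> a \<noteq> b \<and> inner a b \<noteq> 0"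

text \<open>The number of lines by which two nodes of the Dynkin diagram are joined. Its square root is the
strength, which is also twice the cosine of the angle between \<open>a\<close> and \<open>- b\<close>.\<close>

definition bond :: "'a \<Rightarrow> 'a \<Rightarrow> real" where
  "bond a b = cartan_int a b * cartan_int b a"

definition strength :: "'a \<Rightarrow> 'a \<Rightarrow> real" where
  "strength a b = - 2 * inner a b / (norm a * norm b)"

lemma adj_sym: "adj a b \<Longrightarrow> adj b a"
  by (auto simp: adj_def inner_commute)

lemma adj_base: "adj a b \<Longrightarrow> a \<in> \<Delta>" "adj a b \<Longrightarrow> b \<in> \<Delta>" "adj a b \<Longrightarrow> a \<noteq> b"
  by (auto simp: adj_def)

lemma bond_sym: "bond a b = bond b a"
  by (simp add: bond_def mult.commute)

lemma strength_sym: "strength a b = strength b a"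
  by (simp add: strength_def inner_commute mult.commute)

lemma strength_nonneg: "a \<in> \<Delta> \<Longrightarrow> b \<in> \<Delta> \<Longrightarrow> a \<noteq> b \<Longrightarrow> 0 \<le> strength a b"
  using base_obtuse[of a b] by (simp add: strength_def divide_nonpos_nonneg)

lemma strength_squared: "strength a b * strength a b = bond a b"
  by (simp add: strength_def bond_def cartan_int_def inner_commute power2_norm_eq_inner[symmetric]
      power2_eq_square)

lemma bond_Ints: "a \<in> \<Delta> \<Longrightarrow> b \<in> \<Delta> \<Longrightarrow> bond a b \<in> \<int>"
  by (simp add: bond_def cartan_int_Ints base_root)

lemma bond_ge_1: 
  assumes "adj a b"
  shows "1 \<le> bond a b"
proof -
  have "strength a b \<noteq> 0"
    using assms base_nonzero by (auto simp: adj_def strength_def)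
  then have "0 < bond a b"
    using strength_squared[of a b] by (metis not_real_square_gt_zero)
  moreover obtain k where "bond a b = of_int k"
    using bond_Ints[of a b] adj_base[OF assms] by (auto elim: Ints_cases)
  ultimately show ?thesis by simp
qed

lemma strength_ge_1:
  assumes "adj a b"
  shows "1 \<le> strength a b"
proof (rule ccontr)
  assume "\<not> 1 \<le> strength a b"
  then have "strength a b * strength a b < 1 * 1"
    using strength_nonneg assms by (intro mult_strict_mono') (auto simp: adj_def)
  then show False
    using bond_ge_1[OF assms] by (simp add: strength_squared)
qed

text \<open>For the combination \<open>v\<close> of the normalised simple roots with coefficients \<open>c\<close>, the hypothesis says that
\<open>inner v b \<le> 0\<close> at each node \<open>b\<close> of the support. Then \<open>inner v v \<le> 0\<close>, although \<open>v \<noteq> 0\<close>. The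
marks of an affine diagram are of this kind. A set \<open>S\<close> of convenient neighbours is enough, since the
remaining terms are nonnegative.\<close>

lemma no_subadditive:
  assumes nonneg: "\<And>b. b \<in> \<Delta> \<Longrightarrow> 0 \<le> c b" and x: "x \<in> \<Delta>" "0 < c x"
    and sub: "\<And>b. b \<in> \<Delta> \<Longrightarrow> 0 < c b \<Longrightarrow>
      \<exists>S\<subseteq>\<Delta> - {b}. 2 * c b \<le> (\<Sum>a\<in>S. c a * strength a b)"
  shows False
proof -
  define v where "v = (\<Sum>a\<in>\<Delta>. (c a / norm a) *\<^sub>R a)"
  have le: "(c b / norm b) * inner v b \<le> 0" if b: "b \<in> \<Delta>" for b
  proof (cases "0 < c b")
    case True
    have nb: "0 < norm b" using b base_nonzero by simp
    obtain S where S: "S \<subseteq> \<Delta> - {b}" "2 * c b \<le> (\<Sum>a\<in>S. c a * strength a b)"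
      using sub b True by blast
    have "(\<Sum>a\<in>S. c a * strength a b) \<le> (\<Sum>a\<in>\<Delta> - {b}. c a * strength a b)"
      using S b finite_base nonneg strength_nonneg by (intro sum_mono2) auto
    with S have S': "2 * c b \<le> (\<Sum>a\<in>\<Delta> - {b}. c a * strength a b)" by simp
    have "inner v b = (\<Sum>a\<in>\<Delta>. (c a / norm a) * inner a b)"
      by (simp add: v_def inner_sum_left)
    also have "\<dots> = (c b / norm b) * inner b b + (\<Sum>a\<in>\<Delta> - {b}. (c a / norm a) * inner a b)"
      using b finite_base by (subst sum.remove[of _ b]) auto
    also have "(c b / norm b) * inner b b = norm b * c b"
      using nb by (simp add: power2_norm_eq_inner[symmetric] power2_eq_square)
    also have "(\<Sum>a\<in>\<Delta> - {b}. (c a / norm a) * inner a b)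
        = (\<Sum>a\<in>\<Delta> - {b}. norm b * (- (c a * strength a b) / 2))"
      using nb by (intro sum.cong) (auto simp: strength_def)
    also have "\<dots> = norm b * (- (\<Sum>a\<in>\<Delta> - {b}. c a * strength a b) / 2)"
      by (simp add: sum_distrib_left[symmetric] sum_negf sum_divide_distrib[symmetric])
    also have "norm b * c b + \<dots> = norm b * (c b - (\<Sum>a\<in>\<Delta> - {b}. c a * strength a b) / 2)"
      by (simp add: algebra_simps)
    also have "\<dots> \<le> 0"
      using S' nb by (intro mult_nonneg_nonpos) auto
    finally show ?thesis
      using True nb by (intro mult_nonneg_nonpos) auto
  next
    case False
    then show ?thesis using nonneg[OF b] by simp
  qed
  have "inner v v = (\<Sum>b\<in>\<Delta>. (c b / norm b) * inner v b)"
    by (subst (2) v_def) (simp add: inner_sum_right)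
  also have "\<dots> \<le> 0"
    by (intro sum_nonpos le)
  finally have "v = 0"
    by (metis inner_eq_zero_iff inner_ge_zero order_antisym)
  then have "c x / norm x = 0"
    using inner_dual_sum[OF x(1), of "\<lambda>a. c a / norm a"] by (simp add: v_def)
  then show False
    using x base_nonzero by auto
qed

text \<open>Otherwise the function that is one on \<open>a\<close> and \<open>b\<close> would be subadditive.\<close>

lemma bond_lt_4:
  assumes "adj a b"
  shows "bond a b < 4"
proof (rule ccontr)
  assume "\<not> bond a b < 4"
  have "2 \<le> strength a b"
  proof (rule ccontr)
    assume "\<not> 2 \<le> strength a b"
    then have "strength a b * strength a b < 2 * 2"
      using strength_nonneg assms by (intro mult_strict_mono') (auto simp: adj_def)
    then show False using \<open>\<not> bond a b < 4\<close> by (simp add: strength_squared)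
  qed
  moreover define c :: "'a \<Rightarrow> real" where "c y = (if y = a \<or> y = b then 1 else 0)" for y
  ultimately have "2 * c y \<le> (\<Sum>z\<in>(if y = a then {b} else {a}). c z * strength z y)"
    if "0 < c y" for y
    using that strength_sym[of a b] by (auto split: if_splits)
  then have "\<exists>S\<subseteq>\<Delta> - {y}. 2 * c y \<le> (\<Sum>z\<in>S. c z * strength z y)" if "0 < c y" for y
    using that adj_base[OF assms] by (intro exI[of _ "if y = a then {b} else {a}"]) (auto simp: c_def split: if_splits)
  moreover have "0 \<le> c y" "0 < c a" for y by (auto simp: c_def)
  ultimately show False
    using no_subadditive[of c a] adj_base(1)[OF assms] by blast
qed

definition dpath :: "'a list \<Rightarrow> bool" where
  "dpath p \<longleftrightarrow> p \<noteq> [] \<and> distinct p \<and> set p \<subseteq> \<Delta> \<and> (\<forall>i. Suc i < length p \<longrightarrow> adj (p ! i) (p ! Suc i))"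

lemma dpathD:
  assumes "dpath p"
  shows "p \<noteq> []" "distinct p" "set p \<subseteq> \<Delta>" "Suc i < length p \<Longrightarrow> adj (p ! i) (p ! Suc i)"
  using assms by (auto simp: dpath_def)

lemma dpath_singleton: "a \<in> \<Delta> \<Longrightarrow> dpath [a]"
  by (simp add: dpath_def)

lemma dpath_Cons: "dpath p \<Longrightarrow> adj a (hd p) \<Longrightarrow> a \<notin> set p \<Longrightarrow> dpath (a # p)"
  by (auto simp: dpath_def nth_Cons hd_conv_nth adj_base split: nat.splits)

lemma dpath_rev:
  assumes "dpath p"
  shows "dpath (rev p)"
proof -
  have "adj (rev p ! i) (rev p ! Suc i)" if "Suc i < length p" for i
  proof -
    have "adj (p ! (length p - Suc (Suc i))) (p ! (Suc (length p - Suc (Suc i))))"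
      using assms that by (intro dpathD(4)) auto
    moreover have "Suc (length p - Suc (Suc i)) = length p - Suc i"
      using that by simp
    ultimately show ?thesis
      using that by (simp add: rev_nth adj_sym)
  qed
  then show ?thesis
    using assms by (simp add: dpath_def)
qed

lemma dpath_snoc:
  assumes "dpath p" "adj (last p) a" "a \<notin> set p"
  shows "dpath (p @ [a])"
proof -
  have "dpath (a # rev p)"
    using assms dpathD(1) by (intro dpath_Cons dpath_rev) (auto simp: hd_rev adj_sym)
  from dpath_rev[OF this] show ?thesis by simp
qed

lemma dpath_segment:
  assumes "dpath p" "i \<le> j" "j < length p"
  shows "dpath (take (Suc j - i) (drop i p))" (is "dpath ?q")
    and "hd (take (Suc j - i) (drop i p)) = p ! i" and "last (take (Suc j - i) (drop i p)) = p ! j"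
    and "length (take (Suc j - i) (drop i p)) = Suc j - i"
proof -
  show len: "length ?q = Suc j - i" using assms by simp
  then have ne: "?q \<noteq> []" using assms by (metis Suc_diff_le length_0_conv nat.simps(3))
  have "set ?q \<subseteq> set p"
    by (meson set_drop_subset set_take_subset subset_trans)
  then show "dpath ?q"
    using ne assms by (auto simp: dpath_def)
  show "hd ?q = p ! i"
    using ne assms by (simp add: hd_conv_nth del: hd_take)
  show "last ?q = p ! j"
    using ne len assms by (simp add: last_conv_nth)
qed

text \<open>The subadditive function is two along the path and the strength of the bond on the end nodes. If all
bonds are simple, these are the marks of the affine diagram of type \<open>D\<close>. A multiple bond counts like
two end nodes.\<close>

lemma two_ends:
  assumes p: "dpath p" and E: "E \<subseteq> \<Delta> - set p" and F: "F \<subseteq> \<Delta> - set p" and EF: "E \<inter> F = {}"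
    and sumE: "2 \<le> (\<Sum>a\<in>E. bond a (hd p))" and sumF: "2 \<le> (\<Sum>a\<in>F. bond a (last p))"
  shows False
proof -
  define c where "c b = (if b \<in> set p then 2 else if b \<in> E then strength b (hd p)
      else if b \<in> F then strength b (last p) else 0)" for b
  have ne: "p \<noteq> []" and sub: "set p \<subseteq> \<Delta>" and dist: "distinct p" using dpathD[OF p] by auto
  have hl: "hd p \<in> set p" "last p \<in> set p" using ne by auto
  have fin: "finite E" "finite F" using E F finite_base finite_subset by blast+
  have cE: "c a = strength a (hd p)" if "a \<in> E" for a
    using that E by (auto simp: c_def)
  have cF: "c a = strength a (last p)" if "a \<in> F" for a
    using that E F EF by (auto simp: c_def)
  have "\<exists>S\<subseteq>\<Delta> - {b}. 2 * c b \<le> (\<Sum>a\<in>S. c a * strength a b)" if b: "b \<in> \<Delta>" "0 < c b" for b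
  proof -
    consider "b \<in> set p" | "b \<notin> set p" "b \<in> E" | "b \<notin> set p" "b \<in> F"
      using b by (auto simp: c_def split: if_splits)
    then show ?thesis
    proof cases
      case 1
      then obtain i where i: "i < length p" "b = p ! i" by (metis in_set_conv_nth)
      define L where "L = (if i = 0 then E else {p ! (i - 1)})"
      define R where "R = (if Suc i = length p then F else {p ! Suc i})"
      have "2 \<le> (\<Sum>a\<in>L. c a * strength a b)"
      proof (cases "i = 0")
        case True
        then have "b = hd p" using i ne by (simp add: hd_conv_nth)
        then have "(\<Sum>a\<in>L. c a * strength a b) = (\<Sum>a\<in>E. bond a (hd p))"
          using True by (intro sum.cong) (auto simp: L_def cE strength_squared)
        then show ?thesis using sumE by simp
      next
        case False
        then have "adj (p ! (i - 1)) b"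
          using dpathD(4)[OF p, of "i - 1"] i by simp
        then have "1 \<le> strength (p ! (i - 1)) b" by (rule strength_ge_1)
        moreover have "c (p ! (i - 1)) = 2" using False i by (simp add: c_def)
        ultimately show ?thesis using False by (simp add: L_def)
      qed
      moreover have "2 \<le> (\<Sum>a\<in>R. c a * strength a b)"
      proof (cases "Suc i = length p")
        case True
        then have "b = last p" using i ne by (simp add: last_conv_nth flip: True)
        then have "(\<Sum>a\<in>R. c a * strength a b) = (\<Sum>a\<in>F. bond a (last p))"
          using True by (intro sum.cong) (auto simp: R_def cF strength_squared)
        then show ?thesis using sumF by simp
      next
        case False
        then have "adj (p ! Suc i) b"
          using dpathD(4)[OF p, of i] i adj_sym by simp
        then have "1 \<le> strength (p ! Suc i) b" by (rule strength_ge_1)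
        moreover have "c (p ! Suc i) = 2" using False i by (simp add: c_def)
        ultimately show ?thesis using False by (simp add: R_def)
      qed
      moreover have succ: "p ! Suc i \<in> set p \<and> p ! Suc i \<noteq> b \<and> p ! Suc i \<noteq> p ! (i - 1)"
        if "Suc i \<noteq> length p"
        using that i dist by (simp add: nth_eq_iff_index_eq)
      have prev: "p ! (i - 1) \<in> set p \<and> p ! (i - 1) \<noteq> b" if "i \<noteq> 0"
        using that i dist by (simp add: nth_eq_iff_index_eq)
      have "L \<inter> R = {}"
        using succ prev E F EF by (cases "i = 0"; cases "Suc i = length p") (auto simp: L_def R_def)
      moreover have "finite L" "finite R"
        using fin by (auto simp: L_def R_def)
      ultimately have "2 * c b \<le> (\<Sum>a\<in>L \<union> R. c a * strength a b)"
        using 1 by (simp add: c_def sum.union_disjoint)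
      moreover have "L \<subseteq> \<Delta> - {b}"
        using E 1 prev sub by (cases "i = 0") (auto simp: L_def)
      moreover have "R \<subseteq> \<Delta> - {b}"
        using F 1 succ sub by (cases "Suc i = length p") (auto simp: R_def)
      ultimately show ?thesis
        by (intro exI[of _ "L \<union> R"]) simp
    next
      case 2
      then have "b \<noteq> hd p" using hl by auto
      then show ?thesis
        using 2 hl sub by (intro exI[of _ "{hd p}"]) (auto simp: c_def strength_sym)
    next
      case 3
      then have "b \<noteq> last p" "b \<notin> E" using hl EF by auto
      then show ?thesis
        using 3 hl sub by (intro exI[of _ "{last p}"]) (auto simp: c_def strength_sym)
    qed
  qed
  moreover have "0 \<le> c b" if "b \<in> \<Delta>" for b
    using that hl sub E F by (auto simp: c_def intro!: strength_nonneg)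
  moreover have "0 < c (hd p)" "hd p \<in> \<Delta>"
    using hl sub by (auto simp: c_def)
  ultimately show False
    using no_subadditive by blast
qed

text \<open>The subadditive function is constant on the cycle.\<close>

lemma no_cycle:
  assumes p: "dpath p" and len: "3 \<le> length p" and close: "adj (last p) (hd p)"
  shows False
proof -
  define c :: "'a \<Rightarrow> real" where "c b = (if b \<in> set p then 1 else 0)" for b
  have sub: "set p \<subseteq> \<Delta>" and dist: "distinct p" and ne: "p \<noteq> []" using dpathD[OF p] by auto
  let ?n = "length p"
  have "\<exists>S\<subseteq>\<Delta> - {b}. 2 * c b \<le> (\<Sum>a\<in>S. c a * strength a b)" if b: "0 < c b" for b
  proof -
    from b have "b \<in> set p" by (auto simp: c_def split: if_splits)
    then obtain i where i: "i < ?n" "b = p ! i" by (metis in_set_conv_nth)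
    define j where "j = (if i = 0 then ?n - 1 else i - 1)"
    define k where "k = (if Suc i = ?n then 0 else Suc i)"
    have jk: "j < ?n" "k < ?n" "j \<noteq> k" using i len by (auto simp: j_def k_def)
    have close': "adj (p ! (?n - 1)) (p ! 0)" using close ne by (simp add: hd_conv_nth last_conv_nth)
    have "adj (p ! j) b"
      using close' dpathD(4)[OF p, of "i - 1"] i by (auto simp: j_def)
    moreover have "adj (p ! k) b"
    proof (cases "Suc i = ?n")
      case True
      then have "?n - 1 = i" by simp
      then show ?thesis using close' True i by (auto simp: k_def intro: adj_sym)
    next
      case False
      then show ?thesis using dpathD(4)[OF p, of i] i by (auto simp: k_def intro: adj_sym)
    qed
    ultimately have "1 \<le> strength (p ! j) b" "1 \<le> strength (p ! k) b" "p ! j \<noteq> b" "p ! k \<noteq> b"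
      using strength_ge_1 adj_base by auto
    moreover have "p ! j \<noteq> p ! k" using jk dist by (simp add: nth_eq_iff_index_eq)
    moreover have "p ! j \<in> \<Delta>" "p ! k \<in> \<Delta>" using jk sub by (meson nth_mem subsetD)+
    ultimately show ?thesis
      using jk \<open>b \<in> set p\<close> by (intro exI[of _ "{p ! j, p ! k}"]) (auto simp: c_def)
  qed
  moreover have "hd p \<in> \<Delta>" "0 < c (hd p)" "0 \<le> c b" for b using ne sub by (auto simp: c_def)
  ultimately show False
    using no_subadditive[of c "hd p"] by blast
qed

lemma no_chord:
  assumes p: "dpath p" and ij: "i < j" "j < length p" and a: "adj (p ! i) (p ! j)"
  shows "j = Suc i"
proof (rule ccontr)
  assume "j \<noteq> Suc i"
  then have "3 \<le> Suc j - i" using ij by linarith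
  with no_cycle[OF dpath_segment(1)[OF p, of i j]] dpath_segment(2-4)[OF p, of i j] ij adj_sym[OF a]
  show False by (metis less_imp_le)
qed

lemma no_chord':
  assumes "dpath p" "i < length p" "j < length p" "adj (p ! i) (p ! j)"
  shows "j = Suc i \<or> i = Suc j"
  using no_chord[of p i j] no_chord[of p j i] adj_sym[OF assms(4)] adj_base(3)[OF assms(4)] assms
  by (metis linorder_neqE_nat)

lemma no_second_contact:
  assumes p: "dpath p" and ij: "i < j" "j < length p"
    and r: "r \<notin> set p" "adj r (p ! i)" "adj r (p ! j)"
  shows False
proof -
  let ?q = "take (Suc j - i) (drop i p)"
  have q: "dpath ?q" "hd ?q = p ! i" "last ?q = p ! j" "length ?q = Suc j - i"
    using dpath_segment[OF p, of i j] ij by auto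
  have "set ?q \<subseteq> set p"
    by (meson set_drop_subset set_take_subset subset_trans)
  then have "dpath (?q @ [r])"
    using q r by (intro dpath_snoc) (auto intro: adj_sym)
  moreover have "hd (?q @ [r]) = p ! i"
    using q dpathD(1) by (metis hd_append2)
  moreover have "3 \<le> length (?q @ [r])"
    using q(4) ij by (simp del: length_take length_drop)
  ultimately show False
    using no_cycle[of "?q @ [r]"] r by (metis last_snoc)
qed

lemma ex_longest_list:
  assumes "Q x" "\<And>p. Q p \<Longrightarrow> dpath p"
  shows "\<exists>p. Q p \<and> (\<forall>q. Q q \<longrightarrow> length q \<le> length p)"
proof -
  have "length p < Suc (card \<Delta>)" if "Q p" for p
    using dpathD(2,3)[OF assms(2)[OF that]] finite_base
    by (metis card_mono distinct_card le_imp_less_Suc)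
  with ex_has_greatest_nat[of Q x length "Suc (card \<Delta>)"] assms(1) show ?thesis
    by blast
qed

text \<open>A path beginning at \<open>u\<close> with simple bonds that exhausts its surroundings: apart from its own nodes it
only touches \<open>E\<close>, and this only at \<open>u\<close>.\<close>

definition arm :: "'a \<Rightarrow> 'a set \<Rightarrow> 'a list \<Rightarrow> bool" where
  "arm u E p \<longleftrightarrow> dpath p \<and> hd p = u \<and> set p \<inter> E = {} \<and>
     (\<forall>i. Suc i < length p \<longrightarrow> bond (p ! i) (p ! Suc i) < 2) \<and>
     (\<forall>i<length p. \<forall>r. adj (p ! i) r \<longrightarrow>
        r \<in> E \<and> i = 0 \<or> 0 < i \<and> r = p ! (i - 1) \<or> Suc i < length p \<and> r = p ! Suc i)"

lemma armD:
  assumes "arm u E p"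
  shows "dpath p" "p ! 0 = u" "p \<noteq> []" "set p \<inter> E = {}"
    "Suc i < length p \<Longrightarrow> bond (p ! i) (p ! Suc i) < 2"
    "i < length p \<Longrightarrow> adj (p ! i) r \<Longrightarrow>
        r \<in> E \<and> i = 0 \<or> 0 < i \<and> r = p ! (i - 1) \<or> Suc i < length p \<and> r = p ! Suc i"
  using assms dpathD(1)[of p] by (auto simp: arm_def hd_conv_nth)

text \<open>A longest path from \<open>u\<close> that avoids \<open>E\<close> will do. A branching or a multiple bond further along would form
a second heavy end besides \<open>E\<close>, and a node touching the path twice would close a cycle.\<close>

lemma ex_arm:
  assumes u: "u \<in> \<Delta>" and E: "\<And>a. a \<in> E \<Longrightarrow> adj a u" and sumE: "2 \<le> (\<Sum>a\<in>E. bond a u)"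
  obtains p where "arm u E p"
proof -
  let ?Q = "\<lambda>p. dpath p \<and> hd p = u \<and> set p \<inter> E = {}"
  have "?Q [u]"
    using u E adj_base(3) by (auto simp: dpath_singleton)
  from ex_longest_list[of ?Q, OF this]
  obtain p where p: "dpath p" "hd p = u" "set p \<inter> E = {}"
    and max: "\<And>q. ?Q q \<Longrightarrow> length q \<le> length p"
    by fast
  have ne: "p \<noteq> []" and sub: "set p \<subseteq> \<Delta>" and dist: "distinct p" using dpathD[OF p(1)] by auto
  have EsubD: "E \<subseteq> \<Delta>" using E adj_base by blast
  have branch: False if i: "i < length p" and F: "F \<subseteq> \<Delta> - set (take (Suc i) p)" "E \<inter> F = {}"
    "2 \<le> (\<Sum>a\<in>F. bond a (p ! i))" for i F
  proof (rule two_ends[of "take (Suc i) p" E F])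
    show "dpath (take (Suc i) p)"
      using dpath_segment(1)[OF p(1), of 0 i] i by simp
    show "E \<subseteq> \<Delta> - set (take (Suc i) p)"
      using EsubD p(3) set_take_subset[of "Suc i" p] by blast
    show "2 \<le> (\<Sum>a\<in>E. bond a (hd (take (Suc i) p)))"
      using sumE p(2) by simp
    show "2 \<le> (\<Sum>a\<in>F. bond a (last (take (Suc i) p)))"
      using F(3) dpath_segment(3)[OF p(1), of 0 i] i by simp
  qed (use F in auto)
  have fresh: "p ! Suc i \<in> \<Delta>" "p ! Suc i \<notin> set (take (Suc i) p)" "p ! Suc i \<notin> E" if "Suc i < length p" for i
  proof -
    show "p ! Suc i \<in> \<Delta>" "p ! Suc i \<notin> E" using nth_mem[OF that] sub p(3) by blast+
    show "p ! Suc i \<notin> set (take (Suc i) p)"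
      using that dist by (auto simp: in_set_conv_nth nth_eq_iff_index_eq)
  qed
  have "bond (p ! i) (p ! Suc i) < 2" if i: "Suc i < length p" for i
  proof (rule ccontr)
    assume "\<not> ?thesis"
    then show False
      using branch[of i "{p ! Suc i}"] fresh[OF i] i
      by (auto simp: bond_sym)
  qed
  moreover have "r \<in> E \<and> i = 0 \<or> 0 < i \<and> r = p ! (i - 1) \<or> Suc i < length p \<and> r = p ! Suc i"
    if i: "i < length p" and r: "adj (p ! i) r" for i r
  proof -
    consider j where "j < length p" "r = p ! j" | "r \<in> E" | "r \<notin> set p" "r \<notin> E"
      by (metis in_set_conv_nth)
    then show ?thesis
    proof cases
      case 1
      then show ?thesis using no_chord'[OF p(1) i 1(1)] r by auto
    next
      case 2
      have "i = 0"
      proof (rule ccontr)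
        assume "i \<noteq> 0"
        moreover have "r \<notin> set p" using 2 p(3) by blast
        moreover have "adj r (p ! 0)" using E[OF 2] p(2) ne by (simp add: hd_conv_nth)
        ultimately show False
          using no_second_contact[OF p(1), of 0 i r] i adj_sym[OF r] by simp
      qed
      then show ?thesis using 2 by simp
    next
      case 3
      show ?thesis
      proof (cases "Suc i < length p")
        case True
        have "r \<noteq> p ! Suc i" using 3 True by auto
        moreover have "1 \<le> bond r (p ! i)" "1 \<le> bond (p ! Suc i) (p ! i)"
          using bond_ge_1 adj_sym r dpathD(4)[OF p(1) True] by blast+
        ultimately show ?thesis
          using branch[of i "{r, p ! Suc i}"] fresh[OF True] i 3 p(3) adj_base[OF r]
            set_take_subset[of "Suc i" p] by auto
      next
        case False
        then have "last p = p ! i" using i ne last_conv_nth[OF ne] by (metis Suc_lessI diff_Suc_1)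
        then have "?Q (p @ [r])"
          using p r 3 ne by (auto intro!: dpath_snoc)
        from max[OF this] show ?thesis by simp
      qed
    qed
  qed
  ultimately have "arm u E p"
    unfolding arm_def using p by blast
  then show ?thesis by (rule that)
qed

lemma cartan_int_adj:
  assumes "adj a b" "bond a b < 2"
  shows "cartan_int a b = -1"
proof -
  obtain m where m: "cartan_int a b = of_int m"
    using cartan_int_Ints[of a b] adj_base[OF assms(1)] base_root by (auto elim: Ints_cases)
  obtain n where n: "cartan_int b a = of_int n"
    using cartan_int_Ints[of b a] adj_base[OF assms(1)] base_root by (auto elim: Ints_cases)
  have "bond a b = of_int (m * n)" by (simp add: bond_def m n)
  then have "m * n = 1" using assms(2) bond_ge_1[OF assms(1)] by linarith
  moreover have "cartan_int a b \<le> 0"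
    using base_obtuse[of a b] adj_base[OF assms(1)]
    by (simp add: cartan_int_def divide_le_0_iff)
  ultimately have "m = -1"
    using m zmult_eq_1_iff[of m n] by auto
  then show ?thesis using m by simp
qed

lemma cartan_int_not_adj:
  "a \<in> \<Delta> \<Longrightarrow> b \<in> \<Delta> \<Longrightarrow> a \<noteq> b \<Longrightarrow> \<not> adj a b \<Longrightarrow> cartan_int a b = 0"
  by (simp add: adj_def cartan_int_def)

end

section \<open>Connected diagrams with a symmetry\<close>

context root_basis
begin

lemma simply_laced_labelling_list:
  assumes L: "distinct L" "set L = \<Delta>" and simple: "\<And>a b. adj a b \<Longrightarrow> bond a b < 2"
    and edges: "\<And>i j. i < j \<Longrightarrow> j < length L \<Longrightarrow> adj (L ! i) (L ! j) \<longleftrightarrow> {Suc i, Suc j} \<in> E"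
  shows "simply_laced_labelling \<Delta> (length L) E (\<lambda>i. L ! (i - 1))"
  unfolding simply_laced_labelling_def
proof (intro conjI ballI impI)
  have "bij_betw ((!) L) {..<length L} \<Delta>"
    using L by (intro bij_betw_nth) auto
  moreover have "bij_betw (\<lambda>i. i - 1) {1..length L} {..<length L}"
    by (rule bij_betw_byWitness[of _ Suc]) auto
  ultimately show "bij_betw (\<lambda>i. L ! (i - 1)) {1..length L} \<Delta>"
    using bij_betw_trans[of "\<lambda>i. i - 1" _ _ "(!) L"] by (simp add: comp_def)
  fix i j assume ij: "i \<in> {1..length L}" "j \<in> {1..length L}" "i \<noteq> j"
  let ?a = "L ! (i - 1)" and ?b = "L ! (j - 1)"
  have "?a \<in> \<Delta>" "?b \<in> \<Delta>" "?a \<noteq> ?b"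
    using ij L by (auto simp: nth_eq_iff_index_eq simp flip: L(2))
  moreover have "adj ?a ?b \<longleftrightarrow> {i, j} \<in> E"
  proof (cases "i < j")
    case True
    then show ?thesis using edges[of "i - 1" "j - 1"] ij by simp
  next
    case False
    then show ?thesis
      using edges[of "j - 1" "i - 1"] ij adj_sym[of ?a ?b] adj_sym[of ?b ?a]
      by (auto simp: insert_commute)
  qed
  ultimately show "cartan_int ?a ?b = (if {i, j} \<in> E then -1 else 0)"
    using cartan_int_adj[of ?a ?b] cartan_int_not_adj[of ?a ?b] simple[of ?a ?b] by auto
qed

lemma dpath_Cons_Cons:
  "dpath (a # b # p) \<longleftrightarrow> adj a b \<and> a \<notin> set (b # p) \<and> dpath (b # p)"
proof
  assume p: "dpath (a # b # p)"
  have "adj ((b # p) ! i) ((b # p) ! Suc i)" if "Suc i < length (b # p)" for i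
    using dpathD(4)[OF p, of "Suc i"] that by simp
  then have "dpath (b # p)"
    using dpathD(2,3)[OF p] unfolding dpath_def by simp
  then show "adj a b \<and> a \<notin> set (b # p) \<and> dpath (b # p)"
    using dpathD(2)[OF p] dpathD(4)[OF p, of 0] by simp
next
  assume "adj a b \<and> a \<notin> set (b # p) \<and> dpath (b # p)"
  then show "dpath (a # b # p)" using dpath_Cons[of "b # p" a] by simp
qed

text \<open>Bonds have strength at least one, so it suffices that the marks \<open>c\<close> on the nodes listed by \<open>L\<close> are
subadditive with unweighted sums over the neighbours \<open>N i\<close>.\<close>

lemma no_affine_diagram:
  fixes c :: "nat \<Rightarrow> nat"
  assumes L: "distinct L" "L \<noteq> []" "set L \<subseteq> \<Delta>"
    and sub: "\<And>i. i < length L \<Longrightarrow> 0 < c i \<and> N i \<subseteq> {..<length L} \<and>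
      (\<forall>j\<in>N i. adj (L ! i) (L ! j)) \<and> 2 * c i \<le> sum c (N i)"
  shows False
proof -
  define d where "d a = (if a \<in> set L then real (c (THE i. i < length L \<and> L ! i = a)) else 0)" for a
  have d: "d (L ! i) = real (c i)" if "i < length L" for i
  proof -
    have "(THE j. j < length L \<and> L ! j = L ! i) = i"
      using L(1) that by (auto simp: nth_eq_iff_index_eq)
    then show ?thesis using that by (simp add: d_def)
  qed
  have "\<exists>S\<subseteq>\<Delta> - {b}. 2 * d b \<le> (\<Sum>a\<in>S. d a * strength a b)" if bL: "b \<in> set L" for b
  proof -
    obtain i where i: "i < length L" "b = L ! i" using bL by (auto simp: in_set_conv_nth)
    note sub_i = sub[OF i(1), THEN conjunct2]
    note N = sub_i[THEN conjunct1] sub_i[THEN conjunct2, THEN conjunct1, rule_format]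
      and le = sub_i[THEN conjunct2, THEN conjunct2]
    have inj: "inj_on ((!) L) (N i)"
      by (rule inj_on_nth[OF L(1)]) (use N(1) in blast)
    have "2 * d b = real (2 * c i)" using i by (simp add: d)
    also have "\<dots> \<le> real (sum c (N i))" using le by (intro of_nat_mono)
    also have "\<dots> = (\<Sum>j\<in>N i. real (c j))" by simp
    also have "\<dots> \<le> (\<Sum>j\<in>N i. d (L ! j) * strength (L ! j) b)"
    proof (rule sum_mono)
      fix j assume j: "j \<in> N i"
      then have "1 \<le> strength (L ! j) b"
        using strength_ge_1[OF adj_sym[OF N(2)[OF j]]] i(2) by simp
      then have "real (c j) * 1 \<le> real (c j) * strength (L ! j) b"
        by (intro mult_left_mono) auto
      moreover have "j < length L" using j N(1) by auto
      ultimately show "real (c j) \<le> d (L ! j) * strength (L ! j) b"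
        by (simp add: d)
    qed
    also have "\<dots> = (\<Sum>a\<in>(!) L ` N i. d a * strength a b)"
      by (simp add: sum.reindex[OF inj])
    finally have "2 * d b \<le> (\<Sum>a\<in>(!) L ` N i. d a * strength a b)" .
    moreover have "(!) L ` N i \<subseteq> \<Delta> - {b}"
      using adj_base(2)[OF N(2)] adj_base(3)[OF N(2)] i(2) by fastforce
    ultimately show ?thesis by blast
  qed
  moreover have "b \<in> set L" if "0 < d b" for b
    using that by (auto simp: d_def split: if_splits)
  moreover have "0 < d (L ! 0)" "L ! 0 \<in> \<Delta>"
    using d[of 0] sub[of 0] L nth_mem[of 0 L] by auto
  moreover have "0 \<le> d b" for b by (simp add: d_def)
  ultimately show False
    using no_subadditive[of d "L ! 0"] by blast
qed

lemma no_four_neighbours: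
  assumes "adj x a" "adj x b" "adj x c" "adj x d" "distinct [a, b, c, d]"
  shows False
proof (rule two_ends[of "[x]" "{a, b}" "{c, d}"])
  note base = adj_base[OF assms(1)] adj_base[OF assms(2)] adj_base[OF assms(3)] adj_base[OF assms(4)]
  have "1 \<le> bond y x" if "adj x y" for y
    using bond_ge_1[OF adj_sym[OF that]] .
  from this[OF assms(1)] this[OF assms(2)] this[OF assms(3)] this[OF assms(4)]
  show "2 \<le> (\<Sum>a\<in>{a, b}. bond a (hd [x]))" "2 \<le> (\<Sum>a\<in>{c, d}. bond a (last [x]))"
    using assms(5) by auto
  show "dpath [x]" "{a, b} \<subseteq> \<Delta> - set [x]" "{c, d} \<subseteq> \<Delta> - set [x]" "{a, b} \<inter> {c, d} = {}"
    using base assms(5) by (auto intro: dpath_singleton)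
qed

lemma no_triangle:
  assumes "adj a b" "adj b c" "adj c a"
  shows False
proof -
  have "dpath [a, b, c]"
    using assms adj_base[OF assms(1)] adj_base[OF assms(2)] adj_base[OF assms(3)]
    by (simp add: dpath_Cons_Cons dpath_singleton)
  from no_cycle[OF this] assms(3) show False by simp
qed

lemma arm_multiple_bond:
  assumes arm: "arm u E p" and x: "x \<in> set p" "adj x y" "\<not> bond x y < 2"
  shows "x = u \<and> y \<in> E"
proof -
  obtain i where i: "i < length p" "x = p ! i" using x by (metis in_set_conv_nth)
  consider "y \<in> E" "i = 0" | "0 < i" "y = p ! (i - 1)" | "Suc i < length p" "y = p ! Suc i"
    using armD(6)[OF arm i(1)] x(2) i(2) by blast
  then show ?thesis
  proof cases
    case 1
    then show ?thesis using armD(2)[OF arm] i by simp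
  next
    case 2
    then show ?thesis using armD(5)[OF arm, of "i - 1"] x(3) i bond_sym by simp
  next
    case 3
    then show ?thesis using armD(5)[OF arm, of i] x(3) i by simp
  qed
qed

lemma arm_closed:
  assumes arm: "arm u E p" and x: "x \<in> set p" "adj x y"
  shows "y \<in> set p \<or> x = u \<and> y \<in> E"
proof -
  obtain i where i: "i < length p" "x = p ! i" using x by (metis in_set_conv_nth)
  then show ?thesis
    using armD(6)[OF arm i(1), of y] x armD(2)[OF arm] by (auto simp: less_imp_diff_less)
qed

end

text \<open>A connected diagram with a nontrivial involution \<open>\<sigma>\<close>. Connectedness is expressed by closed sets: a
nonempty set of nodes that contains all neighbours of its members is everything.\<close>

locale diagram_symmetry = root_basis +
  fixes \<sigma> :: "'a \<Rightarrow> 'a"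
  assumes connected: "\<And>S. S \<subseteq> \<Delta> \<Longrightarrow> S \<noteq> {} \<Longrightarrow> (\<And>a b. a \<in> S \<Longrightarrow> adj a b \<Longrightarrow> b \<in> S) \<Longrightarrow> S = \<Delta>"
    and sym_base: "a \<in> \<Delta> \<Longrightarrow> \<sigma> a \<in> \<Delta>"
    and sym_inner: "a \<in> \<Delta> \<Longrightarrow> b \<in> \<Delta> \<Longrightarrow> inner (\<sigma> a) (\<sigma> b) = inner a b"
    and sym_sym: "a \<in> \<Delta> \<Longrightarrow> \<sigma> (\<sigma> a) = a"
    and sym_nontrivial: "\<exists>a\<in>\<Delta>. \<sigma> a \<noteq> a"
begin

lemma sym_inj: "a \<in> \<Delta> \<Longrightarrow> b \<in> \<Delta> \<Longrightarrow> \<sigma> a = \<sigma> b \<longleftrightarrow> a = b"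
  using sym_sym by metis

lemma sym_adj: "adj a b \<Longrightarrow> adj (\<sigma> a) (\<sigma> b)"
  by (auto simp: adj_def sym_base sym_inner sym_inj)

lemma sym_bond: "adj a b \<Longrightarrow> bond (\<sigma> a) (\<sigma> b) = bond a b"
  by (auto simp: bond_def adj_def cartan_int_def sym_base sym_inner)

text \<open>Going along the arm, the next node is the only unfixed neighbour of a fixed node that is not in \<open>E\<close>.\<close>

lemma arm_fixed:
  assumes arm: "arm u E p" and u: "\<sigma> u = u" and E: "\<And>e. e \<in> E \<Longrightarrow> \<sigma> e \<in> E" "E \<subseteq> \<Delta>"
    and x: "x \<in> set p"
  shows "\<sigma> x = x"
proof -
  note p = dpathD[OF armD(1)[OF arm]]
  have in\<Delta>: "p ! i \<in> \<Delta>" if "i < length p" for i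
    using that p(3) nth_mem by blast
  have "\<sigma> (p ! i) = p ! i" if "i < length p" for i
    using that
  proof (induction i rule: less_induct)
    case (less i)
    show ?case
    proof (cases i)
      case 0
      then show ?thesis using u armD(2)[OF arm] by simp
    next
      case (Suc k)
      let ?y = "p ! Suc k"
      have y: "?y \<in> \<Delta>" using less Suc in\<Delta> by simp
      have "adj (\<sigma> (p ! k)) (\<sigma> ?y)"
        using sym_adj[OF p(4)[of k]] less.prems Suc by simp
      then have "adj (p ! k) (\<sigma> ?y)"
        using less.IH[of k] less.prems Suc by simp
      then consider "\<sigma> ?y \<in> E" | "0 < k" "\<sigma> ?y = p ! (k - 1)" | "\<sigma> ?y = ?y"
        using armD(6)[OF arm, of k "\<sigma> ?y"] less Suc by auto
      then show ?thesis
      proof cases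
        case 1
        then have "?y \<in> E" using E(1) sym_sym[OF y] by metis
        moreover have "?y \<in> set p" using less Suc by simp
        ultimately show ?thesis using armD(4)[OF arm] by blast
      next
        case 2
        then have "\<sigma> ?y = \<sigma> (p ! (k - 1))"
          using less.IH[of "k - 1"] less.prems Suc by simp
        then have "?y = p ! (k - 1)"
          using sym_inj y in\<Delta> less.prems Suc by simp
        then show ?thesis
          using p(2) less.prems Suc by (simp add: nth_eq_iff_index_eq)
      next
        case 3
        then show ?thesis using Suc by simp
      qed
    qed
  qed
  then show ?thesis using x by (metis in_set_conv_nth)
qed

text \<open>On both sides of a multiple bond the diagram continues as an arm, so there is no other multiple bond
and the symmetry preserves this one. It cannot exchange the two nodes: their roots would have equal
length and equal Cartan integers, whose product two or three would be a square. So both nodes are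
fixed, and with them the two arms, which make up the diagram.\<close>

lemma simply_laced:
  assumes ab: "adj a b"
  shows "bond a b < 2"
proof (rule ccontr)
  assume multi: "\<not> bond a b < 2"
  have multi': "\<not> bond b a < 2" using multi bond_sym by simp
  note ba = adj_sym[OF ab]
  note base = adj_base[OF ab]
  obtain p where p: "arm a {b} p"
    by (rule ex_arm[of a "{b}"]) (use ba base multi' in auto)
  obtain q where q: "arm b {a} q"
    by (rule ex_arm[of b "{a}"]) (use ab base multi in auto)
  have aq: "a \<in> set p" "b \<in> set q"
    using armD(2,3)[OF p] armD(2,3)[OF q] by (metis length_greater_0_conv nth_mem)+
  have all: "set p \<union> set q = \<Delta>"
  proof (rule connected)
    show "set p \<union> set q \<subseteq> \<Delta>"
      using armD(1)[OF p] armD(1)[OF q] dpathD(3) by blast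
    fix x y assume "x \<in> set p \<union> set q" "adj x y"
    then show "y \<in> set p \<union> set q"
      using arm_closed[OF p] arm_closed[OF q] aq by blast
  qed (use aq in auto)
  have unique: "x = a \<and> y = b \<or> x = b \<and> y = a" if "adj x y" "\<not> bond x y < 2" for x y
    using arm_multiple_bond[OF p, of x y] arm_multiple_bond[OF q, of x y] that all adj_base(1)[OF that(1)]
    by blast
  have "\<sigma> a = a \<and> \<sigma> b = b"
  proof (rule ccontr)
    assume "\<not> ?thesis"
    then have "\<sigma> a = b \<and> \<sigma> b = a"
      using unique[OF sym_adj[OF ab]] sym_bond[OF ab] multi by auto
    then have "inner a a = inner b b"
      using sym_inner[of a a] base by simp
    then have eq: "cartan_int a b = cartan_int b a"
      by (simp add: cartan_int_def inner_commute)
    obtain m where m: "cartan_int a b = of_int m"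
      using cartan_int_Ints[of a b] base base_root by (auto elim: Ints_cases)
    have "bond a b = of_int (m * m)" using eq m by (simp add: bond_def)
    then have "2 \<le> m * m" "m * m < 4"
      using multi bond_lt_4[OF ab] by linarith+
    then have "\<bar>m\<bar> \<le> 1 \<or> 2 \<le> \<bar>m\<bar>" "2 \<le> \<bar>m\<bar> * \<bar>m\<bar>" "\<bar>m\<bar> * \<bar>m\<bar> < 4" by auto
    then show False
      using mult_mono[of "\<bar>m\<bar>" 1 "\<bar>m\<bar>" 1] mult_mono[of 2 "\<bar>m\<bar>" 2 "\<bar>m\<bar>"] by auto
  qed
  then have "\<sigma> x = x" if "x \<in> \<Delta>" for x
    using arm_fixed[OF p, of x] arm_fixed[OF q, of x] that all base by auto
  then show False using sym_nontrivial by blast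
qed

lemma ex_arm_pair:
  assumes "adj u a" "adj u b" "a \<noteq> b"
  obtains p where "arm u {a, b} p"
proof (rule ex_arm[of u "{a, b}"])
  show "2 \<le> (\<Sum>a\<in>{a, b}. bond a u)"
    using bond_ge_1[OF adj_sym[OF assms(1)]] bond_ge_1[OF adj_sym[OF assms(2)]] assms(3) by simp
qed (use assms adj_sym adj_base(1) in auto)

text \<open>The three arms at the branch point \<open>x\<close> make up the diagram, so no other node has three neighbours and
\<open>x\<close> is fixed. If its neighbours were fixed as well, then all arms would be.\<close>

lemma branch_symmetric:
  assumes xy: "adj x y1" "adj x y2" "adj x y3" and dist: "distinct [y1, y2, y3]"
  obtains v z where "\<sigma> x = x" "\<And>r. adj x r \<longleftrightarrow> r \<in> {v, \<sigma> v, z}" "distinct [v, \<sigma> v, z]"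
proof -
  define N where "N = {y1, y2, y3}"
  have nb: "adj x r \<longleftrightarrow> r \<in> N" for r
    using no_four_neighbours[of x y1 y2 y3 r] xy dist by (auto simp: N_def)
  have N\<Delta>: "N \<subseteq> \<Delta>" using nb adj_base by blast
  have cardN: "card N = 3" "finite N" using dist by (auto simp: N_def)
  have "\<exists>p. arm x (N - {y}) p" if "y \<in> N" for y
  proof -
    have "card (N - {y}) = 2" using that cardN by simp
    then obtain a b where ab: "N - {y} = {a, b}" "a \<noteq> b" by (auto simp: card_2_iff)
    then have "adj x a" "adj x b" using nb by auto
    then show ?thesis using ex_arm_pair ab by metis
  qed
  then obtain P where P: "\<And>y. y \<in> N \<Longrightarrow> arm x (N - {y}) (P y)" by metis
  have all: "(\<Union>y\<in>N. set (P y)) = \<Delta>"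
  proof (rule connected)
    show "(\<Union>y\<in>N. set (P y)) \<subseteq> \<Delta>"
      using P armD(1) dpathD(3) by blast
    show "(\<Union>y\<in>N. set (P y)) \<noteq> {}"
      using armD(3)[OF P] by (auto simp: N_def)
    fix r s assume r: "r \<in> (\<Union>y\<in>N. set (P y))" and s: "adj r s"
    then obtain y where y: "y \<in> N" "r \<in> set (P y)" by blast
    show "s \<in> (\<Union>y\<in>N. set (P y))"
    proof (cases "s \<in> set (P y)")
      case False
      then have "r = x" "s \<in> N" using arm_closed[OF P[OF y(1)] y(2) s] by auto
      moreover have "x \<in> set (P s)"
        using armD(2,3)[OF P[OF \<open>s \<in> N\<close>]] by (metis length_greater_0_conv nth_mem)
      ultimately have "s \<in> set (P s)"
        using arm_closed[OF P[OF \<open>s \<in> N\<close>], of x s] s by auto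
      then show ?thesis using \<open>s \<in> N\<close> by blast
    qed (use y in blast)
  qed
  have x\<Delta>: "x \<in> \<Delta>" using xy adj_base by blast
  have fixx: "\<sigma> x = x"
  proof (rule ccontr)
    assume ne: "\<sigma> x \<noteq> x"
    obtain y i where y: "y \<in> N" "i < length (P y)" "\<sigma> x = P y ! i"
      using sym_base[OF x\<Delta>] all by (auto simp: in_set_conv_nth)
    then have "i \<noteq> 0" using ne armD(2)[OF P[OF y(1)]] by (metis)
    then have "\<sigma> r \<in> {P y ! (i - 1), P y ! Suc i}" if "r \<in> N" for r
      using armD(6)[OF P[OF y(1)] y(2), of "\<sigma> r"] sym_adj[of x r] that nb y(3) by auto
    then have "\<sigma> ` N \<subseteq> {P y ! (i - 1), P y ! Suc i}" by blast
    then have "card (\<sigma> ` N) \<le> card {P y ! (i - 1), P y ! Suc i}" by (rule card_mono[rotated]) simp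
    also have "\<dots> \<le> 2" by (simp add: card_insert_if)
    also have "card (\<sigma> ` N) = 3"
      using cardN N\<Delta> sym_inj by (subst card_image) (auto simp: inj_on_def)
    finally show False by simp
  qed
  have "\<exists>v\<in>N. \<sigma> v \<noteq> v"
  proof (rule ccontr)
    assume none: "\<not> ?thesis"
    have "\<sigma> r = r" if r: "r \<in> \<Delta>" for r
    proof -
      obtain y where y: "y \<in> N" "r \<in> set (P y)" using r all by blast
      have "\<sigma> e \<in> N - {y}" if "e \<in> N - {y}" for e
        using none that by auto
      then show ?thesis
        using arm_fixed[OF P[OF y(1)] fixx _ _ y(2)] N\<Delta> by blast
    qed
    then show False using sym_nontrivial by blast
  qed
  then obtain v where v: "v \<in> N" "\<sigma> v \<noteq> v" by blast
  then have sv: "\<sigma> v \<in> N" using sym_adj[of x v] nb fixx by simp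
  then have "card (N - {v, \<sigma> v}) = 1"
    using v cardN by (subst card_Diff_subset) auto
  then obtain z where z: "N - {v, \<sigma> v} = {z}" by (auto simp: card_1_singleton_iff)
  show ?thesis
  proof (rule that[OF fixx])
    show "adj x r \<longleftrightarrow> r \<in> {v, \<sigma> v, z}" for r
      using nb z v sv by auto
    show "distinct [v, \<sigma> v, z]"
      using z v by auto
  qed
qed

text \<open>Without branch points a longest path cannot be left.\<close>

lemma ex_A_labelling:
  assumes no_branch: "\<And>x y1 y2 y3. adj x y1 \<Longrightarrow> adj x y2 \<Longrightarrow> adj x y3 \<Longrightarrow> \<not> distinct [y1, y2, y3]"
  shows "\<exists>f. simply_laced_labelling \<Delta> (card \<Delta>) (A_edges (card \<Delta>)) f"
proof -
  obtain a where "a \<in> \<Delta>" using sym_nontrivial by blast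
  from ex_longest_list[of dpath, OF dpath_singleton[OF this]]
  obtain p where p: "dpath p" and max: "\<And>q. dpath q \<Longrightarrow> length q \<le> length p"
    by blast
  note pD = dpathD[OF p]
  have all: "set p = \<Delta>"
  proof (rule connected)
    fix x r assume x: "x \<in> set p" and r: "adj x r"
    show "r \<in> set p"
    proof (rule ccontr)
      assume new: "r \<notin> set p"
      obtain i where i: "i < length p" "x = p ! i" using x by (metis in_set_conv_nth)
      consider "i = 0" | "Suc i = length p" | "0 < i" "Suc i < length p" using i by linarith
      then show False
      proof cases
        case 1
        then have "dpath (r # p)"
          using p new adj_sym[OF r] i pD(1) by (intro dpath_Cons) (auto simp: hd_conv_nth)
        then show False using max by fastforce
      next
        case 2
        then have "last p = x" using i pD(1) by (metis diff_Suc_1 last_conv_nth)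
        then have "dpath (p @ [r])"
          using p new r by (intro dpath_snoc) auto
        then show False using max by fastforce
      next
        case 3
        have "adj x (p ! (i - 1))" "adj x (p ! Suc i)"
          using adj_sym[OF pD(4)[of "i - 1"]] pD(4)[of i] 3 i by auto
        moreover have "distinct [r, p ! (i - 1), p ! Suc i]"
          using new pD(2) 3 by (auto simp: nth_eq_iff_index_eq)
        ultimately show False using no_branch[OF r] by blast
      qed
    qed
  qed (use pD in auto)
  have len: "length p = card \<Delta>"
    using all pD(2) by (metis distinct_card)
  have "simply_laced_labelling \<Delta> (length p) (A_edges (card \<Delta>)) (\<lambda>i. p ! (i - 1))"
  proof (rule simply_laced_labelling_list[OF pD(2) all simply_laced])
    fix i j assume ij: "i < j" "j < length p"
    have "adj (p ! i) (p ! j) \<longleftrightarrow> j = Suc i"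
      using no_chord[OF p ij] pD(4)[of i] ij by auto
    also have "\<dots> \<longleftrightarrow> {Suc i, Suc j} \<in> A_edges (card \<Delta>)"
      using ij len by (auto simp: A_edges_def doubleton_eq_iff)
    finally show "adj (p ! i) (p ! j) \<longleftrightarrow> {Suc i, Suc j} \<in> A_edges (card \<Delta>)" .
  qed
  then show ?thesis using len by auto
qed

lemma D_edges_iff:
  assumes "i < j" 
  shows "{i, j} \<in> D_edges n \<longleftrightarrow> 1 \<le> i \<and> j = i + 1 \<and> j \<le> n - 1 \<or> i = n - 2 \<and> j = n"
  using assms by (auto simp: D_edges_def doubleton_eq_iff)

text \<open>Two arms at the fixed branch point \<open>x\<close> are exchanged. If they consist of one node each, the type is \<open>D\<close>
with the third arm as its tail. If they are longer, the affine diagrams of \<open>E\<^sub>6\<close> and \<open>E\<^sub>7\<close> and the excluded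
second branchings bound all three arms, and the type is \<open>E\<^sub>6\<close>.\<close>

lemma D_or_E6_of_branch:
  assumes fixx: "\<sigma> x = x" and nb: "\<And>r. adj x r \<longleftrightarrow> r \<in> {v, \<sigma> v, z}" and dist: "distinct [v, \<sigma> v, z]"
  shows "(\<exists>n\<ge>4. type_D n \<Delta>) \<or> type_E6 \<Delta>"
proof -
  have v: "adj x v" "adj x (\<sigma> v)" "adj x z" using nb by auto
  have v\<Delta>: "x \<in> \<Delta>" "v \<in> \<Delta>" "\<sigma> v \<in> \<Delta>" "z \<in> \<Delta>" and xv: "x \<noteq> v" "x \<noteq> \<sigma> v" "x \<noteq> z"
    using v adj_base by blast+
  have fixz: "\<sigma> z = z"
  proof -
    have "\<sigma> z \<in> {v, \<sigma> v, z}"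
      using nb sym_adj[OF v(3)] fixx by simp
    moreover have "\<sigma> z \<noteq> v" "\<sigma> z \<noteq> \<sigma> v"
      using sym_sym[of z] sym_inj[of z v] v\<Delta> dist by auto
    ultimately show ?thesis by blast
  qed
  obtain p where p: "arm x {v, \<sigma> v} p"
    using ex_arm_pair[OF v(1,2)] dist by auto
  note pD = dpathD[OF armD(1)[OF p]]
  have hd: "p ! 0 = x" and pE: "v \<notin> set p" "\<sigma> v \<notin> set p"
    using armD[OF p] by auto
  have xp: "x \<in> set p" using hd pD(1) by (metis length_greater_0_conv nth_mem)
  have p1: "Suc 0 < length p" "p ! Suc 0 = z"
    using armD(6)[OF p, of 0 z] hd pD(1) v(3) dist by auto
  have no_vv: "\<not> adj v (\<sigma> v)"
    using no_triangle[of x v "\<sigma> v"] v adj_sym by blast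
  define m where "m = length p"
  show ?thesis
  proof (cases "\<forall>w. adj v w \<longrightarrow> w = x")
    case leaf: True
    have leaf': "w = x" if "adj (\<sigma> v) w" for w
    proof -
      have "adj v (\<sigma> w)" using sym_adj[OF that] sym_sym v\<Delta> by simp
      then have "\<sigma> w = \<sigma> x" using leaf fixx by simp
      then show ?thesis using sym_inj adj_base(2)[OF that] v\<Delta> by simp
    qed
    have all: "set p \<union> {v, \<sigma> v} = \<Delta>"
    proof (rule connected)
      fix a b assume "a \<in> set p \<union> {v, \<sigma> v}" "adj a b"
      then show "b \<in> set p \<union> {v, \<sigma> v}"
        using arm_closed[OF p, of a b] leaf leaf' xp by auto
    qed (use pD v\<Delta> in auto)
    let ?L = "rev p @ [v, \<sigma> v]"
    have m: "2 \<le> m" and len: "length ?L = m + 2" using p1 by (auto simp: m_def)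
    have rev: "?L ! i = p ! (m - Suc i)" if "i < m" for i
      using that by (simp add: nth_append rev_nth m_def)
    have Lv: "?L ! m = v" "?L ! Suc m = \<sigma> v" by (simp_all add: nth_append m_def)
    have adj_v: "adj (p ! k) v \<longleftrightarrow> k = 0" "adj (p ! k) (\<sigma> v) \<longleftrightarrow> k = 0" if "k < m" for k
    proof -
      have "p ! k \<in> set p" using that by (simp add: m_def)
      then show "adj (p ! k) v \<longleftrightarrow> k = 0" "adj (p ! k) (\<sigma> v) \<longleftrightarrow> k = 0"
        using arm_closed[OF p, of "p ! k"] pE v hd nth_eq_iff_index_eq[OF pD(2), of k 0] pD(1) that
        by (auto simp: m_def)
    qed
    have "simply_laced_labelling \<Delta> (length ?L) (D_edges (m + 2)) (\<lambda>i. ?L ! (i - 1))"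
    proof (rule simply_laced_labelling_list[OF _ _ simply_laced])
      show "distinct ?L" using pD(2) pE dist by auto
      show "set ?L = \<Delta>" using all by auto
      fix i j assume ij: "i < j" "j < length ?L"
      then consider "j < m" | "i < m" "j = m" | "i < m" "j = Suc m" | "i = m" "j = Suc m"
        using len by linarith
      then show "adj (?L ! i) (?L ! j) \<longleftrightarrow> {Suc i, Suc j} \<in> D_edges (m + 2)"
      proof cases
        case 1
        have "adj (p ! (m - Suc i)) (p ! (m - Suc j)) \<longleftrightarrow> m - Suc i = Suc (m - Suc j)"
        proof
          assume "adj (p ! (m - Suc i)) (p ! (m - Suc j))"
          then show "m - Suc i = Suc (m - Suc j)"
            using no_chord[OF armD(1)[OF p], of "m - Suc j" "m - Suc i"] 1 ij
              adj_sym[of "p ! (m - Suc i)" "p ! (m - Suc j)"] by (auto simp: m_def)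
        next
          assume eq: "m - Suc i = Suc (m - Suc j)"
          then have "adj (p ! (m - Suc j)) (p ! Suc (m - Suc j))"
            using pD(4)[of "m - Suc j"] 1 ij by (simp add: m_def)
          then show "adj (p ! (m - Suc i)) (p ! (m - Suc j))"
            unfolding eq by (rule adj_sym)
        qed
        also have "\<dots> \<longleftrightarrow> j = Suc i" using 1 ij by auto
        finally show ?thesis using 1 ij by (auto simp: rev D_edges_iff)
      next
        case 2
        then show ?thesis using adj_v(1)[of "m - Suc i"] m
          by (auto simp: rev Lv D_edges_iff)
      next
        case 3
        then show ?thesis using adj_v(2)[of "m - Suc i"] m
          by (auto simp: rev Lv D_edges_iff)
      next
        case 4
        then show ?thesis using no_vv m by (auto simp: Lv D_edges_iff)
      qed
    qed
    then have "type_D (m + 2) \<Delta>" unfolding type_D_def len by blast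
    then show ?thesis using m by (intro disjI1 exI[of _ "m + 2"]) auto
  next
    case False
    then obtain w where vw: "adj v w" and wx: "w \<noteq> x" by blast
    define v' w' where "v' = \<sigma> v" and "w' = \<sigma> w"
    have w\<Delta>: "w \<in> \<Delta>" "w' \<in> \<Delta>" using vw adj_base sym_base by (auto simp: w'_def)
    have vw': "adj v' w'" using sym_adj[OF vw] by (simp add: v'_def w'_def)
    have sv': "\<sigma> v' = v" "\<sigma> w' = w" using sym_sym v\<Delta> w\<Delta> by (auto simp: v'_def w'_def)
    have xv': "adj x v'" "v' \<notin> set p" "v \<noteq> v'" "v' \<noteq> z" "v \<noteq> z"
      using v pE dist by (auto simp: v'_def)
    have not_p: "y \<notin> set p" if "adj v y" "y \<noteq> x" for y
    proof
      assume "y \<in> set p"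
      then obtain i where i: "i < length p" "y = p ! i" by (metis in_set_conv_nth)
      then have "0 < i" using that hd by (cases i) auto
      then show False
        using no_second_contact[OF armD(1)[OF p], of 0 i v] i pE that hd adj_sym[OF v(1)] by auto
    qed
    have wp: "w \<notin> set p" using not_p vw wx by blast
    have dpath5: "dpath [v, x, v']"
      using v\<Delta> xv' adj_sym[OF v(1)] xv by (simp add: dpath_Cons_Cons dpath_singleton v'_def)
    have ww': "w \<noteq> w'"
    proof
      assume "w = w'"
      then show False
        using no_second_contact[OF dpath5, of 0 2 w] wx adj_base(3)[OF vw] adj_base(3)[OF vw']
          adj_sym[OF vw] adj_sym[OF vw'] by auto
    qed
    have w'x: "w' \<noteq> x" using wx fixx sv' by metis
    have wv': "w \<noteq> v'" using no_vv vw unfolding v'_def by metis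
    have w'v: "w' \<noteq> v" using wv' sv' by (metis v'_def)
    have wz: "w \<noteq> z" using wp p1 nth_mem by metis
    have w'z: "w' \<noteq> z" using wz fixz sv' by metis
    have wv: "w \<noteq> v" "w' \<noteq> v'" using vw vw' adj_base(3) by blast+
    have zx: "z \<noteq> x" "v \<noteq> x" "v' \<noteq> x" using xv by (auto simp: v'_def)
    note ne = ww' w'x wx wv' w'v wz w'z wv zx xv'(3-5)
    note ne' = ne[symmetric]
    note edges = v(1) xv'(1) v(3) vw vw' adj_sym[OF v(1)] adj_sym[OF xv'(1)] adj_sym[OF v(3)]
      adj_sym[OF vw] adj_sym[OF vw']
    \<comment> \<open>a third node on the long arm would give the affine diagram of \<open>E\<^sub>6\<close>\<close>
    have p2: "length p = 2"
    proof (rule ccontr)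
      assume "length p \<noteq> 2"
      then have l3: "2 < length p" using p1 by simp
      define y where "y = p ! 2"
      have yp: "y \<in> set p" using l3 by (simp add: y_def)
      have zy: "adj z y" using pD(4)[of 1] l3 p1 by (simp add: y_def numeral_2_eq_2)
      have y: "y \<in> \<Delta>" "y \<noteq> x" "y \<noteq> z" "y \<noteq> v" "y \<noteq> v'" "y \<noteq> w"
        using pD(3) yp pE(1) xv'(2) wp nth_eq_iff_index_eq[OF pD(2), of 2 0]
          nth_eq_iff_index_eq[OF pD(2), of 2 "Suc 0"] l3 hd p1 pD(1)
        by (fastforce simp: y_def)+
      have w'y: "y \<noteq> w'"
      proof
        assume "y = w'"
        then have "adj v' y" using vw' by simp
        then show False
          using no_second_contact[OF armD(1)[OF p], of 0 2 v'] l3 hd xv'(2) adj_sym[OF xv'(1)]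
          by (simp add: y_def)
      qed
      show False
      proof (rule no_affine_diagram[where L = "[x, v, v', z, w, w', y]"
            and c = "(!) [3, 2, 2, 2, 1, 1, 1]"
            and N = "(!) [{1, 2, 3}, {0, 4}, {0, 5}, {0, 6}, {1}, {2}, {3}]"])
        show "distinct [x, v, v', z, w, w', y]"
          using ne ne' y y(2-)[symmetric] w'y w'y[symmetric] by simp
        show "set [x, v, v', z, w, w', y] \<subseteq> \<Delta>"
          using v\<Delta> w\<Delta> y(1) by (simp add: v'_def)
        fix i assume "i < length [x, v, v', z, w, w', y]"
        then have "i \<in> {0, 1, 2, 3, 4, 5, 6}" by auto
        then show "0 < [3::nat, 2, 2, 2, 1, 1, 1] ! i \<and>
          [{1, 2, 3}, {0, 4}, {0, 5}, {0, 6}, {1}, {2}, {3}] ! i \<subseteq> {..<length [x, v, v', z, w, w', y]} \<and>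
          (\<forall>j\<in>[{1, 2, 3}, {0, 4}, {0, 5}, {0, 6}, {1}, {2}, {3}] ! i.
            adj ([x, v, v', z, w, w', y] ! i) ([x, v, v', z, w, w', y] ! j)) \<and>
          2 * [3::nat, 2, 2, 2, 1, 1, 1] ! i
            \<le> sum ((!) [3::nat, 2, 2, 2, 1, 1, 1]) ([{1, 2, 3}, {0, 4}, {0, 5}, {0, 6}, {1}, {2}, {3}] ! i)"
          using edges zy adj_sym[OF zy] by (elim insertE emptyE) simp_all
      qed simp
    qed
    have pset: "set p = {x, z}"
      using p2 hd p1 by (cases p; cases "tl p") auto
    have nb_v: "a \<in> {x, w}" if a: "adj v a" for a
    proof (rule ccontr)
      assume a': "a \<notin> {x, w}"
      have "a \<notin> set p" using not_p a a' by blast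
      moreover have "a \<noteq> v'" using no_vv a by (auto simp: v'_def)
      ultimately have fresh: "{w, a} \<subseteq> \<Delta> - set [v, x]" "{w, a} \<inter> {v', z} = {}"
        using adj_base[OF a] adj_base[OF vw] a' pset ne by auto
      have vx: "dpath [v, x]"
        using v\<Delta> adj_sym[OF v(1)] xv by (simp add: dpath_Cons_Cons dpath_singleton)
      have "2 \<le> (\<Sum>y\<in>{w, a}. bond y (hd [v, x]))"
        using bond_ge_1[OF adj_sym[OF vw]] bond_ge_1[OF adj_sym[OF a]] a' by auto
      moreover have "2 \<le> (\<Sum>y\<in>{v', z}. bond y (last [v, x]))"
        using bond_ge_1[OF adj_sym[OF xv'(1)]] bond_ge_1[OF adj_sym[OF v(3)]] xv' by auto
      ultimately show False
        using two_ends[OF vx fresh(1) _ fresh(2)] v\<Delta> ne by (auto simp: v'_def)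
    qed
    \<comment> \<open>a third node on a short arm would give the affine diagram of \<open>E\<^sub>7\<close>\<close>
    have nb_w: "t = v" if wt: "adj w t" for t
    proof (rule ccontr)
      assume tv: "t \<noteq> v"
      define t' where "t' = \<sigma> t"
      have t\<Delta>: "t \<in> \<Delta>" "t' \<in> \<Delta>" using wt adj_base sym_base by (auto simp: t'_def)
      have wt': "adj w' t'" using sym_adj[OF wt] by (simp add: t'_def w'_def)
      have tw: "t \<noteq> w" using wt adj_base by blast
      have path: "dpath [w, v, x, v', w']"
        using edges w\<Delta> ne ne' by (simp add: dpath_Cons_Cons dpath_singleton)
      have path': "dpath [w, v, x, z]"
        using edges v\<Delta> ne ne' by (simp add: dpath_Cons_Cons dpath_singleton)
      have tx: "t \<noteq> x" using no_chord[OF path, of 0 2] wt by auto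
      have tv': "t \<noteq> v'" using no_chord[OF path, of 0 3] wt by auto
      have tw': "t \<noteq> w'" using no_chord[OF path, of 0 4] wt by auto
      have tz: "t \<noteq> z" using no_chord[OF path', of 0 3] wt by auto
      have tt': "t \<noteq> t'"
        using no_second_contact[OF path, of 0 4 t] adj_sym[OF wt] adj_sym[OF wt'] tv tw tx tv' tw' by auto
      have st': "\<sigma> t' = t" using sym_sym t\<Delta> by (simp add: t'_def)
      have other: "t' \<noteq> a" if "t \<noteq> \<sigma> a" for a using that st' by auto
      have t'x: "t' \<noteq> x" "t' \<noteq> z" "t' \<noteq> v" "t' \<noteq> v'" "t' \<noteq> w" "t' \<noteq> w'"
        using other[of x] other[of z] other[of v] other[of v'] other[of w] other[of w']
          tx tz tv tv' tw tw' fixx fixz sv' by (simp_all add: v'_def w'_def)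
      note nt = tx tv tv' tw tw' tz tt' t'x
      show False
      proof (rule no_affine_diagram[where L = "[x, v, v', z, w, w', t, t']"
            and c = "(!) [4, 3, 3, 2, 2, 2, 1, 1]"
            and N = "(!) [{1, 2, 3}, {0, 4}, {0, 5}, {0}, {1, 6}, {2, 7}, {4}, {5}]"])
        show "distinct [x, v, v', z, w, w', t, t']"
          using ne ne' nt nt[symmetric] by simp
        show "set [x, v, v', z, w, w', t, t'] \<subseteq> \<Delta>"
          using v\<Delta> w\<Delta> t\<Delta> by (simp add: v'_def)
        fix i assume "i < length [x, v, v', z, w, w', t, t']"
        then have "i \<in> {0, 1, 2, 3, 4, 5, 6, 7}" by auto
        then show "0 < [4::nat, 3, 3, 2, 2, 2, 1, 1] ! i \<and>
          [{1, 2, 3}, {0, 4}, {0, 5}, {0}, {1, 6}, {2, 7}, {4}, {5}] ! i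
            \<subseteq> {..<length [x, v, v', z, w, w', t, t']} \<and>
          (\<forall>j\<in>[{1, 2, 3}, {0, 4}, {0, 5}, {0}, {1, 6}, {2, 7}, {4}, {5}] ! i.
            adj ([x, v, v', z, w, w', t, t'] ! i) ([x, v, v', z, w, w', t, t'] ! j)) \<and>
          2 * [4::nat, 3, 3, 2, 2, 2, 1, 1] ! i
            \<le> sum ((!) [4::nat, 3, 3, 2, 2, 2, 1, 1])
                ([{1, 2, 3}, {0, 4}, {0, 5}, {0}, {1, 6}, {2, 7}, {4}, {5}] ! i)"
          using edges wt wt' adj_sym[OF wt] adj_sym[OF wt'] by (elim insertE emptyE) simp_all
      qed simp
    qed
    have nb_z: "a = x" if "adj z a" for a
      using armD(6)[OF p, of 1 a] that p1 p2 hd by simp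
    have nb_v': "a \<in> {x, w'}" if "adj v' a" for a
    proof -
      have "\<sigma> a \<in> {x, w}" using nb_v[of "\<sigma> a"] sym_adj[OF that] sv' by simp
      then show ?thesis using sym_sym[OF adj_base(2)[OF that]] fixx by (auto simp: w'_def)
    qed
    have nb_w': "a = v'" if "adj w' a" for a
    proof -
      have "\<sigma> a = v" using nb_w[of "\<sigma> a"] sym_adj[OF that] sv' by simp
      then show ?thesis using sym_sym[OF adj_base(2)[OF that]] by (auto simp: v'_def)
    qed
    have nb_x: "a \<in> {v, v', z}" if "adj x a" for a
      using nb that by (simp add: v'_def)
    have all: "{w, z, v, x, v', w'} = \<Delta>"
    proof (rule connected)
      fix a b assume "a \<in> {w, z, v, x, v', w'}" "adj a b"
      then show "b \<in> {w, z, v, x, v', w'}"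
        using nb_v[of b] nb_v'[of b] nb_w[of b] nb_w'[of b] nb_z[of b] nb_x[of b] by auto
    qed (use v\<Delta> w\<Delta> in \<open>auto simp: v'_def\<close>)
    let ?L = "[w, z, v, x, v', w']"
    have len: "length ?L = 6" by simp
    have "simply_laced_labelling \<Delta> (length ?L) E6_edges (\<lambda>i. ?L ! (i - 1))"
    proof (rule simply_laced_labelling_list[OF _ _ simply_laced])
      show "distinct ?L" using ne ne' by auto
      show "set ?L = \<Delta>" using all by auto
      fix i j assume ij: "i < j" "j < length ?L"
      have yes: "adj w v" "adj z x" "adj v x" "adj x v'" "adj v' w'"
        by (fact edges)+
      have no: "\<not> adj w z" "\<not> adj w x" "\<not> adj w v'" "\<not> adj w w'" "\<not> adj z v" "\<not> adj z v'"
        "\<not> adj z w'" "\<not> adj v v'" "\<not> adj v w'" "\<not> adj x w'"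
        using nb_w[of z] nb_w[of x] nb_w[of v'] nb_w[of w'] nb_z[of v] nb_z[of v'] nb_z[of w']
          nb_v[of v'] nb_v[of w'] nb_x[of w'] ne ne' by auto
      have "j = 1 \<or> j = 2 \<or> j = 3 \<or> j = 4 \<or> j = 5" using ij by auto
      moreover have "i = 0 \<or> i = 1 \<or> i = 2 \<or> i = 3 \<or> i = 4" using ij by auto
      ultimately show "adj (?L ! i) (?L ! j) \<longleftrightarrow> {Suc i, Suc j} \<in> E6_edges"
        using ij(1) yes no
        by (elim disjE; simp add: E6_edges_def doubleton_eq_iff)
    qed
    then have "simply_laced_labelling \<Delta> 6 E6_edges (\<lambda>i. ?L ! (i - 1))"
      by (simp only: len)
    then show ?thesis unfolding type_E6_def by blast
  qed
qed

theorem classification: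
  "(\<exists>f. simply_laced_labelling \<Delta> (card \<Delta>) (A_edges (card \<Delta>)) f) \<or> (\<exists>n\<ge>4. type_D n \<Delta>) \<or> type_E6 \<Delta>"
proof (cases "\<exists>x y1 y2 y3. adj x y1 \<and> adj x y2 \<and> adj x y3 \<and> distinct [y1, y2, y3]")
  case True
  then obtain x y1 y2 y3 where "adj x y1" "adj x y2" "adj x y3" "distinct [y1, y2, y3]" by blast
  then show ?thesis
  proof (rule branch_symmetric)
    fix v z
    assume "\<sigma> x = x" "\<And>r. adj x r \<longleftrightarrow> r \<in> {v, \<sigma> v, z}" "distinct [v, \<sigma> v, z]"
    from D_or_E6_of_branch[OF this] show ?thesis by blast
  qed
next
  case False
  then show ?thesis using ex_A_labelling by blast
qed

end

section \<open>When the longest element is not minus the identity\<close>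

context root_basis
begin

text \<open>When the word makes the positive root negative, it does so at a letter whose simple root has just
been reached.\<close>

lemma pos_root_conj_base:
  assumes "set ss \<subseteq> \<Delta>" "b \<in> pos_roots" "- word ss b \<in> pos_roots"
  shows "\<exists>ts a. set ts \<subseteq> \<Delta> \<and> a \<in> \<Delta> \<and> word ts b = a"
  using assms
proof (induction ss)
  case Nil
  then show ?case using pos_not_neg by simp
next
  case (Cons c ss)
  have c: "c \<in> \<Delta>" and ss: "set ss \<subseteq> \<Delta>" using Cons.prems by auto
  have "word ss b \<in> \<Phi>"
    using word_root[of ss b] ss base_subset pos_root[OF Cons.prems(2)] by blast
  then consider "word ss b \<in> pos_roots" "word ss b \<noteq> c" | "word ss b = c" | "- word ss b \<in> pos_roots"
    using root_cases by blast
  then show ?case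
  proof cases
    case 1
    then have "word (c # ss) b \<in> pos_roots" using reflection_pos[OF c] by simp
    then show ?thesis using Cons.prems(3) pos_not_neg by blast
  next
    case 2
    then show ?thesis using c ss by blast
  next
    case 3
    then show ?thesis using Cons.IH[OF ss Cons.prems(2)] by blast
  qed
qed

lemma root_conj_base:
  assumes "b \<in> \<Phi>"
  obtains ts a where "set ts \<subseteq> \<Delta>" "a \<in> \<Delta>" "b = word ts a \<or> b = - word ts a"
proof -
  obtain ss where ss: "set ss \<subseteq> \<Delta>" "w0 = word ss"
    using w0_in_W by (rule refl_groupE)
  have pos: "\<exists>ts a. set ts \<subseteq> \<Delta> \<and> a \<in> \<Delta> \<and> c = word ts a" if c: "c \<in> pos_roots" for c
  proof -
    obtain ts a where ts: "set ts \<subseteq> \<Delta>" "a \<in> \<Delta>" "word ts c = a"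
      using pos_root_conj_base[OF ss(1) c] w0_pos[OF c] ss(2) by auto
    then have "c = word (rev ts) a" using word_rev[of ts c] by simp
    then show ?thesis using ts by (intro exI[of _ "rev ts"] exI[of _ a]) simp
  qed
  show ?thesis
    using root_cases[OF assms]
  proof
    assume "b \<in> pos_roots"
    then show ?thesis using pos that by blast
  next
    assume "- b \<in> pos_roots"
    then obtain ts a where "set ts \<subseteq> \<Delta>" "a \<in> \<Delta>" "- b = word ts a" using pos by blast
    then show ?thesis using that[of ts a] by (metis minus_minus)
  qed
qed

lemma inner_span_orthogonal:
  assumes "\<And>a b. a \<in> S \<Longrightarrow> b \<in> T \<Longrightarrow> inner a b = 0" "x \<in> span S" "y \<in> span T"
  shows "inner x y = 0"
proof -
  have 1: "inner a y = 0" if a: "a \<in> S" for a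
    using assms(3)
    by (induction rule: span_induct_alt) (use assms(1)[OF a] in \<open>auto simp: inner_add_right\<close>)
  from assms(2) show ?thesis
    by (induction rule: span_induct_alt) (auto simp: inner_add_left 1)
qed

lemma word_span_invariant:
  assumes orth: "\<And>a b. a \<in> S \<Longrightarrow> b \<in> T \<Longrightarrow> inner a b = 0"
    and ss: "set ss \<subseteq> S \<union> T" and x: "x \<in> span S"
  shows "word ss x \<in> span S"
  using ss
proof (induction ss)
  case Nil
  then show ?case using x by simp
next
  case (Cons c ss)
  then have IH: "word ss x \<in> span S" by simp
  show ?case
  proof (cases "c \<in> S")
    case True
    then show ?thesis using IH by (simp add: reflection_def span_diff span_scale span_base)
  next
    case False
    then have "c \<in> T" using Cons by simp
    then have "inner (word ss x) c = 0"
      using inner_span_orthogonal[of S T, OF orth IH] by (simp add: span_base)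
    then show ?thesis using IH by (simp add: reflection_def cartan_int_def)
  qed
qed

text \<open>Every root is conjugate to a simple root up to sign. If the base splits into two orthogonal parts, the
group preserves the span of each part, and so the root system splits as well.\<close>

lemma diagram_connected:
  assumes irr: "irreducible_root_system \<Phi>"
    and S: "S \<subseteq> \<Delta>" "S \<noteq> {}" and closed: "\<And>a b. a \<in> S \<Longrightarrow> adj a b \<Longrightarrow> b \<in> S"
  shows "S = \<Delta>"
proof (rule ccontr)
  assume ne: "S \<noteq> \<Delta>"
  define T where "T = \<Delta> - S"
  have T: "T \<noteq> {}" "S \<union> T = \<Delta>" using S ne by (auto simp: T_def)
  have orth: "inner a b = 0" if "a \<in> S" "b \<in> T" for a b
    using closed[OF that(1), of b] that S by (auto simp: adj_def T_def)
  have orth': "inner b a = 0" if "b \<in> T" "a \<in> S" for a b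
    using orth[OF that(2,1)] by (simp add: inner_commute)
  let ?A = "\<Phi> \<inter> span S" and ?B = "\<Phi> \<inter> span T"
  have "b \<in> span S \<or> b \<in> span T" if "b \<in> \<Phi>" for b
  proof -
    obtain ts a where ts: "set ts \<subseteq> \<Delta>" "a \<in> \<Delta>" "b = word ts a \<or> b = - word ts a"
      using root_conj_base[OF \<open>b \<in> \<Phi>\<close>] .
    have "a \<in> S \<or> a \<in> T" using ts T by auto
    then have "word ts a \<in> span S \<or> word ts a \<in> span T"
      using word_span_invariant[of S T ts a, OF orth] word_span_invariant[of T S ts a, OF orth'] ts T
      by (auto simp: span_base Un_commute)
    then show ?thesis using ts(3) span_neg by blast
  qed
  then have "?A \<union> ?B = \<Phi>" by blast
  moreover have zero: "inner a b = 0" if "a \<in> ?A" "b \<in> ?B" for a b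
    using inner_span_orthogonal[of S T, OF orth] that by blast
  moreover have "?A \<inter> ?B = {}"
  proof (rule ccontr)
    assume "?A \<inter> ?B \<noteq> {}"
    then obtain c where "c \<in> ?A" "c \<in> ?B" by blast
    then show False using zero[of c c] root_nonzero by auto
  qed
  moreover have "?A \<noteq> {}" "?B \<noteq> {}"
    using S T base_root span_superset[of S] span_superset[of T] by blast+
  ultimately have split: "\<exists>A B. A \<noteq> {} \<and> B \<noteq> {} \<and> A \<inter> B = {} \<and> A \<union> B = \<Phi> \<and> (\<forall>a\<in>A. \<forall>b\<in>B. inner a b = 0)"
    by (intro exI[of _ ?A] exI[of _ ?B]) simp
  show False
    by (rule notE[OF irr[unfolded irreducible_root_system_def, THEN conjunct2, THEN conjunct2] split])
qed

lemma dual_nonzero: "b \<in> \<Delta> \<Longrightarrow> dual b \<noteq> 0"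
  using inner_dual[of b b] by auto

lemma W_nonzero: "u \<in> W \<Longrightarrow> x \<noteq> 0 \<Longrightarrow> u x \<noteq> 0"
  using refl_group_inner[of u \<Delta> x x] by (metis inner_eq_zero_iff inner_zero_left)

text \<open>The images of the dual vectors are nonzero, so \<open>- 1\<close> fixes none of them.\<close>

lemma no_fixed_reps_if_minus:
  assumes "\<And>x. w0 x = - x" "J \<subseteq> \<Delta>" "J \<noteq> \<Delta>"
  shows "fixed_reps J = {}"
proof (rule ccontr)
  assume "fixed_reps J \<noteq> {}"
  then obtain u where u: "u \<in> fixed_reps J" by blast
  obtain b where b: "b \<in> \<Delta> - J" using assms by blast
  have "- u (dual b) = u (dual b)"
    using u b assms(1) by (simp add: fixed_reps_def)
  then have "(2::real) *\<^sub>R u (dual b) = 0"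
    unfolding scaleR_2 by (metis add.left_inverse)
  moreover have "u (dual b) \<noteq> 0"
    using u b W_nonzero dual_nonzero by (simp add: fixed_reps_def)
  ultimately show False by simp
qed

lemma type_if_not_minus:
  assumes irr: "irreducible_root_system \<Phi>" and not: "\<not> (\<forall>x. w0 x = - x)"
  shows "(\<exists>f. simply_laced_labelling \<Delta> (card \<Delta>) (A_edges (card \<Delta>)) f) \<or> (\<exists>n\<ge>4. type_D n \<Delta>) \<or> type_E6 \<Delta>"
proof -
  have "\<exists>a\<in>\<Delta>. - w0 a \<noteq> a"
  proof (rule ccontr)
    assume none: "\<not> ?thesis"
    have "w0 = uminus"
      by (rule linear_eq_on_base) (use none refl_group_linear[OF w0_in_W] in \<open>auto simp: linear_iff equation_minus_iff\<close>)
    then show False using not by simp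
  qed
  then interpret diagram_symmetry \<Phi> \<Delta> "\<lambda>x. - w0 x"
  proof unfold_locales
    show "S = \<Delta>" if "S \<subseteq> \<Delta>" "S \<noteq> {}" "\<And>a b. a \<in> S \<Longrightarrow> adj a b \<Longrightarrow> b \<in> S" for S
      using that by (rule diagram_connected[OF irr])
    show "- w0 a \<in> \<Delta>" if "a \<in> \<Delta>" for a
      using that by (rule opposite_base)
    show "inner (- w0 a) (- w0 b) = inner a b" for a b
      by (simp add: refl_group_inner[OF w0_in_W])
    show "- w0 (- w0 a) = a" for a
      by (simp add: W_minus[OF w0_in_W] w0_involution)
  qed
  show ?thesis by (rule classification)
qed

end

section \<open>Symmetric colourings\<close>

definition reversal :: "nat \<Rightarrow> nat \<Rightarrow> nat" where
  "reversal n i = (if i \<in> {1..n} then n + 1 - i else i)"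

lemma reversal_permutes: "reversal n permutes {1..n}"
  by (rule bij_imp_permutes[OF bij_betw_byWitness[of _ "reversal n"]]) (auto simp: reversal_def)

text \<open>The index of the block that contains \<open>i\<close>. A coset of the block subgroup with representative \<open>p\<close> is
recorded by the colouring \<open>colour ns \<circ> inv p\<close>.\<close>

definition colour :: "nat list \<Rightarrow> nat \<Rightarrow> nat" where
  "colour ns i = (LEAST k. i \<le> sum_list (take (Suc k) ns))"

lemma sum_list_take_Suc: "k < length ns \<Longrightarrow> sum_list (take (Suc k) ns) = sum_list (take k ns) + ns ! k" for ns :: "nat list"
  by (simp add: take_Suc_conv_app_nth)

lemma sum_list_take_mono: "i \<le> j \<Longrightarrow> sum_list (take i ns) \<le> sum_list (take j ns)" for ns :: "nat list"
  by (metis le_add1 le_add_diff_inverse sum_list_append take_add)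

lemma sum_list_take_le: "sum_list (take i ns) \<le> sum_list ns" for ns :: "nat list"
  by (metis append_take_drop_id le_add1 sum_list_append)

lemma card_block: "k < length ns \<Longrightarrow> card (block ns k) = ns ! k"
  by (simp add: block_def sum_list_take_Suc)

lemma colour_less:
  assumes "i \<in> {1..sum_list ns}"
  shows "colour ns i < length ns"
proof -
  have "ns \<noteq> []" using assms by auto
  then have "i \<le> sum_list (take (Suc (length ns - 1)) ns)" using assms by simp
  then have "colour ns i \<le> length ns - 1" unfolding colour_def by (rule Least_le)
  then show ?thesis using \<open>ns \<noteq> []\<close> by (cases ns) auto
qed

lemma colour_eq_iff:
  assumes k: "k < length ns"
  shows "i \<in> {1..sum_list ns} \<and> colour ns i = k \<longleftrightarrow> i \<in> block ns k"
proof
  assume i: "i \<in> block ns k"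
  then have lt: "sum_list (take k ns) < i" "i \<le> sum_list (take (Suc k) ns)"
    by (auto simp: block_def)
  have "colour ns i = k"
    unfolding colour_def
  proof (rule Least_equality)
    show "i \<le> sum_list (take (Suc k) ns)" by (fact lt(2))
    fix l assume "i \<le> sum_list (take (Suc l) ns)"
    then have "\<not> Suc l \<le> k" using lt(1) sum_list_take_mono[of "Suc l" k ns] by linarith
    then show "k \<le> l" by simp
  qed
  then show "i \<in> {1..sum_list ns} \<and> colour ns i = k"
    using lt sum_list_take_le[of "Suc k" ns] by auto
next
  assume i: "i \<in> {1..sum_list ns} \<and> colour ns i = k"
  have "\<exists>l. i \<le> sum_list (take (Suc l) ns)"
    using i by (intro exI[of _ "length ns"]) simp
  then have le: "i \<le> sum_list (take (Suc k) ns)"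
    using i LeastI_ex[of "\<lambda>l. i \<le> sum_list (take (Suc l) ns)"] by (simp add: colour_def)
  have "sum_list (take k ns) < i"
  proof (cases k)
    case 0
    then show ?thesis using i by simp
  next
    case (Suc l)
    then have "\<not> i \<le> sum_list (take (Suc l) ns)"
      using i not_less_Least[of l "\<lambda>l. i \<le> sum_list (take (Suc l) ns)"] by (simp add: colour_def)
    then show ?thesis using Suc by simp
  qed
  then show "i \<in> block ns k" using le by (simp add: block_def)
qed

lemma block_eq_colour: "k < length ns \<Longrightarrow> block ns k = {i \<in> {1..sum_list ns}. colour ns i = k}"
  using colour_eq_iff[of k ns] by auto

lemma block_subgroup_iff:
  "p \<in> block_subgroup ns \<longleftrightarrow>
     p permutes {1..sum_list ns} \<and> (\<forall>i\<in>{1..sum_list ns}. colour ns (p i) = colour ns i)"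
proof
  assume p: "p \<in> block_subgroup ns"
  then have perm: "p permutes {1..sum_list ns}" by (simp add: block_subgroup_def sym_group_carrier)
  have "colour ns (p i) = colour ns i" if i: "i \<in> {1..sum_list ns}" for i
  proof -
    let ?k = "colour ns i"
    have k: "?k < length ns" using i by (rule colour_less)
    then have "i \<in> block ns ?k" using i by (simp add: block_eq_colour)
    then have "p i \<in> block ns ?k" using p k by (auto simp: block_subgroup_def)
    then show ?thesis using k by (simp add: block_eq_colour)
  qed
  with perm show "p permutes {1..sum_list ns} \<and> (\<forall>i\<in>{1..sum_list ns}. colour ns (p i) = colour ns i)"
    by blast
next
  assume p: "p permutes {1..sum_list ns} \<and> (\<forall>i\<in>{1..sum_list ns}. colour ns (p i) = colour ns i)"
  have "p ` block ns k = block ns k" if k: "k < length ns" for k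
  proof (rule card_subset_eq)
    show "finite (block ns k)" by (simp add: block_def)
    show "p ` block ns k \<subseteq> block ns k"
      unfolding block_eq_colour[OF k] using p permutes_in_image by fastforce
    show "card (p ` block ns k) = card (block ns k)"
      by (rule card_image) (use p permutes_inj_on in blast)
  qed
  then show "p \<in> block_subgroup ns" using p by (simp add: block_subgroup_def sym_group_carrier)
qed

lemma count_image_mset_set:
  "finite A \<Longrightarrow> count (image_mset f (mset_set A)) k = card {i \<in> A. f i = k}"
  by (induction A rule: finite_induct) (auto simp: Collect_conv_if card_insert_if conj_disj_distribR Collect_disj_eq
      intro!: arg_cong[where f = card])

lemma card_colour:
  assumes "p permutes {1..sum_list ns}" "k < length ns"
  shows "card {i \<in> {1..sum_list ns}. colour ns (p i) = k} = ns ! k"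
proof -
  have "p ` {i \<in> {1..sum_list ns}. colour ns (p i) = k} = {i \<in> {1..sum_list ns}. colour ns i = k}"
    (is "p ` ?A = ?B")
  proof
    show "?B \<subseteq> p ` ?A"
    proof
      fix j assume j: "j \<in> ?B"
      then have "inv' p j \<in> ?A" "j = p (inv' p j)"
        using assms(1) permutes_inverses(1)[OF assms(1)] permutes_in_image[OF permutes_inv[OF assms(1)]] by auto
      then show "j \<in> p ` ?A" by blast
    qed
  qed (use assms(1) permutes_in_image in fastforce)
  moreover have "card (p ` ?A) = card ?A"
    by (rule card_image) (use assms(1) permutes_inj_on in blast)
  ultimately show ?thesis
    using card_block[OF assms(2)] block_eq_colour[OF assms(2)] by simp
qed

lemma left_centre_right:
  fixes i n :: nat
  assumes "i \<in> {1..n}"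
  obtains "i \<le> n div 2" "\<not> n + 1 - i \<le> n div 2" | "odd n" "i = Suc (n div 2)"
    | "n + 1 - i \<le> n div 2" "\<not> i \<le> n div 2"
proof -
  have "i \<le> n div 2 \<and> \<not> n + 1 - i \<le> n div 2 \<or> odd n \<and> i = Suc (n div 2) \<or>
      n + 1 - i \<le> n div 2 \<and> \<not> i \<le> n div 2"
  proof (cases "even n")
    case True
    then obtain h where "n = 2 * h" by (elim evenE)
    then show ?thesis using assms by auto
  next
    case False
    then obtain h where "n = 2 * h + 1" by (elim oddE)
    then show ?thesis using assms by auto
  qed
  then show ?thesis using that by blast
qed

text \<open>
The reversal pairs the left half with the right half; only the centre of an interval of odd length is
its own partner.\<close>

lemma card_symmetric_fibre:
  fixes c :: "nat \<Rightarrow> 'c"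
  assumes sym: "\<And>i. i \<in> {1..n} \<Longrightarrow> c (n + 1 - i) = c i"
  shows "card {i \<in> {1..n}. c i = k} =
    2 * card {i \<in> {1..n div 2}. c i = k} + (if odd n \<and> c (Suc (n div 2)) = k then 1 else 0)"
proof -
  let ?L = "{i \<in> {1..n div 2}. c i = k}"
  let ?M = "if odd n \<and> c (Suc (n div 2)) = k then {Suc (n div 2)} else {}"
  let ?R = "(\<lambda>i. n + 1 - i) ` ?L"
  have "{i \<in> {1..n}. c i = k} = ?L \<union> ?M \<union> ?R" (is "?A = _")
  proof
    show "?A \<subseteq> ?L \<union> ?M \<union> ?R"
    proof
      fix i assume i: "i \<in> ?A"
      then have "i \<in> {1..n}" by blast
      then show "i \<in> ?L \<union> ?M \<union> ?R"
      proof (cases rule: left_centre_right)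
        case 3
        then have "n + 1 - i \<in> ?L" "i = n + 1 - (n + 1 - i)" using i sym[of i] by auto
        then show ?thesis by blast
      qed (use i in auto)
    qed
    show "?L \<union> ?M \<union> ?R \<subseteq> ?A"
    proof -
      have "n + 1 - i \<in> ?A" if "i \<in> ?L" for i using that sym[of i] by auto
      moreover have "?M \<subseteq> ?A" by (auto elim!: oddE)
      ultimately show ?thesis by auto
    qed
  qed
  moreover have "card ?R = card ?L"
    by (rule card_image) (auto simp: inj_on_def)
  moreover have "(?L \<union> ?M) \<inter> ?R = {}" "?L \<inter> ?M = {}"
    by (auto elim!: oddE)
  ultimately show ?thesis by (simp add: card_Un_disjoint)
qed

text \<open>The permutations whose cosets are counted. Their colourings are the symmetric ones.\<close>

definition fixed_perms :: "nat list \<Rightarrow> (nat \<Rightarrow> nat) set" where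
  "fixed_perms ns = {p. p permutes {1..sum_list ns} \<and>
     inv' p \<circ> (reversal (sum_list ns) \<circ> p) \<in> block_subgroup ns}"

lemma inv_comp_in_block_subgroup_iff:
  assumes p: "p permutes {1..sum_list ns}" and q: "q permutes {1..sum_list ns}"
  shows "inv' p \<circ> q \<in> block_subgroup ns \<longleftrightarrow>
    (\<forall>j\<in>{1..sum_list ns}. colour ns (inv' p j) = colour ns (inv' q j))"
proof -
  let ?I = "{1..sum_list ns}"
  have "inv' p \<circ> q permutes ?I"
    by (rule permutes_compose[OF q permutes_inv[OF p]])
  then have "inv' p \<circ> q \<in> block_subgroup ns \<longleftrightarrow> (\<forall>i\<in>?I. colour ns (inv' p (q i)) = colour ns i)"
    by (simp add: block_subgroup_iff)
  also have "\<dots> \<longleftrightarrow> (\<forall>j\<in>q ` ?I. colour ns (inv' p j) = colour ns (inv' q j))"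
    by (simp add: permutes_inverses(2)[OF q])
  also have "q ` ?I = ?I" by (rule permutes_image[OF q])
  finally show ?thesis .
qed

lemma fixed_perms_iff:
  "p \<in> fixed_perms ns \<longleftrightarrow> p permutes {1..sum_list ns} \<and>
     (\<forall>i\<in>{1..sum_list ns}. colour ns (inv' p (sum_list ns + 1 - i)) = colour ns (inv' p i))"
proof (cases "p permutes {1..sum_list ns}")
  case True
  let ?r = "reversal (sum_list ns)"
  have rp: "?r \<circ> p permutes {1..sum_list ns}"
    by (rule permutes_compose[OF True reversal_permutes])
  have "inv' (?r \<circ> p) i = inv' p (?r i)" for i
  proof -
    have "?r (?r i) = i" by (auto simp: reversal_def)
    then have "(?r \<circ> p) (inv' p (?r i)) = i" using permutes_inverses(1)[OF True] by simp
    then show ?thesis using permutes_inverses(2)[OF rp] by metis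
  qed
  then show ?thesis
    using True inv_comp_in_block_subgroup_iff[OF True rp] by (auto simp: fixed_perms_def reversal_def)
qed (simp add: fixed_perms_def)

lemma fixed_perms_fibre:
  assumes p: "p \<in> fixed_perms ns" and k: "k < length ns"
  defines "n \<equiv> sum_list ns"
  shows "ns ! k = 2 * card {i \<in> {1..n div 2}. colour ns (inv' p i) = k} +
    (if odd n \<and> colour ns (inv' p (Suc (n div 2))) = k then 1 else 0)"
proof -
  have "card {i \<in> {1..n}. colour ns (inv' p i) = k} = ns ! k"
    using card_colour[OF permutes_inv k, of p] p by (simp add: fixed_perms_iff n_def)
  then show ?thesis
    using card_symmetric_fibre[of n "\<lambda>i. colour ns (inv' p i)" k] p by (simp add: fixed_perms_iff n_def)
qed

lemma length_filter_le_1: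
  assumes "\<And>i j. i < length xs \<Longrightarrow> j < length xs \<Longrightarrow> P (xs ! i) \<Longrightarrow> P (xs ! j) \<Longrightarrow> i = j"
  shows "length (filter P xs) \<le> 1"
proof -
  have "length (filter P xs) = card {i. i < length xs \<and> P (xs ! i)}"
    by (rule length_filter_conv_card)
  also have "\<dots> \<le> 1"
    using assms by (simp add: card_le_Suc0_iff_eq)
  finally show ?thesis .
qed

text \<open>A colour class of odd size must contain the centre.\<close>

lemma admissible_if_fixed_perms:
  assumes "fixed_perms ns \<noteq> {}" "\<forall>m\<in>set ns. 0 < m"
  shows "admissible_blocks ns"
proof -
  obtain p where p: "p \<in> fixed_perms ns" using assms by blast
  have odd: "k = colour ns (inv' p (Suc (sum_list ns div 2)))" if "k < length ns" "odd (ns ! k)" for k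
    using fixed_perms_fibre[OF p that(1)] that(2) by (auto split: if_splits)
  show ?thesis
    unfolding admissible_blocks_def
  proof (intro conjI length_filter_le_1)
    fix i j assume "i < length ns" "j < length ns" "odd (ns ! i)" "odd (ns ! j)"
    then show "i = j" using odd[of i] odd[of j] by simp
  qed (use assms(2) in simp)
qed

definition half_multiset :: "nat list \<Rightarrow> nat multiset" where
  "half_multiset ns = (\<Sum>k<length ns. replicate_mset (ns ! k div 2) k)"

lemma count_half_multiset:
  "count (half_multiset ns) k = (if k < length ns then ns ! k div 2 else 0)"
  by (simp add: half_multiset_def count_sum)

definition left_half :: "nat list \<Rightarrow> (nat \<Rightarrow> nat) \<Rightarrow> nat list" where
  "left_half ns p = map (\<lambda>i. colour ns (inv' p i)) [1..<Suc (sum_list ns div 2)]"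

lemma count_left_half:
  "count (mset (left_half ns p)) k = card {i \<in> {1..sum_list ns div 2}. colour ns (inv' p i) = k}"
proof -
  have "mset (left_half ns p) = image_mset (\<lambda>i. colour ns (inv' p i)) (mset_set {1..sum_list ns div 2})"
    unfolding left_half_def by (simp add: atLeastLessThanSuc_atLeastAtMost del: upt_Suc)
  then show ?thesis by (simp add: count_image_mset_set)
qed

lemma sum_list_halves: "sum_list ns = 2 * (\<Sum>m\<leftarrow>ns. m div 2) + length (filter odd ns)"
  for ns :: "nat list"
  by (induction ns) (auto elim!: oddE)

lemma size_half_multiset:
  assumes "length (filter odd ns) \<le> 1"
  shows "size (half_multiset ns) = sum_list ns div 2"
proof -
  have "length (filter odd ns) = 0 \<or> length (filter odd ns) = 1" using assms by linarith
  then have "sum_list ns div 2 = (\<Sum>m\<leftarrow>ns. m div 2)"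
    using sum_list_halves[of ns] by presburger
  also have "\<dots> = (\<Sum>k<length ns. ns ! k div 2)"
    by (simp add: sum_list_sum_nth atLeast0LessThan)
  also have "\<dots> = size (half_multiset ns)"
    by (simp add: half_multiset_def size_multiset_sum)
  finally show ?thesis by simp
qed

text \<open>The left half determines the right half by symmetry, and then the colour of the centre as the one
whose class is still incomplete.\<close>

lemma left_half_eq_iff:
  assumes p: "p \<in> fixed_perms ns" and q: "q \<in> fixed_perms ns"
  shows "left_half ns p = left_half ns q \<longleftrightarrow> inv' p \<circ> q \<in> block_subgroup ns"
proof -
  let ?n = "sum_list ns"
  let ?c = "\<lambda>p i. colour ns (inv' p i)"
  have perm: "p permutes {1..?n}" "q permutes {1..?n}"
    and sp: "\<And>i. i \<in> {1..?n} \<Longrightarrow> ?c p (?n + 1 - i) = ?c p i"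
    and sq: "\<And>i. i \<in> {1..?n} \<Longrightarrow> ?c q (?n + 1 - i) = ?c q i"
    using p q unfolding fixed_perms_iff by blast+
  have "left_half ns p = left_half ns q \<longleftrightarrow> (\<forall>i\<in>{1..?n div 2}. ?c p i = ?c q i)"
    by (auto simp: left_half_def)
  also have "\<dots> \<longleftrightarrow> (\<forall>i\<in>{1..?n}. ?c p i = ?c q i)"
  proof
    assume half: "\<forall>i\<in>{1..?n div 2}. ?c p i = ?c q i"
    have centre: "?c p (Suc (?n div 2)) = ?c q (Suc (?n div 2))" if odd: "odd ?n"
    proof -
      let ?k = "?c p (Suc (?n div 2))"
      have "Suc (?n div 2) \<in> {1..?n}"
        using odd by (elim oddE) simp
      then have "inv' p (Suc (?n div 2)) \<in> {1..?n}"
        by (simp only: permutes_in_image[OF permutes_inv[OF perm(1)]])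
      then have k: "?k < length ns" by (rule colour_less)
      have "{i \<in> {1..?n div 2}. ?c p i = ?k} = {i \<in> {1..?n div 2}. ?c q i = ?k}"
        using half by auto
      then have "(if ?c q (Suc (?n div 2)) = ?k then 1 else 0) = (1::nat)"
        using fixed_perms_fibre[OF p k] fixed_perms_fibre[OF q k] odd by simp
      then show ?thesis by (simp split: if_splits)
    qed
    show "\<forall>i\<in>{1..?n}. ?c p i = ?c q i"
    proof
      fix i assume i: "i \<in> {1..?n}"
      from i show "?c p i = ?c q i"
      proof (cases rule: left_centre_right)
        case 1
        then show ?thesis using half i by simp
      next
        case 2
        then show ?thesis using centre by simp
      next
        case 3
        then have "?n + 1 - i \<in> {1..?n div 2}" using i by auto
        then have "?c p (?n + 1 - i) = ?c q (?n + 1 - i)" using half by blast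
        then show ?thesis using sp[OF i] sq[OF i] by simp
      qed
    qed
  qed auto
  also have "\<dots> \<longleftrightarrow> inv' p \<circ> q \<in> block_subgroup ns"
    using inv_comp_in_block_subgroup_iff[OF perm] by simp
  finally show ?thesis .
qed

text \<open>Conversely an arrangement of the half multiset is mirrored, and the centre receives the colour of odd
size if there is one. The colour classes then have the sizes of the blocks, so some permutation
transforms the standard colouring into this one.\<close>

lemma left_half_image:
  assumes adm: "admissible_blocks ns"
  shows "left_half ns ` fixed_perms ns = permutations_of_multiset (half_multiset ns)"
proof
  let ?n = "sum_list ns"
  show "left_half ns ` fixed_perms ns \<subseteq> permutations_of_multiset (half_multiset ns)"
  proof
    fix xs assume "xs \<in> left_half ns ` fixed_perms ns"
    then obtain p where p: "p \<in> fixed_perms ns" "xs = left_half ns p" by blast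
    have "count (mset xs) k = count (half_multiset ns) k" for k
    proof (cases "k < length ns")
      case True
      then show ?thesis
        using fixed_perms_fibre[OF p(1) True] by (simp add: p(2) count_left_half count_half_multiset)
    next
      case False
      have "colour ns (inv' p i) \<noteq> k" if "i \<in> {1..?n div 2}" for i
      proof -
        have "inv' p i \<in> {1..?n}"
          using that p(1) permutes_in_image[OF permutes_inv, of p "{1..?n}" i] by (auto simp: fixed_perms_iff)
        then show ?thesis using colour_less False by blast
      qed
      then have "{i \<in> {1..?n div 2}. colour ns (inv' p i) = k} = {}" by blast
      then show ?thesis using False by (simp add: p(2) count_left_half count_half_multiset del: Collect_empty_eq)
    qed
    then show "xs \<in> permutations_of_multiset (half_multiset ns)"
      by (intro permutations_of_multisetI multiset_eqI)
  qed
  show "permutations_of_multiset (half_multiset ns) \<subseteq> left_half ns ` fixed_perms ns"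
  proof
    fix xs assume "xs \<in> permutations_of_multiset (half_multiset ns)"
    then have xs: "mset xs = half_multiset ns" by (rule permutations_of_multisetD)
    have odd1: "length (filter odd ns) \<le> 1" using adm by (simp add: admissible_blocks_def)
    have len: "length xs = ?n div 2"
      using size_half_multiset[OF odd1] xs by (metis size_mset)
    \<comment> \<open>the colour of the centre, an arbitrary value if all blocks are even\<close>
    define z where "z = (SOME k. k < length ns \<and> odd (ns ! k))"
    define c where "c i = (if i \<le> ?n div 2 then xs ! (i - 1)
      else if ?n + 1 - i \<le> ?n div 2 then xs ! (?n - i) else z)" for i
    have sym: "c (?n + 1 - i) = c i" if "i \<in> {1..?n}" for i
    proof -
      from that show ?thesis
        by (cases rule: left_centre_right) (use that in \<open>auto simp: c_def elim!: oddE\<close>)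
    qed
    have fibre: "card {i \<in> {1..?n div 2}. c i = k} = count (half_multiset ns) k" for k
    proof -
      have "count (mset xs) k = card {i. i < length xs \<and> xs ! i = k}"
        by (simp add: count_mset count_list_eq_length_filter length_filter_conv_card eq_commute)
      also have "\<dots> = card (Suc ` {i. i < length xs \<and> xs ! i = k})"
        by (simp add: card_image)
      also have "Suc ` {i. i < length xs \<and> xs ! i = k} = {i \<in> {1..?n div 2}. c i = k}"
        (is "_ ` ?A = ?B")
      proof
        show "?B \<subseteq> Suc ` ?A"
        proof
          fix i assume "i \<in> ?B"
          then have "i - 1 \<in> ?A" "i = Suc (i - 1)" using len by (auto simp: c_def)
          then show "i \<in> Suc ` ?A" by blast
        qed
      qed (use len in \<open>auto simp: c_def\<close>)
      finally show ?thesis using xs by simp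
    qed
    have unique: "k = l" if "k < length ns" "odd (ns ! k)" "l < length ns" "odd (ns ! l)" for k l
    proof -
      have "card {i. i < length ns \<and> odd (ns ! i)} \<le> 1"
        using odd1 by (simp add: length_filter_conv_card)
      then show ?thesis
        using that by (auto simp: card_le_Suc0_iff_eq)
    qed
    have total: "?n mod 2 = length (filter odd ns)"
    proof -
      have "length (filter odd ns) = 0 \<or> length (filter odd ns) = 1" using odd1 by linarith
      then show ?thesis using sum_list_halves[of ns] by presburger
    qed
    have z: "odd ?n \<and> c (Suc (?n div 2)) = k \<longleftrightarrow> odd (ns ! k)" if k: "k < length ns" for k
    proof (cases "odd ?n")
      case True
      then have "length (filter odd ns) = 1" using total by (simp add: odd_iff_mod_2_eq_one)
      then have "\<exists>k. k < length ns \<and> odd (ns ! k)"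
        by (metis One_nat_def filter_False in_set_conv_nth length_0_conv zero_neq_one)
      then have "z < length ns \<and> odd (ns ! z)" unfolding z_def by (rule someI_ex)
      moreover have "c (Suc (?n div 2)) = z" using True by (auto simp: c_def elim!: oddE)
      ultimately show ?thesis using unique True k by blast
    next
      case False
      then have "filter odd ns = []" using total by (simp add: even_iff_mod_2_eq_zero)
      then show ?thesis using k False by (simp add: filter_empty_conv)
    qed
    have count: "card {i \<in> {1..?n}. c i = k} = card {i \<in> {1..?n}. colour ns i = k}" for k
    proof (cases "k < length ns")
      case True
      have "card {i \<in> {1..?n}. c i = k} = 2 * (ns ! k div 2) + (if odd (ns ! k) then 1 else 0)"
        using card_symmetric_fibre[of ?n c k, OF sym] fibre[of k] z[OF True] True
        by (simp add: count_half_multiset)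
      also have "\<dots> = ns ! k" using odd_two_times_div_two_succ[of "ns ! k"] by auto
      also have "\<dots> = card {i \<in> {1..?n}. colour ns i = k}"
        using card_block[OF True] block_eq_colour[OF True] by simp
      finally show ?thesis .
    next
      case False
      then have "{i \<in> {1..?n}. colour ns i = k} = {}" using colour_less by blast
      moreover have "\<not> (odd ?n \<and> c (Suc (?n div 2)) = k)"
      proof
        assume "odd ?n \<and> c (Suc (?n div 2)) = k"
        then have "\<exists>l. l < length ns \<and> odd (ns ! l)"
          using total by (metis filter_False in_set_conv_nth list.size(3) odd_iff_mod_2_eq_one zero_neq_one)
        then have "z < length ns" unfolding z_def by (metis (mono_tags, lifting) someI_ex)
        moreover have "c (Suc (?n div 2)) = z"
          using \<open>odd ?n \<and> _\<close> by (auto simp: c_def elim!: oddE)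
        ultimately show False using \<open>odd ?n \<and> _\<close> False by simp
      qed
      then have "card {i \<in> {1..?n}. c i = k} = 0"
        using card_symmetric_fibre[of ?n c k, OF sym] fibre[of k] False
        by (simp only: count_half_multiset if_False)
      ultimately show ?thesis by (simp only: card.empty)
    qed
    have "image_mset c (mset_set {1..?n}) = image_mset (colour ns) (mset_set {1..?n})"
      by (rule multiset_eqI) (simp only: count_image_mset_set[OF finite_atLeastAtMost] count)
    then obtain q where q: "q permutes {1..?n}" "\<forall>i\<in>{1..?n}. c i = colour ns (q i)"
      using image_mset_eq_implies_permutes[of "{1..?n}" c "colour ns"] by auto
    define p where "p = inv' q"
    have p: "p permutes {1..?n}" "inv' p = q"
      using q(1) permutes_inv permutes_inv_inv by (auto simp: p_def)
    have "p \<in> fixed_perms ns"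
      unfolding fixed_perms_iff
    proof (intro conjI ballI)
      fix i assume i: "i \<in> {1..?n}"
      then have "?n + 1 - i \<in> {1..?n}" by auto
      then show "colour ns (inv' p (?n + 1 - i)) = colour ns (inv' p i)"
        using q(2) sym[OF i] i p(2) by metis
    qed (fact p(1))
    moreover have "left_half ns p = xs"
    proof (rule nth_equalityI)
      show "length (left_half ns p) = length xs" by (simp add: left_half_def len del: upt_Suc)
      fix i assume "i < length (left_half ns p)"
      then have i: "i < ?n div 2" by (simp add: left_half_def del: upt_Suc)
      then have "left_half ns p ! i = c (Suc i)"
        using q(2) p(2) by (simp add: left_half_def del: upt_Suc)
      then show "left_half ns p ! i = xs ! i" using i by (simp add: c_def)
    qed
    ultimately show "xs \<in> left_half ns ` fixed_perms ns" by blast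
  qed
qed

theorem card_left_half:
  assumes adm: "admissible_blocks ns"
  shows "real (card (left_half ns ` fixed_perms ns)) =
    fact (sum_list ns div 2) / (\<Prod>m\<leftarrow>ns. fact (m div 2))"
proof -
  let ?M = "half_multiset ns"
  have "(\<Prod>x\<in>set_mset ?M. fact (count ?M x)) = (\<Prod>k<length ns. fact (count ?M k) :: real)"
  proof (rule prod.mono_neutral_left)
    show "set_mset ?M \<subseteq> {..<length ns}"
      by (auto simp: count_half_multiset simp flip: count_greater_zero_iff split: if_splits)
    show "\<forall>k\<in>{..<length ns} - set_mset ?M. fact (count ?M k) = (1::real)"
      by (auto simp: not_in_iff)
  qed simp
  also have "\<dots> = (\<Prod>k<length ns. fact (ns ! k div 2))"
    by (intro prod.cong) (auto simp: count_half_multiset)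
  also have "\<dots> = (\<Prod>m\<leftarrow>ns. fact (m div 2))"
    using prod.list_conv_set_nth[of "map (\<lambda>m. fact (m div 2) :: real) ns"] by (simp add: atLeast0LessThan)
  finally have prod: "(\<Prod>x\<in>set_mset ?M. fact (count ?M x)) = (\<Prod>m\<leftarrow>ns. fact (m div 2) :: real)" .
  have "card (permutations_of_multiset ?M) * (\<Prod>x\<in>set_mset ?M. fact (count ?M x)) = fact (size ?M)"
    by (rule card_permutations_of_multiset_aux)
  then have "real (card (permutations_of_multiset ?M) * (\<Prod>x\<in>set_mset ?M. fact (count ?M x))) = real (fact (size ?M))"
    by (simp only:)
  then have "real (card (permutations_of_multiset ?M)) * (\<Prod>x\<in>set_mset ?M. fact (count ?M x)) = fact (size ?M)"
    by (simp only: of_nat_mult of_nat_prod of_nat_fact)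
  moreover have "(\<Prod>m\<leftarrow>ns. fact (m div 2) :: real) \<noteq> 0"
    by (induction ns) auto
  ultimately show ?thesis
    using prod left_half_image[OF adm] size_half_multiset[of ns] adm
    by (simp add: admissible_blocks_def eq_divide_eq)
qed

section \<open>Labelled diagrams and weights\<close>

lemma cartan_int_add: "cartan_int (x + y) a = cartan_int x a + cartan_int y a"
  by (simp add: cartan_int_def inner_add_left add_divide_distrib algebra_simps)

lemma cartan_int_diff: "cartan_int (x - y) a = cartan_int x a - cartan_int y a"
  by (simp add: cartan_int_def inner_diff_left diff_divide_distrib algebra_simps)

lemma cartan_int_scale: "cartan_int (c *\<^sub>R x) a = c * cartan_int x a"
  by (simp add: cartan_int_def)

lemma cartan_int_sum: "cartan_int (\<Sum>i\<in>A. x i) a = (\<Sum>i\<in>A. cartan_int (x i) a)"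
  by (simp add: cartan_int_def inner_sum_left sum_distrib_left sum_divide_distrib)

lemma cartan_int_minus_right: "cartan_int x (- a) = - cartan_int x a"
  by (simp add: cartan_int_def)

lemma cartan_int_self: "a \<noteq> 0 \<Longrightarrow> cartan_int a a = 2"
  by (simp add: cartan_int_def)

context root_basis
begin

text \<open>Scaling the dual vectors turns them into the fundamental weights.\<close>

lemma cartan_int_dual:
  assumes "a \<in> \<Delta>" "b \<in> \<Delta>"
  shows "cartan_int ((inner a a / 2) *\<^sub>R dual a) b = (if a = b then 1 else 0)"
  using assms base_nonzero[of b] by (simp add: cartan_int_def inner_dual)

lemma cartan_int_eqI:
  assumes "\<And>a. a \<in> \<Delta> \<Longrightarrow> cartan_int x a = cartan_int y a"
  shows "x = y"
proof (rule base_eqI)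
  fix a assume a: "a \<in> \<Delta>"
  then show "inner a x = inner a y"
    using assms[OF a] base_nonzero[OF a] by (simp add: cartan_int_def inner_commute)
qed

text \<open>Each reflection changes a weight by an integral multiple of a root, so the Weyl group acts trivially on
the weight lattice modulo the root lattice.\<close>

lemma weight_shift:
  assumes w: "w \<in> W" and x: "\<And>a. a \<in> \<Delta> \<Longrightarrow> cartan_int x a \<in> \<int>" and c: "c \<in> \<Delta>"
  shows "inner (dual c) (w x - x) \<in> \<int>"
proof -
  obtain ss where ss: "set ss \<subseteq> \<Delta>" "w = word ss" using w by (rule refl_groupE)
  have "\<forall>c\<in>\<Delta>. inner (dual c) (word ss x - x) \<in> \<int>" using ss(1)
  proof (induction ss)
    case (Cons a ss)
    let ?y = "word ss x"
    have a: "a \<in> \<Delta>" and IH: "\<And>c. c \<in> \<Delta> \<Longrightarrow> inner (dual c) (?y - x) \<in> \<int>" using Cons by auto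
    have "cartan_int (?y - x) a = (\<Sum>c\<in>\<Delta>. inner (dual c) (?y - x) * cartan_int c a)"
      by (subst base_expansion[of "?y - x"]) (simp add: cartan_int_sum cartan_int_scale)
    also have "\<dots> \<in> \<int>" by (intro Ints_sum Ints_mult IH cartan_int_Ints base_root a)
    finally have "cartan_int ?y a \<in> \<int>"
      using Ints_add[OF _ x[OF a], of "cartan_int (?y - x) a"] by (simp add: cartan_int_diff)
    moreover have "inner (dual c) (word (a # ss) x - x) =
        inner (dual c) (?y - x) - cartan_int ?y a * inner (dual c) a" for c
      by (simp add: reflection_def inner_diff_right)
    ultimately show ?case using IH a by (auto simp: inner_dual)
  qed simp
  then show ?thesis using ss c by simp
qed

lemma labelling_bij: "simply_laced_labelling \<Delta> n E f \<Longrightarrow> bij_betw f {1..n} \<Delta>"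
  unfolding simply_laced_labelling_def by (rule conjunct1)

lemma labelling_base: "simply_laced_labelling \<Delta> n E f \<Longrightarrow> i \<in> {1..n} \<Longrightarrow> f i \<in> \<Delta>"
  using bij_betwE[OF labelling_bij] by blast

lemma labelling_onto:
  assumes "simply_laced_labelling \<Delta> n E f" "a \<in> \<Delta>"
  obtains i where "i \<in> {1..n}" "a = f i"
  using bij_betw_imp_surj_on[OF labelling_bij[OF assms(1)]] assms(2) that by blast

lemma labelling_inj:
  "simply_laced_labelling \<Delta> n E f \<Longrightarrow> i \<in> {1..n} \<Longrightarrow> j \<in> {1..n} \<Longrightarrow> f i = f j \<longleftrightarrow> i = j"
  using inj_on_eq_iff[OF bij_betw_imp_inj_on[OF labelling_bij]] by blast

lemma labelling_cartan_int:
  assumes "simply_laced_labelling \<Delta> n E f" "i \<in> {1..n}" "j \<in> {1..n}"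
  shows "cartan_int (f i) (f j) = (if i = j then 2 else if {i, j} \<in> E then -1 else 0)"
proof (cases "i = j")
  case True
  then show ?thesis
    using cartan_int_self[OF base_nonzero[OF labelling_base[OF assms(1,2)]]] by simp
next
  case False
  then show ?thesis
    using assms(1)[unfolded simply_laced_labelling_def, THEN conjunct2, rule_format, OF assms(2,3)]
    by simp
qed

lemma labelling_card: "simply_laced_labelling \<Delta> n E f \<Longrightarrow> card \<Delta> = n"
  using bij_betw_same_card[OF labelling_bij, of n E f] by simp

text \<open>Cartan integers determine the edges, so a set of simple roots with its own labelling is an induced
subgraph of the diagram, embedded by \<open>t\<close>.\<close>

lemma labelled_subset:
  assumes f: "simply_laced_labelling \<Delta> n E f" and J: "J \<subseteq> \<Delta>"
    and g: "simply_laced_labelling J m F g"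
  obtains t where "\<And>i. i \<in> {1..m} \<Longrightarrow> t i \<in> {1..n}" "J = f ` t ` {1..m}"
    "\<And>i j. i \<in> {1..m} \<Longrightarrow> j \<in> {1..m} \<Longrightarrow> t i = t j \<longleftrightarrow> i = j"
    "\<And>i j. i \<in> {1..m} \<Longrightarrow> j \<in> {1..m} \<Longrightarrow> i \<noteq> j \<Longrightarrow> {i, j} \<in> F \<longleftrightarrow> {t i, t j} \<in> E"
    "card (\<Delta> - J) = n - m"
proof -
  have gbij: "bij_betw g {1..m} J" using g by (simp add: simply_laced_labelling_def)
  have ginj: "g i = g j \<longleftrightarrow> i = j" if "i \<in> {1..m}" "j \<in> {1..m}" for i j
    using inj_on_eq_iff[OF bij_betw_imp_inj_on[OF gbij]] that by blast
  have "\<exists>k\<in>{1..n}. g i = f k" if "i \<in> {1..m}" for i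
    using labelling_onto[OF f, of "g i"] bij_betwE[OF gbij] that J by blast
  then obtain t where t: "\<And>i. i \<in> {1..m} \<Longrightarrow> t i \<in> {1..n} \<and> g i = f (t i)" by metis
  have inj: "t i = t j \<longleftrightarrow> i = j" if "i \<in> {1..m}" "j \<in> {1..m}" for i j
    using t that ginj by metis
  have edge: "{i, j} \<in> F \<longleftrightarrow> {t i, t j} \<in> E" if ij: "i \<in> {1..m}" "j \<in> {1..m}" "i \<noteq> j" for i j
  proof -
    have "cartan_int (g i) (g j) = (if {i, j} \<in> F then -1 else 0)"
      using g ij by (simp add: simply_laced_labelling_def)
    then show ?thesis
      using labelling_cartan_int[OF f, of "t i" "t j"] t[OF ij(1)] t[OF ij(2)] inj[OF ij(1,2)] ij(3)
      by (auto split: if_splits)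
  qed
  have "J = f ` t ` {1..m}"
    unfolding image_image bij_betw_imp_surj_on[OF gbij, symmetric] using t by (intro image_cong) auto
  moreover have "card (\<Delta> - J) = n - m"
    using J finite_base labelling_card[OF f] bij_betw_same_card[OF gbij]
    by (simp add: card_Diff_subset finite_subset)
  ultimately show ?thesis using that t inj edge by blast
qed

end

section \<open>Type A\<close>

locale type_A_basis = root_basis +
  fixes n :: nat and f :: "nat \<Rightarrow> 'a"
  assumes labelling: "simply_laced_labelling \<Delta> (n - 1) (A_edges (n - 1)) f"
begin

lemma node: "i \<in> {1..<n} \<Longrightarrow> f i \<in> \<Delta>"
  using labelling_base[OF labelling, of i] by auto

lemma node_onto:
  assumes "a \<in> \<Delta>" obtains i where "i \<in> {1..<n}" "a = f i"
proof -
  obtain i where i: "i \<in> {1..n - 1}" "a = f i" by (rule labelling_onto[OF labelling assms])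
  then have "i \<in> {1..<n}" by auto
  then show ?thesis using i(2) by (rule that)
qed

lemma node_inj:
  assumes "i \<in> {1..<n}" "j \<in> {1..<n}"
  shows "f i = f j \<longleftrightarrow> i = j"
proof -
  have "i \<in> {1..n - 1}" "j \<in> {1..n - 1}" using assms by auto
  then show ?thesis by (rule labelling_inj[OF labelling])
qed

lemma cartan_int_node:
  assumes "i \<in> {1..<n}" "j \<in> {1..<n}"
  shows "cartan_int (f i) (f j) = (if i = j then 2 else if j = Suc i \<or> i = Suc j then -1 else 0)"
  using labelling_cartan_int[OF labelling, of i j] assms
  by (auto simp: A_edges_def doubleton_eq_iff)

text \<open>
The weights of the standard representation, that is, the coordinate vectors projected to the
hyperplane of sum zero. The first one is the first fundamental weight, and \<open>f j = wt j - wt (j + 1)\<close>.\<close>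

definition wt :: "nat \<Rightarrow> 'a" where
  "wt j = (inner (f 1) (f 1) / 2) *\<^sub>R dual (f 1) - (\<Sum>k\<in>{1..<j}. f k)"

lemma wt_Suc: "1 \<le> j \<Longrightarrow> wt (Suc j) = wt j - f j"
  by (simp add: wt_def atLeastLessThanSuc)

lemma cartan_int_wt:
  assumes i: "i \<in> {1..<n}" and "1 \<le> j" "j \<le> n"
  shows "cartan_int (wt j) (f i) = (if i = j then 1 else 0) - (if j = Suc i then 1 else 0)"
  using assms(2,3)
proof (induction j rule: dec_induct)
  case base
  have 1: "1 \<in> {1..<n}" using i by auto
  have "f 1 = f i \<longleftrightarrow> i = 1"
    using node_inj[OF 1 i] by auto
  then show ?case
    using cartan_int_dual[OF node[OF 1] node[OF i]] i by (simp add: wt_def)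
next
  case (step j)
  then show ?case
    using cartan_int_node[of j i] i by (auto simp: wt_Suc cartan_int_diff)
qed

lemma reflection_wt:
  assumes i: "i \<in> {1..<n}" and j: "j \<in> {1..n}"
  shows "reflection (f i) (wt j) = wt (transpose i (Suc i) j)"
  using cartan_int_wt[OF i, of j] j i wt_Suc[of i]
  by (auto simp: reflection_def transpose_def)

lemma wt_inj:
  assumes "j \<in> {1..n}" "k \<in> {1..n}" "wt j = wt k"
  shows "j = k"
proof -
  have "False" if "j < k" "j \<in> {1..n}" "k \<in> {1..n}" "wt j = wt k" for j k
    using that cartan_int_wt[of j j] cartan_int_wt[of j k] by (auto split: if_splits)
  then show ?thesis using assms by (metis linorder_neqE_nat)
qed

text \<open>Consequently the stabiliser of a fundamental weight consists of the permutations that preserve an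
initial segment.\<close>

lemma sum_wt:
  assumes c: "c \<in> {1..<n}"
  shows "(\<Sum>j\<in>{1..c}. wt j) = (inner (f c) (f c) / 2) *\<^sub>R dual (f c)"
proof (rule cartan_int_eqI)
  fix a assume "a \<in> \<Delta>"
  then obtain i where i: "i \<in> {1..<n}" "a = f i" by (rule node_onto)
  have "cartan_int (\<Sum>j\<in>{1..c}. wt j) a
      = (\<Sum>j\<in>{1..c}. (if i = j then 1 else 0) - (if j = Suc i then 1 else 0))"
    unfolding cartan_int_sum i(2) using c by (intro sum.cong) (auto simp: cartan_int_wt[OF i(1)])
  also have "\<dots> = (if i \<le> c then 1 else 0) - (if Suc i \<le> c then 1 else 0)"
    using i by (simp add: sum_subtractf)
  also have "\<dots> = (if f c = a then 1 else 0)"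
    using node_inj[OF c i(1)] i(2) by auto
  also have "\<dots> = cartan_int ((inner (f c) (f c) / 2) *\<^sub>R dual (f c)) a"
    using cartan_int_dual[OF node[OF c] \<open>a \<in> \<Delta>\<close>] by simp
  finally show "cartan_int (\<Sum>j\<in>{1..c}. wt j) a = \<dots>" .
qed

text \<open>The only linear relation between the weights is that their sum vanishes. It concerns the empty and the
full set, which differ in size.\<close>

lemma sum_wt_inj:
  assumes A: "A \<subseteq> {1..n}" and B: "B \<subseteq> {1..n}" and card: "card A = card B"
    and eq: "(\<Sum>j\<in>A. wt j) = (\<Sum>j\<in>B. wt j)"
  shows "A = B"
proof (cases "n = 0")
  case False
  define d :: "nat \<Rightarrow> real" where "d i = of_bool (i \<in> A) - of_bool (i \<in> B)" for i
  have fin: "finite A" "finite B" using A B finite_subset by blast+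
  have cart: "cartan_int (\<Sum>j\<in>A. wt j) (f i) = of_bool (i \<in> A) - of_bool (Suc i \<in> A)"
    if i: "i \<in> {1..<n}" and A: "A \<subseteq> {1..n}" for A i
  proof -
    have "finite A" using A finite_subset by blast
    have "cartan_int (\<Sum>j\<in>A. wt j) (f i)
        = (\<Sum>j\<in>A. (if i = j then 1 else 0) - (if j = Suc i then 1 else 0))"
      unfolding cartan_int_sum using A by (intro sum.cong) (auto simp: cartan_int_wt[OF i])
    then show ?thesis using \<open>finite A\<close> by (simp add: sum_subtractf)
  qed
  have step: "d (Suc i) = d i" if "i \<in> {1..<n}" for i
    using cart[OF that A] cart[OF that B] eq by (simp add: d_def)
  have const: "d i = d 1" if "1 \<le> i" "i \<le> n" for i
    using that by (induction i rule: dec_induct) (use step in auto)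
  have "(\<Sum>i\<in>{1..n}. d i) = real (card A) - real (card B)"
  proof -
    have "(\<Sum>i\<in>{1..n}. of_bool (i \<in> C)) = real (card C)" if "C \<subseteq> {1..n}" for C
      using that by (simp add: of_bool_def sum.If_cases Int_absorb1)
    then show ?thesis using A B by (simp add: d_def sum_subtractf)
  qed
  moreover have "(\<Sum>i\<in>{1..n}. d i) = (\<Sum>i\<in>{1..n}. d 1)"
    by (intro sum.cong refl const) auto
  ultimately have "d 1 = 0" using card False by simp
  then have "d i = 0" if "i \<in> {1..n}" for i
    using const[of i] that by simp
  then have "i \<in> A \<longleftrightarrow> i \<in> B" if "i \<in> {1..n}" for i
    using that by (fastforce simp: d_def of_bool_def split: if_splits)
  then show ?thesis using A B by blast
qed (use A B in auto)

text \<open>The isomorphism between the Weyl group and the symmetric group, as a relation.\<close>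

definition acts :: "('a \<Rightarrow> 'a) \<Rightarrow> (nat \<Rightarrow> nat) \<Rightarrow> bool" where
  "acts w p \<longleftrightarrow> p permutes {1..n} \<and> (\<forall>j\<in>{1..n}. w (wt j) = wt (p j))"

lemma acts_permutes: "acts w p \<Longrightarrow> p permutes {1..n}"
  by (simp add: acts_def)

lemma acts_id: "acts id id"
  by (simp add: acts_def permutes_id)

lemma acts_reflection: "i \<in> {1..<n} \<Longrightarrow> acts (reflection (f i)) (transpose i (Suc i))"
  by (auto simp: acts_def reflection_wt intro!: permutes_swap_id)

lemma acts_comp:
  assumes "acts u p" "acts v q"
  shows "acts (u \<circ> v) (p \<circ> q)"
proof -
  have "q j \<in> {1..n}" if "j \<in> {1..n}" for j
    using that permutes_in_image[OF acts_permutes[OF assms(2)]] by blast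
  then show ?thesis
    using assms permutes_compose[of q "{1..n}" p] by (simp add: acts_def)
qed

lemma acts_unique:
  assumes "acts w p" "acts w q"
  shows "p = q"
proof
  fix j
  show "p j = q j"
  proof (cases "j \<in> {1..n}")
    case True
    then have "wt (p j) = wt (q j)" using assms by (metis acts_def)
    moreover have "p j \<in> {1..n}" "q j \<in> {1..n}"
      using True permutes_in_image[OF acts_permutes] assms by blast+
    ultimately show ?thesis using wt_inj by blast
  next
    case False
    then show ?thesis using permutes_not_in[OF acts_permutes] assms by metis
  qed
qed

lemma acts_node:
  assumes "acts u p" "u \<in> W" "i \<in> {1..<n}"
  shows "u (f i) = wt (p i) - wt (p (Suc i))"
proof -
  have "f i = wt i - wt (Suc i)" using wt_Suc[of i] assms(3) by simp
  then show ?thesis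
    using assms by (simp add: acts_def linear_diff[OF refl_group_linear])
qed

lemma acts_unique_elt:
  assumes "acts u p" "acts v p" "u \<in> W" "v \<in> W"
  shows "u = v"
proof (rule linear_eq_on_base)
  fix a assume "a \<in> \<Delta>"
  then obtain i where i: "i \<in> {1..<n}" "a = f i" by (rule node_onto)
  then show "u a = v a"
    using acts_node[OF assms(1,3) i(1)] acts_node[OF assms(2,4) i(1)] by simp
qed (use assms refl_group_linear in auto)

lemma ex_perm:
  assumes "w \<in> W"
  shows "\<exists>p. acts w p"
proof -
  obtain ss where ss: "set ss \<subseteq> \<Delta>" "w = word ss" using assms by (rule refl_groupE)
  have "\<exists>p. acts (word ss) p" using ss(1)
  proof (induction ss)
    case Nil
    show ?case unfolding word_simps by (rule exI[where P = "acts id", OF acts_id])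
  next
    case (Cons a ss)
    then obtain p where "acts (word ss) p" by auto
    moreover have "a \<in> \<Delta>" using Cons by simp
    then obtain i where "i \<in> {1..<n}" "a = f i" by (rule node_onto)
    ultimately show ?case using acts_comp acts_reflection unfolding word_simps by blast
  qed
  then show ?thesis using ss by simp
qed

lemma ex_elt_transpose:
  assumes "1 \<le> a" "Suc a \<le> b" "b \<le> n"
  shows "\<exists>w\<in>W. acts w (transpose a b)"
  using assms(2,3)
proof (induction b rule: dec_induct)
  case base
  then have "a \<in> {1..<n}" using assms(1) by simp
  then show ?case using acts_reflection refl_group_reflection node by blast
next
  case (step b)
  then have b: "b \<in> {1..<n}" using assms(1) by simp
  let ?s = "reflection (f b)" and ?t = "transpose b (Suc b)"
  obtain w where w: "w \<in> W" "acts w (transpose a b)" using step by auto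
  have "acts (?s \<circ> w \<circ> ?s) (?t \<circ> transpose a b \<circ> ?t)"
    by (intro acts_comp acts_reflection b w)
  moreover have "?t \<circ> transpose a b \<circ> ?t = transpose a (Suc b)"
    using step by (auto simp: fun_eq_iff transpose_def)
  moreover have "?s \<circ> w \<circ> ?s \<in> W"
    by (intro refl_group_comp refl_group_reflection node b w)
  ultimately show ?case by metis
qed

lemma ex_elt:
  assumes "p permutes {1..n}"
  shows "\<exists>w\<in>W. acts w p"
  using assms finite_atLeastAtMost
proof (induction p rule: permutes_induct)
  case id
  then show ?case using acts_id refl_group_id by blast
next
  case (swap a b p)
  then obtain w where w: "w \<in> W" "acts w p" by blast
  have "\<exists>v\<in>W. acts v (transpose a b)"
  proof (cases "a < b")
    case True
    then show ?thesis using ex_elt_transpose[of a b] swap by auto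
  next
    case False
    then show ?thesis using ex_elt_transpose[of b a] swap by (auto simp: transpose_commute)
  qed
  then show ?case using acts_comp refl_group_comp w by metis
qed

lemma acts_inv:
  assumes "acts u p" "u \<in> W"
  shows "acts (inv_into UNIV u) (inv' p)"
proof -
  have p: "p permutes {1..n}" using assms acts_permutes by blast
  have "inv_into UNIV u (wt j) = wt (inv' p j)" if j: "j \<in> {1..n}" for j
  proof -
    have "inv' p j \<in> {1..n}" using j permutes_in_image[OF permutes_inv[OF p]] by blast
    then have "u (wt (inv' p j)) = wt j"
      using assms(1) permutes_inverses(1)[OF p] by (simp add: acts_def)
    then show ?thesis using assms(2) by (metis refl_group_inv_cancel(1))
  qed
  then show ?thesis using permutes_inv[OF p] by (simp add: acts_def)
qed

lemma acts_fixes_dual_iff: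
  assumes w: "w \<in> W" "acts w p" and c: "c \<in> {1..<n}"
  shows "w (dual (f c)) = dual (f c) \<longleftrightarrow> p ` {1..c} = {1..c}"
proof -
  let ?s = "\<Sum>j\<in>{1..c}. wt j"
  have p: "p permutes {1..n}" using w acts_permutes by blast
  have "f c \<noteq> 0" using base_nonzero node c by blast
  then have "w (dual (f c)) = dual (f c) \<longleftrightarrow> w ?s = ?s"
    unfolding sum_wt[OF c] linear_scale[OF refl_group_linear[OF w(1)]] by simp
  also have "w ?s = (\<Sum>j\<in>p ` {1..c}. wt j)"
  proof -
    have "w ?s = (\<Sum>j\<in>{1..c}. wt (p j))"
      unfolding linear_sum[OF refl_group_linear[OF w(1)]]
      using w(2) c by (intro sum.cong) (auto simp: acts_def)
    also have "\<dots> = (\<Sum>j\<in>p ` {1..c}. wt j)"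
      using permutes_inj_on[OF p] by (subst sum.reindex) (auto simp: comp_def)
    finally show ?thesis .
  qed
  also have "\<dots> = ?s \<longleftrightarrow> p ` {1..c} = {1..c}"
  proof
    assume eq: "(\<Sum>j\<in>p ` {1..c}. wt j) = ?s"
    show "p ` {1..c} = {1..c}"
    proof (rule sum_wt_inj[OF _ _ _ eq])
      show "p ` {1..c} \<subseteq> {1..n}"
        using c permutes_image[OF p] by (metis atLeastatMost_subset_iff atLeastLessThan_iff image_mono le_refl less_imp_le)
      show "card (p ` {1..c}) = card {1..c}"
        by (rule card_image) (rule permutes_inj_on[OF p])
    qed (use c in auto)
  qed simp
  finally show ?thesis .
qed

text \<open>The reversal maps \<open>f i\<close> to \<open>- f (n - i)\<close>.\<close>

lemma acts_w0: "acts w0 (reversal n)"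
proof -
  obtain w where w: "w \<in> W" "acts w (reversal n)"
    using ex_elt[OF reversal_permutes] by blast
  have "- w a \<in> pos_roots" if a: "a \<in> \<Delta>" for a
  proof -
    obtain i where i: "i \<in> {1..<n}" "a = f i" using a by (rule node_onto)
    have ni: "n - i \<in> {1..<n}" using i by auto
    have "w a = wt (n + 1 - i) - wt (n - i)"
      using acts_node[OF w(2,1) i(1)] i by (simp add: reversal_def)
    also have "n + 1 - i = Suc (n - i)" using i by auto
    finally have "- w a = f (n - i)"
      using wt_Suc[of "n - i"] ni by simp
    then show ?thesis using base_pos node[OF ni] by simp
  qed
  then show ?thesis using longest_word_eqI[OF w(1)] w(2) by simp
qed

definition perm :: "('a \<Rightarrow> 'a) \<Rightarrow> nat \<Rightarrow> nat" where
  "perm w = (SOME p. acts w p)"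

lemma acts_perm: "w \<in> W \<Longrightarrow> acts w (perm w)"
  unfolding perm_def using ex_perm by (rule someI_ex)

lemma perm_eq: "acts w p \<Longrightarrow> perm w = p"
  unfolding perm_def using acts_unique by blast

lemma a_P_eq_card_left_half:
  assumes J: "J \<subseteq> \<Delta>" and n: "sum_list ns = n"
    and block: "\<And>w. w \<in> W \<Longrightarrow> w \<in> refl_group J \<longleftrightarrow> perm w \<in> block_subgroup ns"
  shows "a_P \<Delta> J = card (left_half ns ` fixed_perms ns)"
    and "fixed_reps J \<noteq> {} \<Longrightarrow> fixed_perms ns \<noteq> {}"
proof -
  have perm_inv_comp: "perm (inv_into UNIV u \<circ> v) = inv' (perm u) \<circ> perm v" if "u \<in> W" "v \<in> W" for u v
    using that by (intro perm_eq acts_comp acts_inv acts_perm)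
  have reps: "u \<in> fixed_reps J \<longleftrightarrow> u \<in> W \<and> perm u \<in> fixed_perms ns" for u
  proof (cases "u \<in> W")
    case True
    have "u \<in> fixed_reps J \<longleftrightarrow> inv_into UNIV u \<circ> (w0 \<circ> u) \<in> refl_group J"
      using inv_comp_parabolic_iff[OF J True refl_group_comp[OF w0_in_W True]] True
      by (simp add: fixed_reps_def)
    also have "\<dots> \<longleftrightarrow> perm (inv_into UNIV u \<circ> (w0 \<circ> u)) \<in> block_subgroup ns"
      using True w0_in_W by (intro block) (simp add: refl_group_comp refl_group_inv)
    also have "perm (inv_into UNIV u \<circ> (w0 \<circ> u)) = inv' (perm u) \<circ> (reversal n \<circ> perm u)"
      using True by (intro perm_eq acts_comp acts_inv acts_perm acts_w0)
    finally show ?thesis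
      using True acts_permutes[OF acts_perm[OF True]] n
      unfolding fixed_perms_def mem_Collect_eq by metis
  qed (simp add: fixed_reps_def)
  have image: "perm ` fixed_reps J = fixed_perms ns"
  proof
    show "fixed_perms ns \<subseteq> perm ` fixed_reps J"
    proof
      fix p assume p: "p \<in> fixed_perms ns"
      then have "p permutes {1..n}" using n by (simp add: fixed_perms_def)
      then obtain w where w: "w \<in> W" "acts w p" using ex_elt by blast
      then show "p \<in> perm ` fixed_reps J"
        using p reps perm_eq[OF w(2)] by (intro image_eqI[of _ _ w]) auto
    qed
  qed (use reps in auto)
  then show "fixed_reps J \<noteq> {} \<Longrightarrow> fixed_perms ns \<noteq> {}" by blast
  have "a_P \<Delta> J = card ((\<lambda>u. left_half ns (perm u)) ` fixed_reps J)"
  proof (rule a_P_eq_card[OF J])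
    fix u v assume uv: "u \<in> fixed_reps J" "v \<in> fixed_reps J"
    then have W: "u \<in> W" "v \<in> W" using reps by blast+
    have "left_half ns (perm u) = left_half ns (perm v) \<longleftrightarrow> inv' (perm u) \<circ> perm v \<in> block_subgroup ns"
      using uv reps by (intro left_half_eq_iff) auto
    also have "\<dots> \<longleftrightarrow> inv_into UNIV u \<circ> v \<in> refl_group J"
      using block[of "inv_into UNIV u \<circ> v"] W by (simp add: perm_inv_comp refl_group_comp refl_group_inv)
    also have "\<dots> \<longleftrightarrow> (\<forall>b\<in>\<Delta> - J. u (dual b) = v (dual b))"
      using inv_comp_parabolic_iff[OF J W] by auto
    finally show "left_half ns (perm u) = left_half ns (perm v) \<longleftrightarrow> (\<forall>b\<in>\<Delta> - J. u (dual b) = v (dual b))" .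
  qed
  also have "(\<lambda>u. left_half ns (perm u)) ` fixed_reps J = left_half ns ` fixed_perms ns"
    using image by (metis image_image)
  finally show "a_P \<Delta> J = card (left_half ns ` fixed_perms ns)" .
qed

lemma perm_iso: "perm \<in> iso (weyl_group \<Delta>) (sym_group n)"
proof (rule isoI)
  show "perm \<in> hom (weyl_group \<Delta>) (sym_group n)"
  proof (rule homI)
    show "perm u \<in> carrier (sym_group n)" if "u \<in> carrier (weyl_group \<Delta>)" for u
      using that acts_permutes[OF acts_perm] by (simp add: carrier_weyl_group sym_group_carrier)
    show "perm (u \<otimes>\<^bsub>weyl_group \<Delta>\<^esub> v) = perm u \<otimes>\<^bsub>sym_group n\<^esub> perm v"
      if "u \<in> carrier (weyl_group \<Delta>)" "v \<in> carrier (weyl_group \<Delta>)" for u v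
      using that perm_eq[OF acts_comp[OF acts_perm acts_perm]]
      by (simp add: carrier_weyl_group sym_group_mult mult_weyl_group)
  qed
  show "bij_betw perm (carrier (weyl_group \<Delta>)) (carrier (sym_group n))"
    unfolding bij_betw_def carrier_weyl_group
  proof
    show "inj_on perm W"
      by (rule inj_onI) (metis acts_perm acts_unique_elt)
    show "perm ` W = carrier (sym_group n)"
      using ex_elt perm_eq acts_permutes[OF acts_perm] by (fastforce simp: sym_group_carrier)
  qed
qed

end

text \<open>The nodes missing from \<open>J\<close> are the positions at which the interval is cut into blocks.\<close>

lemma ex_composition:
  fixes C :: "nat set"
  assumes "1 \<le> n" "C \<subseteq> {1..<n}"
  shows "\<exists>ns. (\<forall>m\<in>set ns. 0 < m) \<and> sum_list ns = n \<and>
    {sum_list (take k ns) |k. 0 < k \<and> k < length ns} = C"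
  using assms
proof (induction n arbitrary: C rule: less_induct)
  case (less n)
  show ?case
  proof (cases "C = {}")
    case True
    then show ?thesis using less.prems by (intro exI[of _ "[n]"]) auto
  next
    case False
    define m where "m = Max C"
    have fin: "finite C" using less.prems finite_subset by blast
    have m: "m \<in> C" "\<And>c. c \<in> C \<Longrightarrow> c \<le> m" using False fin by (auto simp: m_def)
    then have mn: "1 \<le> m" "m < n" using less.prems by auto
    have "C - {m} \<subseteq> {1..<m}" using m(2) less.prems by fastforce
    then obtain ns where ns: "\<forall>m\<in>set ns. 0 < m" "sum_list ns = m"
      "{sum_list (take k ns) |k. 0 < k \<and> k < length ns} = C - {m}"
      using less.IH[OF mn(2,1)] by blast
    let ?ns = "ns @ [n - m]"
    have "(\<lambda>k. sum_list (take k ?ns)) ` {k. 0 < k \<and> k < length ?ns}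
        = insert (sum_list (take (length ns) ?ns)) ((\<lambda>k. sum_list (take k ns)) ` {k. 0 < k \<and> k < length ns})"
    proof -
      have "0 < length ns" using ns(2) mn by (cases ns) auto
      then have "{k. 0 < k \<and> k < length ?ns} = insert (length ns) {k. 0 < k \<and> k < length ns}"
        by auto
      moreover have "take k ?ns = take k ns" if "k < length ns" for k using that by simp
      ultimately show ?thesis by (simp add: image_iff)
    qed
    also have "\<dots> = C" using ns(2,3) m(1) by (auto simp: setcompr_eq_image)
    finally have "{sum_list (take k ?ns) |k. 0 < k \<and> k < length ?ns} = C"
      by (simp only: setcompr_eq_image)
    then show ?thesis using ns(1,2) mn by (intro exI[of _ ?ns]) auto
  qed
qed

lemma block_subgroup_iff_initial_segments:
  "p \<in> block_subgroup ns \<longleftrightarrow> p permutes {1..sum_list ns} \<and>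
    (\<forall>k. 0 < k \<and> k < length ns \<longrightarrow> p ` {1..sum_list (take k ns)} = {1..sum_list (take k ns)})"
proof
  assume p: "p \<in> block_subgroup ns"
  have "p ` {1..sum_list (take k ns)} = {1..sum_list (take k ns)}" if "k \<le> length ns" for k
    using that
  proof (induction k)
    case (Suc k)
    have "{1..sum_list (take (Suc k) ns)} = {1..sum_list (take k ns)} \<union> block ns k"
      using sum_list_take_mono[of k "Suc k" ns] by (auto simp: block_def)
    moreover have "p ` block ns k = block ns k"
      using p Suc by (simp add: block_subgroup_def)
    ultimately show ?case using Suc by (simp add: image_Un)
  qed simp
  then show "p permutes {1..sum_list ns} \<and>
    (\<forall>k. 0 < k \<and> k < length ns \<longrightarrow> p ` {1..sum_list (take k ns)} = {1..sum_list (take k ns)})"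
    using p by (simp add: block_subgroup_def sym_group_carrier)
next
  assume p: "p permutes {1..sum_list ns} \<and>
    (\<forall>k. 0 < k \<and> k < length ns \<longrightarrow> p ` {1..sum_list (take k ns)} = {1..sum_list (take k ns)})"
  have seg: "p ` {1..sum_list (take k ns)} = {1..sum_list (take k ns)}" if "k \<le> length ns" for k
  proof -
    have "k = 0 \<or> 0 < k \<and> k < length ns \<or> k = length ns" using that by linarith
    then show ?thesis
    proof (elim disjE)
      assume "0 < k \<and> k < length ns"
      then show ?thesis using p by blast
    next
      assume "k = length ns"
      then show ?thesis using permutes_image[OF conjunct1[OF p]] by simp
    qed simp
  qed
  have "p ` block ns k = block ns k" if k: "k < length ns" for k
  proof -
    have "block ns k = {1..sum_list (take (Suc k) ns)} - {1..sum_list (take k ns)}"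
      by (auto simp: block_def)
    then show ?thesis
      using seg[of k] seg[of "Suc k"] k p image_set_diff[OF permutes_inj[OF conjunct1[OF p]]] by simp
  qed
  then show "p \<in> block_subgroup ns" using p by (simp add: block_subgroup_def sym_group_carrier)
qed

context root_basis
begin

text \<open>The isomorphism in the hypothesis sends the generators to adjacent transpositions, so it agrees with the
action on the weights, and the parabolic subgroup is the block subgroup with respect to that action.\<close>

theorem a_P_type_A:
  assumes J: "J \<subseteq> \<Delta>" and type: "type_A_with_blocks \<Delta> J ns" and adm: "admissible_blocks ns"
  shows "real (a_P \<Delta> J) = fact (sum_list ns div 2) / (\<Prod>m\<leftarrow>ns. fact (m div 2))"
proof -
  let ?n = "sum_list ns"
  obtain f h where f: "simply_laced_labelling \<Delta> (?n - 1) (A_edges (?n - 1)) f"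
    and h: "h \<in> iso (weyl_group \<Delta>) (sym_group ?n)"
    and gen: "\<And>i. i \<in> {1..?n - 1} \<Longrightarrow> h (reflection (f i)) = transpose i (i + 1)"
    and par: "h ` parabolic_subgroup \<Delta> J = block_subgroup ns"
    using type unfolding type_A_with_blocks_def by blast
  interpret type_A_basis \<Phi> \<Delta> ?n f
    by unfold_locales (fact f)
  have hom: "h (u \<circ> v) = h u \<circ> h v" if "u \<in> W" "v \<in> W" for u v
    using h that by (auto simp: iso_def hom_def carrier_weyl_group mult_weyl_group sym_group_mult)
  have h_id: "h id = id"
    using hom_one[OF _ group_weyl_group sym_group_is_group, of h \<Delta> ?n] h
    by (simp add: iso_def one_weyl_group sym_group_one)
  have "acts (word ss) (h (word ss))" if "set ss \<subseteq> \<Delta>" for ss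
    using that
  proof (induction ss)
    case Nil
    show ?case unfolding word_simps h_id by (rule acts_id)
  next
    case (Cons a ss)
    then have "a \<in> \<Delta>" by simp
    then obtain i where i: "i \<in> {1..<?n}" "a = f i" by (rule node_onto)
    have IH: "acts (word ss) (h (word ss))" using Cons by simp
    have "h (reflection a \<circ> word ss) = h (reflection a) \<circ> h (word ss)"
      using Cons.prems by (intro hom) (auto intro: refl_group_reflection refl_groupI)
    also have "h (reflection a) = transpose i (Suc i)"
      using gen[of i] i by auto
    finally show ?case
      unfolding word_simps by (simp only: i(2) acts_comp[OF acts_reflection[OF i(1)] IH])
  qed
  then have acts_h: "acts w (h w)" if "w \<in> W" for w
    using that by (metis refl_groupE)
  have "w \<in> refl_group J \<longleftrightarrow> perm w \<in> block_subgroup ns" if w: "w \<in> W" for w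
  proof -
    have "inj_on h W" using h by (simp add: iso_def bij_betw_def carrier_weyl_group)
    then have "w \<in> refl_group J \<longleftrightarrow> h w \<in> h ` refl_group J"
      using w refl_group_mono[OF J] by (auto simp: inj_on_def)
    also have "\<dots> \<longleftrightarrow> perm w \<in> block_subgroup ns"
      using par perm_eq[OF acts_h[OF w]] by (simp add: parabolic_eq_refl_group[OF J])
    finally show ?thesis .
  qed
  then show ?thesis
    using a_P_eq_card_left_half(1)[OF J refl] card_left_half[OF adm] by simp
qed

theorem blocks_if_fixed_reps:
  assumes J: "J \<subseteq> \<Delta>" and f: "simply_laced_labelling \<Delta> (card \<Delta>) (A_edges (card \<Delta>)) f"
    and reps: "fixed_reps J \<noteq> {}"
  shows "\<exists>ns. type_A_with_blocks \<Delta> J ns \<and> admissible_blocks ns"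
proof -
  define n where "n = Suc (card \<Delta>)"
  interpret type_A_basis \<Phi> \<Delta> n f
    by unfold_locales (use f in \<open>simp add: n_def\<close>)
  define C where "C = {c \<in> {1..<n}. f c \<notin> J}"
  obtain ns where ns: "\<forall>m\<in>set ns. 0 < m" "sum_list ns = n"
    "{sum_list (take k ns) |k. 0 < k \<and> k < length ns} = C"
  proof -
    have "1 \<le> n" "C \<subseteq> {1..<n}" by (auto simp: C_def n_def)
    from ex_composition[OF this] show ?thesis using that by blast
  qed
  have duals: "\<Delta> - J = f ` C"
  proof
    show "\<Delta> - J \<subseteq> f ` C"
    proof
      fix a assume a: "a \<in> \<Delta> - J"
      then have "a \<in> \<Delta>" by blast
      then obtain i where "i \<in> {1..<n}" "a = f i" by (rule node_onto)
      then show "a \<in> f ` C" using a by (auto simp: C_def)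
    qed
    show "f ` C \<subseteq> \<Delta> - J" using node by (auto simp: C_def)
  qed
  have block: "w \<in> refl_group J \<longleftrightarrow> perm w \<in> block_subgroup ns" if w: "w \<in> W" for w
  proof -
    have "w \<in> refl_group J \<longleftrightarrow> (\<forall>c\<in>C. w (dual (f c)) = dual (f c))"
      using w by (simp add: parabolic_iff_fixes_dual[OF J] duals)
    also have "\<dots> \<longleftrightarrow> (\<forall>c\<in>C. perm w ` {1..c} = {1..c})"
      by (intro ball_cong refl acts_fixes_dual_iff[OF w acts_perm[OF w]]) (simp add: C_def)
    also have "\<dots> \<longleftrightarrow> perm w \<in> block_subgroup ns"
      using acts_permutes[OF acts_perm[OF w]] unfolding block_subgroup_iff_initial_segments ns(2) ns(3)[symmetric]
      by blast
    finally show ?thesis .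
  qed
  have "perm ` parabolic_subgroup \<Delta> J = block_subgroup ns"
  proof
    show "perm ` parabolic_subgroup \<Delta> J \<subseteq> block_subgroup ns"
      using block refl_group_mono[OF J] by (auto simp: parabolic_eq_refl_group[OF J])
    show "block_subgroup ns \<subseteq> perm ` parabolic_subgroup \<Delta> J"
    proof
      fix p assume p: "p \<in> block_subgroup ns"
      then have "p permutes {1..n}" using ns(2) by (simp add: block_subgroup_def sym_group_carrier)
      then obtain w where w: "w \<in> W" "acts w p" using ex_elt by blast
      then have "w \<in> refl_group J" using block p perm_eq by metis
      then show "p \<in> perm ` parabolic_subgroup \<Delta> J"
        using perm_eq[OF w(2)] by (auto simp: parabolic_eq_refl_group[OF J])
    qed
  qed
  then have "type_A_with_blocks \<Delta> J ns"
    unfolding type_A_with_blocks_def ns(2)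
    using labelling perm_iso perm_eq[OF acts_reflection] by (intro exI[of _ f] exI[of _ perm]) auto
  moreover have "admissible_blocks ns"
    using admissible_if_fixed_perms[OF a_P_eq_card_left_half(2)[OF J ns(2) block reps] ns(1)] .
  ultimately show ?thesis by blast
qed

end

section \<open>Type D\<close>

lemma D_edges_symmetric_iff:
  "{i, j} \<in> D_edges n \<longleftrightarrow>
    1 \<le> i \<and> j = i + 1 \<and> j \<le> n - 1 \<or> 1 \<le> j \<and> i = j + 1 \<and> i \<le> n - 1 \<or>
    i = n - 2 \<and> j = n \<or> j = n - 2 \<and> i = n"
  by (auto simp: D_edges_def doubleton_eq_iff)

lemma D_edges_three_neighbours:
  assumes n: "4 \<le> n" and ab: "{i, a} \<in> D_edges n" "{i, b} \<in> D_edges n" "{i, c} \<in> D_edges n"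
    and dist: "distinct [a, b, c]" and le: "i \<in> {1..n}" "a \<in> {1..n}" "b \<in> {1..n}" "c \<in> {1..n}"
  shows "i = n - 2" "{a, b, c} = {n - 3, n - 1, n}"
proof -
  have nb: "x \<in> {i - 1, i + 1} \<or> i = n - 2 \<or> i = n \<and> x = n - 2"
    if "{i, x} \<in> D_edges n" for x
    using that n by (auto simp: D_edges_symmetric_iff)
  have nb_n: "x = n - 2" if "{n, x} \<in> D_edges n" for x
    using that n by (auto simp: D_edges_symmetric_iff)
  show i: "i = n - 2"
  proof (rule ccontr)
    assume "i \<noteq> n - 2"
    then have "{a, b, c} \<subseteq> {i - 1, i + 1} \<or> {a, b, c} \<subseteq> {n - 2}"
      using nb[OF ab(1)] nb[OF ab(2)] nb[OF ab(3)] nb_n ab by blast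
    moreover have "card {i - 1, i + 1} \<le> 2" "card {n - 2} \<le> 2" by (simp_all add: card_insert_if)
    ultimately have "card {a, b, c} \<le> 2"
      by (meson card_mono finite.emptyI finite.insertI le_trans)
    then show False using dist by simp
  qed
  have "x \<in> {n - 3, n - 1, n}" if "{i, x} \<in> D_edges n" "x \<in> {1..n}" for x
    using that n i by (auto simp: D_edges_symmetric_iff) arith
  then have "{a, b, c} \<subseteq> {n - 3, n - 1, n}" using ab le by blast
  moreover have "card {a, b, c} = card {n - 3, n - 1, n}"
  proof -
    have "n - 3 \<noteq> n - 1" "n - 3 \<noteq> n" "n - 1 \<noteq> n" using n by linarith+
    then show ?thesis using dist by simp
  qed
  ultimately show "{a, b, c} = {n - 3, n - 1, n}"
    by (intro card_subset_eq) auto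
qed

lemma D_edges_connected:
  assumes n: "3 \<le> n" and closed: "\<And>i j. i \<in> {1..n} \<Longrightarrow> j \<in> {1..n} \<Longrightarrow> {i, j} \<in> D_edges n \<Longrightarrow> P i \<longleftrightarrow> P j"
    and ij: "i \<in> {1..n}" "j \<in> {1..n}"
  shows "P i \<longleftrightarrow> P j"
proof -
  have line: "P k \<longleftrightarrow> P 1" if "1 \<le> k" "k \<le> n - 1" for k
    using that
  proof (induction k rule: dec_induct)
    case (step k)
    then show ?case using closed[of k "Suc k"] n by (auto simp: D_edges_symmetric_iff)
  qed simp
  have "P n \<longleftrightarrow> P 1"
    using closed[of "n - 2" n] line[of "n - 2"] n by (auto simp: D_edges_symmetric_iff)
  moreover have "k \<le> n - 1 \<or> k = n" if "k \<in> {1..n}" for k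
    using that by auto
  ultimately have "P k \<longleftrightarrow> P 1" if "k \<in> {1..n}" for k
    using line[of k] that by auto
  then show ?thesis using ij by blast
qed

locale type_D_basis = root_basis +
  fixes n :: nat and f :: "nat \<Rightarrow> 'a"
  assumes labelling: "simply_laced_labelling \<Delta> n (D_edges n) f" and n4: "4 \<le> n"
begin

lemma node: "i \<in> {1..n} \<Longrightarrow> f i \<in> \<Delta>"
  by (rule labelling_base[OF labelling])

lemma cartan_int_node:
  assumes "i \<in> {1..n}" "j \<in> {1..n}"
  shows "cartan_int (f i) (f j) = (if i = j then 2 else if {i, j} \<in> D_edges n then -1 else 0)"
  by (rule labelling_cartan_int[OF labelling assms])

text \<open>
The coordinate vectors, for which \<open>f j = wt j - wt (j + 1)\<close> for \<open>j < n\<close> and \<open>f n = wt (n - 1) + wt n\<close>. The last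
one is obtained from the difference of the two final simple roots.\<close>

definition wt :: "nat \<Rightarrow> 'a" where
  "wt j = (1 / 2) *\<^sub>R (f n - f (n - 1)) + (\<Sum>k\<in>{j..<n}. f k)"

lemma wt_Suc: "j < n \<Longrightarrow> wt j = f j + wt (Suc j)"
  by (simp add: wt_def sum.atLeast_Suc_lessThan algebra_simps)

lemma f_n: "f n = wt (n - 1) + wt n"
proof -
  have "wt (n - 1) = f (n - 1) + wt n"
    using wt_Suc[of "n - 1"] n4 by simp
  moreover have "2 *\<^sub>R wt n = f n - f (n - 1)"
    by (simp add: wt_def)
  ultimately show ?thesis
    by (simp add: scaleR_2 algebra_simps)
qed

lemma cartan_int_wt:
  assumes i: "i \<in> {1..n}" and "1 \<le> j" "j \<le> n"
  shows "cartan_int (wt j) (f i) =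
    (if i = n then (if j = n \<or> j = n - 1 then 1 else 0)
     else (if i = j then 1 else 0) - (if j = Suc i then 1 else 0))"
  using assms(3,2)
proof (induction j rule: inc_induct)
  case base
  have "cartan_int (f n) (f i) = (if i = n then 2 else if i = n - 2 then -1 else 0)"
    using cartan_int_node[of n i] i n4 by (auto simp: D_edges_symmetric_iff)
  moreover have "cartan_int (f (n - 1)) (f i) = (if i = n - 1 then 2 else if i = n - 2 then -1 else 0)"
    using cartan_int_node[of "n - 1" i] i n4 by (auto simp: D_edges_symmetric_iff)
  moreover have "cartan_int (wt n) (f i) = (cartan_int (f n) (f i) - cartan_int (f (n - 1)) (f i)) / 2"
    by (simp add: wt_def cartan_int_scale cartan_int_diff)
  moreover have "n = Suc i \<longleftrightarrow> i = n - 1" "n - 1 \<noteq> n" "n - 2 \<noteq> n" "n - 2 \<noteq> n - 1" using n4 i by auto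
  ultimately show ?case by auto
next
  case (step j)
  have j: "j \<in> {1..n}" using step by simp
  have "{j, i} \<in> D_edges n \<longleftrightarrow> i = Suc j \<and> i < n \<or> j = Suc i \<or> j = n - 2 \<and> i = n"
    using i j step(2) n4 by (auto simp: D_edges_symmetric_iff)
  then have cart: "cartan_int (f j) (f i) = (if i = j then 2 else
      if i = Suc j \<and> i < n \<or> j = Suc i \<or> j = n - 2 \<and> i = n then -1 else 0)"
    using cartan_int_node[OF j i] by simp
  have IH: "cartan_int (wt (Suc j)) (f i) =
    (if i = n then (if Suc j = n \<or> Suc j = n - 1 then 1 else 0)
     else (if i = Suc j then 1 else 0) - (if Suc j = Suc i then 1 else 0))"
    using step.IH by simp
  have sum: "cartan_int (wt j) (f i) = cartan_int (f j) (f i) + cartan_int (wt (Suc j)) (f i)"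
    unfolding wt_Suc[OF step(2)] by (rule cartan_int_add)
  show ?case
  proof (cases "i = n")
    case True
    obtain k where k: "n = Suc (Suc k)" using n4 by (cases n; cases "n - 1") auto
    then have "j = Suc k \<or> j = k \<or> j < k" using step(2) by linarith
    then show ?thesis
      unfolding sum cart IH unfolding True k by (elim disjE) simp_all
  next
    case False
    then have "i < n" using i by simp
    consider "i = j" | "i = Suc j" | "j = Suc i" | "i \<noteq> j" "i \<noteq> Suc j" "j \<noteq> Suc i" by blast
    then show ?thesis
      unfolding sum cart IH by cases (use False \<open>i < n\<close> in simp_all)
  qed
qed

lemma wt_nonzero:
  assumes "j \<in> {1..n}"
  shows "wt j \<noteq> 0"
proof
  assume "wt j = 0"
  then have "cartan_int (wt j) (f j) = 0" by (simp add: cartan_int_def)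
  then show False using assms cartan_int_wt[of j j] by (auto split: if_splits)
qed

lemma reflection_wt:
  assumes i: "i \<in> {1..<n}" and j: "j \<in> {1..n}"
  shows "reflection (f i) (wt j) = wt (transpose i (Suc i) j)"
  using cartan_int_wt[of i j] j i wt_Suc[of i]
  by (auto simp: reflection_def transpose_def)

lemma reflection_n_wt:
  assumes j: "j \<in> {1..n}"
  shows "reflection (f n) (wt j) = (if j = n then - wt (n - 1) else if j = n - 1 then - wt n else wt j)"
  using cartan_int_wt[of n j] j n4 by (auto simp: reflection_def f_n)

text \<open>
The first nodes act by adjacent transpositions, and the last one exchanges the last two coordinate
vectors with a change of sign.\<close>

lemma W_wt:
  assumes "w \<in> W" "j \<in> {1..n}"
  shows "\<exists>k\<in>{1..n}. w (wt j) = wt k \<or> w (wt j) = - wt k"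
proof -
  obtain ss where ss: "set ss \<subseteq> \<Delta>" "w = word ss" using assms(1) by (rule refl_groupE)
  have "\<exists>k\<in>{1..n}. word ss (wt j) = wt k \<or> word ss (wt j) = - wt k"
    using ss(1)
  proof (induction ss)
    case Nil
    then show ?case using assms(2) by auto
  next
    case (Cons a ss)
    then obtain k where k: "k \<in> {1..n}" "word ss (wt j) = wt k \<or> word ss (wt j) = - wt k" by auto
    have "a \<in> \<Delta>" using Cons by simp
    then obtain i where i: "i \<in> {1..n}" "a = f i" by (rule labelling_onto[OF labelling])
    have "\<exists>l\<in>{1..n}. reflection a (wt k) = wt l \<or> reflection a (wt k) = - wt l"
    proof (cases "i = n")
      case True
      then show ?thesis using reflection_n_wt[OF k(1)] i k(1) n4 by auto
    next
      case False
      then have "i \<in> {1..<n}" using i by auto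
      then have "transpose i (Suc i) k \<in> {1..n}" using k(1) by (auto simp: transpose_def)
      then show ?thesis using reflection_wt[OF \<open>i \<in> {1..<n}\<close> k(1)] i(2) by metis
    qed
    then show ?case using k(2) by (auto simp: reflection_minus)
  qed
  then show ?thesis using ss by simp
qed

text \<open>Sign changes of the coordinates in \<open>A\<close>. The Weyl group contains them if their number is even.\<close>

definition flips :: "('a \<Rightarrow> 'a) \<Rightarrow> nat set \<Rightarrow> bool" where
  "flips w A \<longleftrightarrow> (\<forall>j\<in>{1..n}. w (wt j) = (if j \<in> A then - wt j else wt j))"

lemma flips_conj:
  assumes w: "w \<in> W" "flips w A" and i: "i \<in> {1..<n}"
  shows "flips (reflection (f i) \<circ> w \<circ> reflection (f i)) (transpose i (Suc i) ` A)"
  unfolding flips_def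
proof
  fix j assume j: "j \<in> {1..n}"
  let ?t = "transpose i (Suc i)"
  have t: "?t j \<in> {1..n}" "?t (?t j) = j" using i j by (auto simp: transpose_def)
  have "w (reflection (f i) (wt j)) = (if ?t j \<in> A then - wt (?t j) else wt (?t j))"
    using w(2) t(1) reflection_wt[OF i j] by (simp add: flips_def)
  then have "(reflection (f i) \<circ> w \<circ> reflection (f i)) (wt j) = (if ?t j \<in> A then - wt j else wt j)"
    using reflection_wt[OF i t(1)] t(2) by (simp add: reflection_minus)
  moreover have "?t j \<in> A \<longleftrightarrow> j \<in> ?t ` A"
    using t(2) by (metis image_iff transpose_involutory)
  ultimately show "(reflection (f i) \<circ> w \<circ> reflection (f i)) (wt j) = (if j \<in> ?t ` A then - wt j else wt j)"
    by simp
qed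

lemma ex_flips_pair:
  assumes "1 \<le> a" "a \<le> n - 1"
  shows "\<exists>w\<in>W. flips w {a, Suc a}"
  using assms(2,1)
proof (induction a rule: inc_induct)
  case base
  have n1: "n - 1 \<in> {1..<n}" "Suc (n - 1) = n" using n4 by auto
  have "flips (reflection (f (n - 1)) \<circ> reflection (f n)) {n - 1, n}"
    unfolding flips_def
  proof
    fix j assume j: "j \<in> {1..n}"
    show "(reflection (f (n - 1)) \<circ> reflection (f n)) (wt j) = (if j \<in> {n - 1, n} then - wt j else wt j)"
      using reflection_n_wt[OF j] reflection_wt[OF n1(1) j] reflection_wt[OF n1(1), of n]
        reflection_wt[OF n1(1), of "n - 1"] n4 n1(2) j
      by (auto simp: reflection_minus transpose_def)
  qed
  moreover have "reflection (f (n - 1)) \<circ> reflection (f n) \<in> W"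
    using n4 by (intro refl_group_comp refl_group_reflection node) auto
  ultimately show ?case using n1(2) by auto
next
  case (step a)
  then obtain w where w: "w \<in> W" "flips w {Suc a, Suc (Suc a)}" by auto
  have a: "a \<in> {1..<n}" "Suc a \<in> {1..<n}" using step by auto
  let ?s = "reflection (f a)" and ?t = "reflection (f (Suc a))"
  have sW: "?s \<in> W" "?t \<in> W" using a node by (auto intro!: refl_group_reflection)
  have sws: "?s \<circ> w \<circ> ?s \<in> W"
    by (rule refl_group_comp[OF refl_group_comp[OF sW(1) w(1)] sW(1)])
  have "flips (?t \<circ> (?s \<circ> w \<circ> ?s) \<circ> ?t) (transpose (Suc a) (Suc (Suc a)) ` transpose a (Suc a) ` {Suc a, Suc (Suc a)})"
    using flips_conj[OF sws flips_conj[OF w a(1)] a(2)] .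
  moreover have "transpose (Suc a) (Suc (Suc a)) ` transpose a (Suc a) ` {Suc a, Suc (Suc a)} = {a, Suc a}"
    by (auto simp: transpose_def)
  moreover have "?t \<circ> (?s \<circ> w \<circ> ?s) \<circ> ?t \<in> W"
    by (rule refl_group_comp[OF refl_group_comp[OF sW(2) sws] sW(2)])
  ultimately show ?case by metis
qed

lemma ex_flips_initial:
  assumes "2 * h \<le> n"
  shows "\<exists>w\<in>W. flips w {1..2 * h}"
  using assms
proof (induction h)
  case 0
  have "flips id {1..2 * 0}" by (simp add: flips_def)
  then show ?case using refl_group_id by blast
next
  case (Suc h)
  then obtain w where w: "w \<in> W" "flips w {1..2 * h}" by auto
  have "1 \<le> Suc (2 * h)" "Suc (2 * h) \<le> n - 1" using Suc.prems by auto
  from ex_flips_pair[OF this] obtain v where v: "v \<in> W" "flips v {Suc (2 * h), Suc (Suc (2 * h))}"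
    by blast
  have "flips (w \<circ> v) {1..2 * Suc h}"
    unfolding flips_def
  proof
    fix j assume j: "j \<in> {1..n}"
    show "(w \<circ> v) (wt j) = (if j \<in> {1..2 * Suc h} then - wt j else wt j)"
      using j w(2) v(2) W_minus[OF w(1), of "wt j"] by (auto simp: flips_def)
  qed
  then show ?case using w v refl_group_comp by blast
qed

lemma flips_node:
  assumes w: "w \<in> W" "flips w A" and i: "i \<in> {1..<n}" "i \<in> A" "Suc i \<in> A"
  shows "w (f i) = - f i"
proof -
  have "f i = wt i - wt (Suc i)" using wt_Suc[of i] i by simp
  then show ?thesis
    using w i by (simp add: linear_diff[OF refl_group_linear] flips_def)
qed

lemma w0_even:
  assumes "even n"
  shows "w0 x = - x"
proof -
  obtain w where w: "w \<in> W" "flips w {1..n}"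
    using ex_flips_initial[of "n div 2"] assms by auto
  have "w = uminus"
  proof (rule linear_eq_on_base)
    fix a assume "a \<in> \<Delta>"
    then obtain i where i: "i \<in> {1..n}" "a = f i" by (rule labelling_onto[OF labelling])
    show "w a = - a"
    proof (cases "i = n")
      case True
      then show ?thesis
        using w i n4 by (simp add: f_n linear_add[OF refl_group_linear] flips_def)
    next
      case False
      then show ?thesis using flips_node[OF w, of i] i by auto
    qed
  qed (use w refl_group_linear in \<open>auto simp: linear_iff\<close>)
  then show ?thesis using w0_eq_minus[OF w(1)] by simp
qed

text \<open>The element that changes all signs except the last exchanges the two final nodes up to sign and negates
the others.\<close>

lemma w0_odd:
  assumes "odd n"
  shows "flips w0 {1..<n}" "i \<in> {1..<n - 1} \<Longrightarrow> w0 (f i) = - f i" "w0 (f (n - 1)) = - f n"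
proof -
  obtain h where h: "n = 2 * h + 1" using assms by (elim oddE)
  then have "{1..<n} = {1..2 * h}" by auto
  then obtain w where w: "w \<in> W" "flips w {1..<n}"
    using ex_flips_initial[of h] h by auto
  have f_n1: "f (n - 1) = wt (n - 1) - wt n"
    using wt_Suc[of "n - 1"] n4 by simp
  have wf: "w (f i) = - f i" if "i \<in> {1..<n - 1}" for i
    using flips_node[OF w, of i] that by auto
  have wn1: "w (f (n - 1)) = - f n"
    using w n4 unfolding f_n f_n1 by (simp add: linear_diff[OF refl_group_linear] flips_def)
  have wn: "w (f n) = - f (n - 1)"
    using w n4 unfolding f_n f_n1 by (simp add: linear_add[OF refl_group_linear] flips_def)
  have "- w a \<in> pos_roots" if a: "a \<in> \<Delta>" for a
  proof -
    obtain i where i: "i \<in> {1..n}" "a = f i" using a by (rule labelling_onto[OF labelling])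
    then have "i \<in> {1..<n - 1} \<or> i = n - 1 \<or> i = n" by auto
    then have "- w a \<in> \<Delta>" using i wf[of i] wn1 wn node n4 by auto
    then show ?thesis by (rule base_pos)
  qed
  then have "w0 = w" using longest_word_eqI[OF w(1)] by simp
  with w(2) wf wn1 show "flips w0 {1..<n}" "i \<in> {1..<n - 1} \<Longrightarrow> w0 (f i) = - f i" "w0 (f (n - 1)) = - f n"
    by auto
qed

text \<open>Compare the Cartan integers. A node negated by \<open>w0\<close> is orthogonal to \<open>x\<close>, and those of the two final nodes
are opposite.\<close>

lemma w0_fixed:
  assumes odd: "odd n" and x: "w0 x = x"
  shows "x = cartan_int x (f n) *\<^sub>R wt n"
proof (rule cartan_int_eqI)
  fix a assume "a \<in> \<Delta>"
  then obtain i where i: "i \<in> {1..n}" "a = f i" by (rule labelling_onto[OF labelling])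
  have inv: "cartan_int x (w0 b) = cartan_int x b" for b
    using refl_group_inner[OF w0_in_W, of x b] refl_group_inner[OF w0_in_W, of b b] x
    by (simp add: cartan_int_def)
  consider "i \<in> {1..<n - 1}" | "i = n - 1" | "i = n" using i by fastforce
  then show "cartan_int x a = cartan_int (cartan_int x (f n) *\<^sub>R wt n) a"
  proof cases
    case 1
    then have "cartan_int x (f i) = 0"
      using inv[of "f i"] w0_odd(2)[OF odd 1] by (simp add: cartan_int_minus_right)
    moreover have "cartan_int (wt n) (f i) = 0"
      using cartan_int_wt[of i n] 1 by auto
    ultimately show ?thesis using i by (simp add: cartan_int_scale)
  next
    case 2
    then have "cartan_int x (f i) = - cartan_int x (f n)"
      using inv[of "f i"] w0_odd(3)[OF odd] by (simp add: cartan_int_minus_right)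
    moreover have "cartan_int (wt n) (f i) = -1"
      using cartan_int_wt[of i n] 2 n4 by auto
    ultimately show ?thesis using i by (simp add: cartan_int_scale)
  next
    case 3
    then show ?thesis using i cartan_int_wt[of n n] n4 by (simp add: cartan_int_scale)
  qed
qed

text \<open>
The dual vector of a missing node is conjugate to a multiple of the last coordinate vector, hence it is
itself proportional to a coordinate vector. Only the first of these is orthogonal to all simple
roots but one.\<close>

lemma missing_node:
  assumes odd: "odd n" and reps: "fixed_reps J \<noteq> {}" and k: "k \<in> {1..n}" "f k \<notin> J"
  shows "k = 1"
proof -
  obtain u where u: "u \<in> W" "w0 (u (dual (f k))) = u (dual (f k))"
    using reps k node by (auto simp: fixed_reps_def)
  let ?v = "inv_into UNIV u"
  obtain c where c: "u (dual (f k)) = c *\<^sub>R wt n"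
    using w0_fixed[OF odd u(2)] by blast
  have v: "?v \<in> W" using u(1) refl_group_inv by blast
  obtain i where i: "i \<in> {1..n}" "?v (wt n) = wt i \<or> ?v (wt n) = - wt i"
    using W_wt[OF v, of n] n4 by auto
  have "dual (f k) = ?v (c *\<^sub>R wt n)" using u(1) c by (metis refl_group_inv_cancel(1))
  also have "\<dots> = c *\<^sub>R ?v (wt n)" by (simp add: linear_scale[OF refl_group_linear[OF v]])
  finally obtain d where d: "dual (f k) = d *\<^sub>R wt i"
    using i(2) by (metis scaleR_minus_left scaleR_minus_right)
  have "d \<noteq> 0" using d dual_nonzero[OF node[OF k(1)]] by auto
  have zero: "cartan_int (wt i) (f l) = 0" if "l \<in> {1..n}" "l \<noteq> k" for l
  proof -
    have "f k \<noteq> f l" using labelling_inj[OF labelling k(1) that(1)] that(2) by auto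
    then have "cartan_int (dual (f k)) (f l) = 0"
      using inner_dual[OF node[OF k(1)] node[OF that(1)]] by (simp add: cartan_int_def)
    then show ?thesis using d \<open>d \<noteq> 0\<close> by (simp add: cartan_int_scale)
  qed
  have "i = k"
    using zero[of i] cartan_int_wt[of i i] i(1) by (auto split: if_splits)
  moreover have "i = 1"
  proof (rule ccontr)
    assume "i \<noteq> 1"
    then have i1: "i - 1 \<in> {1..n}" "Suc (i - 1) = i" "i - 1 \<noteq> n" "i - 1 \<noteq> i" "1 \<le> i" "i \<le> n"
      using i(1) by auto
    then have "cartan_int (wt i) (f (i - 1)) \<noteq> 0"
      using cartan_int_wt[of "i - 1" i] by (simp del: One_nat_def)
    with i1 show False using zero[of "i - 1"] \<open>i = k\<close> \<open>i \<noteq> 1\<close> i(1) by auto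
  qed
  ultimately show ?thesis by simp
qed

lemma type_D_remove_first: "type_D (n - 1) (\<Delta> - {f 1})"
proof -
  let ?g = "\<lambda>i. f (i + 1)"
  have bij: "bij_betw f {1..n} \<Delta>" by (rule labelling_bij[OF labelling])
  have "bij_betw f ({1..n} - {1}) (\<Delta> - {f 1})"
    using bij n4 by (intro bij_betw_DiffI) (auto simp: bij_betw_def)
  moreover have "bij_betw (\<lambda>i. i + 1) {1..n - 1} ({1..n} - {1})"
    by (rule bij_betw_byWitness[of _ "\<lambda>i. i - 1"]) auto
  ultimately have "bij_betw (f \<circ> (\<lambda>i. i + 1)) {1..n - 1} (\<Delta> - {f 1})"
    by (intro bij_betw_trans)
  then have "bij_betw ?g {1..n - 1} (\<Delta> - {f 1})"
    unfolding comp_def .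
  moreover have "cartan_int (?g i) (?g j) = (if {i, j} \<in> D_edges (n - 1) then -1 else 0)"
    if "i \<in> {1..n - 1}" "j \<in> {1..n - 1}" "i \<noteq> j" for i j
  proof -
    have "{i, j} \<in> D_edges (n - 1) \<longleftrightarrow> {i + 1, j + 1} \<in> D_edges n"
    proof -
      have "(1 \<le> k \<and> l = k + 1 \<and> l \<le> n - 1 - 1) \<longleftrightarrow> (1 \<le> k + 1 \<and> l + 1 = k + 1 + 1 \<and> l + 1 \<le> n - 1)"
        "(k = n - 1 - 2 \<and> l = n - 1) \<longleftrightarrow> (k + 1 = n - 2 \<and> l + 1 = n)" if "1 \<le> k" for k l
        using n4 that by auto
      from this[of i j] this[of j i] show ?thesis
        unfolding D_edges_symmetric_iff using that by (metis atLeastAtMost_iff)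
    qed
    then show ?thesis
      using that cartan_int_node[of "i + 1" "j + 1"] by auto
  qed
  ultimately show ?thesis
    unfolding type_D_def simply_laced_labelling_def by blast
qed

lemma J_if_fixed_reps:
  assumes "odd n" "fixed_reps J \<noteq> {}" "J \<subseteq> \<Delta>" "J \<noteq> \<Delta>"
  shows "J = \<Delta> - {f 1}"
proof -
  have "a = f 1" if a: "a \<in> \<Delta>" "a \<notin> J" for a
  proof -
    obtain k where "k \<in> {1..n}" "a = f k" using a(1) by (rule labelling_onto[OF labelling])
    then show ?thesis using missing_node[OF assms(1,2)] a(2) by auto
  qed
  then show ?thesis using assms(3,4) by blast
qed

lemma ex_elt_wt: "1 \<le> j \<Longrightarrow> j \<le> n \<Longrightarrow> \<exists>u\<in>W. u (wt 1) = wt j"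
proof (induction j rule: dec_induct)
  case base
  then show ?case using refl_group_id by (metis id_apply)
next
  case (step j)
  then obtain u where u: "u \<in> W" "u (wt 1) = wt j" by auto
  have j: "j \<in> {1..<n}" using step by auto
  have "reflection (f j) (wt j) = wt (Suc j)" using reflection_wt[OF j, of j] j by simp
  moreover have "reflection (f j) \<circ> u \<in> W"
    using u j node by (auto intro!: refl_group_comp refl_group_reflection)
  ultimately show ?case using u(2) by (metis comp_apply)
qed

lemma a_P_remove_first:
  assumes odd: "odd n"
  shows "a_P \<Delta> (\<Delta> - {f 1}) = 2"
proof -
  let ?J = "\<Delta> - {f 1}"
  have f1: "f 1 \<in> \<Delta>" using node n4 by auto
  have missing: "\<Delta> - ?J = {f 1}" using f1 by blast
  have wt1: "wt 1 = (inner (f 1) (f 1) / 2) *\<^sub>R dual (f 1)"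
  proof (rule cartan_int_eqI)
    fix a assume a: "a \<in> \<Delta>"
    then obtain i where i: "i \<in> {1..n}" "a = f i" by (rule labelling_onto[OF labelling])
    have "f 1 = f i \<longleftrightarrow> i = 1" using labelling_inj[OF labelling, of 1 i] i n4 by auto
    then show "cartan_int (wt 1) a = cartan_int ((inner (f 1) (f 1) / 2) *\<^sub>R dual (f 1)) a"
      unfolding cartan_int_dual[OF f1 a] using cartan_int_wt[of i 1] i n4 by auto
  qed
  have c0: "inner (f 1) (f 1) / 2 \<noteq> 0" using base_nonzero[OF f1] by simp
  have dual_iff: "u (dual (f 1)) = x \<longleftrightarrow> u (wt 1) = (inner (f 1) (f 1) / 2) *\<^sub>R x" if "u \<in> W" for u x
    using c0 unfolding wt1 linear_scale[OF refl_group_linear[OF that]] by simp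
  have reps: "u \<in> fixed_reps ?J \<longleftrightarrow> u \<in> W \<and> w0 (u (wt 1)) = u (wt 1)" for u
  proof (cases "u \<in> W")
    case True
    then have "w0 (u (wt 1)) = u (wt 1) \<longleftrightarrow> w0 (u (dual (f 1))) = u (dual (f 1))"
      using c0 unfolding wt1
      by (simp add: linear_scale[OF refl_group_linear[OF \<open>u \<in> W\<close>]] linear_scale[OF refl_group_linear[OF w0_in_W]])
    then show ?thesis unfolding fixed_reps_def missing by simp
  qed (simp add: fixed_reps_def)
  have "a_P \<Delta> ?J = card ((\<lambda>u. u (wt 1)) ` fixed_reps ?J)"
  proof (rule a_P_eq_card)
    fix u v assume "u \<in> fixed_reps ?J" "v \<in> fixed_reps ?J"
    then have "u \<in> W" "v \<in> W" using reps by blast+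
    then show "u (wt 1) = v (wt 1) \<longleftrightarrow> (\<forall>b\<in>\<Delta> - ?J. u (dual b) = v (dual b))"
      using c0 unfolding missing wt1 by (simp add: linear_scale[OF refl_group_linear])
  qed blast
  also have "(\<lambda>u. u (wt 1)) ` fixed_reps ?J = {wt n, - wt n}"
  proof
    show "(\<lambda>u. u (wt 1)) ` fixed_reps ?J \<subseteq> {wt n, - wt n}"
    proof
      fix x assume "x \<in> (\<lambda>u. u (wt 1)) ` fixed_reps ?J"
      then obtain u where u: "u \<in> W" "w0 x = x" "x = u (wt 1)" using reps by blast
      obtain k where k: "k \<in> {1..n}" "x = wt k \<or> x = - wt k"
        using W_wt[OF u(1), of 1] u(3) n4 by auto
      have "k = n"
      proof (rule ccontr)
        assume "k \<noteq> n"
        then have "w0 (wt k) = - wt k"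
          using w0_odd(1)[OF odd] k(1) by (auto simp: flips_def)
        then have "wt k = - wt k"
          using u(2) k(2) W_minus[OF w0_in_W, of "wt k"] by auto
        then have "2 *\<^sub>R wt k = 0" unfolding scaleR_2 by (metis add.left_inverse)
        then show False using wt_nonzero[OF k(1)] by simp
      qed
      then show "x \<in> {wt n, - wt n}" using k(2) by simp
    qed
    obtain u where u: "u \<in> W" "u (wt 1) = wt n" using ex_elt_wt[of n] n4 by auto
    obtain v where v: "v \<in> W" "flips v {n - 1, n}"
    proof -
      have "1 \<le> n - 1" "Suc (n - 1) = n" using n4 by auto
      then show ?thesis using ex_flips_pair[of "n - 1"] that by auto
    qed
    have w0n: "w0 (wt n) = wt n" using w0_odd(1)[OF odd] n4 by (auto simp: flips_def)
    have "v (wt n) = - wt n" using v(2) n4 by (auto simp: flips_def)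
    then have vu: "v \<circ> u \<in> W" "(v \<circ> u) (wt 1) = - wt n" using u v by (auto intro: refl_group_comp)
    have "u \<in> fixed_reps ?J" using reps u w0n by simp
    moreover have "v \<circ> u \<in> fixed_reps ?J"
      using vu w0n W_minus[OF w0_in_W, of "wt n"] unfolding reps by simp
    ultimately show "{wt n, - wt n} \<subseteq> (\<lambda>u. u (wt 1)) ` fixed_reps ?J"
      using u(2) vu(2) by (metis (mono_tags, lifting) empty_subsetI image_eqI insert_subset)
  qed
  also have "card {wt n, - wt n} = 2"
  proof -
    have "wt n \<noteq> - wt n"
    proof
      assume "wt n = - wt n"
      then have "2 *\<^sub>R wt n = 0" unfolding scaleR_2 by (metis add.left_inverse)
      then show False using wt_nonzero[of n] n4 by simp
    qed
    then show ?thesis by simp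
  qed
  finally show ?thesis .
qed

text \<open>The branch point of the subdiagram with its three neighbours must be that of the diagram. So the missing
node \<open>k\<close> lies on the tail beyond it, and unless it is the first node, it disconnects the first node from
the branch point.\<close>

lemma J_if_type_D:
  assumes J: "J \<subseteq> \<Delta>" and type: "type_D (n - 1) J" and n5: "5 \<le> n"
  shows "J = \<Delta> - {f 1}"
proof -
  define m where "m = n - 1"
  have m: "4 \<le> m" "n = Suc m" using n5 by (auto simp: m_def)
  obtain g where "simply_laced_labelling J m (D_edges m) g"
    using type by (auto simp: type_D_def m_def)
  then obtain t where tn: "\<And>i. i \<in> {1..m} \<Longrightarrow> t i \<in> {1..n}" and Jt: "J = f ` t ` {1..m}"
    and tinj: "\<And>i j. i \<in> {1..m} \<Longrightarrow> j \<in> {1..m} \<Longrightarrow> t i = t j \<longleftrightarrow> i = j"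
    and edge: "\<And>i j. i \<in> {1..m} \<Longrightarrow> j \<in> {1..m} \<Longrightarrow> i \<noteq> j \<Longrightarrow> {i, j} \<in> D_edges m \<longleftrightarrow> {t i, t j} \<in> D_edges n"
    and "card (\<Delta> - J) = n - m"
    using labelled_subset[OF labelling J] by metis
  then have "card (\<Delta> - J) = 1" using m(2) by simp
  then obtain b where b: "\<Delta> - J = {b}" by (auto simp: card_1_singleton_iff)
  then have "b \<in> \<Delta>" by blast
  then obtain k where k: "k \<in> {1..n}" "b = f k" by (rule labelling_onto[OF labelling])
  have in_J: "f l \<in> J \<longleftrightarrow> l \<noteq> k" if "l \<in> {1..n}" for l
    using b node[OF that] labelling_inj[OF labelling that k(1)] k(2) by blast
  have tk: "t i \<noteq> k" if "i \<in> {1..m}" for i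
    using in_J[OF tn[OF that]] that unfolding Jt by blast
  have t_onto: "\<exists>i\<in>{1..m}. t i = l" if l: "l \<in> {1..n}" "l \<noteq> k" for l
  proof -
    obtain i where "i \<in> {1..m}" "f l = f (t i)" using in_J[OF l(1)] l(2) unfolding Jt by blast
    then show ?thesis using labelling_inj[OF labelling l(1) tn] by blast
  qed
  have nb: "{t (m - 2), t (m - 3)} \<in> D_edges n" "{t (m - 2), t (m - 1)} \<in> D_edges n"
    "{t (m - 2), t m} \<in> D_edges n"
  proof -
    have in_m: "m - 3 \<in> {1..m}" "m - 2 \<in> {1..m}" "m - 1 \<in> {1..m}" "m \<in> {1..m}"
      and ne: "m - 2 \<noteq> m - 3" "m - 2 \<noteq> m - 1" "m - 2 \<noteq> m"
      using m(1) by auto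
    have "{m - 2, m - 3} \<in> D_edges m" "{m - 2, m - 1} \<in> D_edges m" "{m - 2, m} \<in> D_edges m"
      unfolding D_edges_symmetric_iff using m(1) by arith+
    then show "{t (m - 2), t (m - 3)} \<in> D_edges n" "{t (m - 2), t (m - 1)} \<in> D_edges n"
      "{t (m - 2), t m} \<in> D_edges n"
      using edge[OF in_m(2,1) ne(1)] edge[OF in_m(2,3) ne(2)] edge[OF in_m(2,4) ne(3)] by blast+
  qed
  have tin: "t (m - 2) \<in> {1..n}" "t (m - 3) \<in> {1..n}" "t (m - 1) \<in> {1..n}" "t m \<in> {1..n}"
    using tn[of "m - 2"] tn[of "m - 3"] tn[of "m - 1"] tn[of m] m by auto
  have tdist: "distinct [t (m - 3), t (m - 1), t m]"
    using tinj[of "m - 3" "m - 1"] tinj[of "m - 3" m] tinj[of "m - 1" m] m by auto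
  have branch: "t (m - 2) = n - 2" "{t (m - 3), t (m - 1), t m} = {n - 3, n - 1, n}"
    using D_edges_three_neighbours[OF n4 nb tdist tin] by auto
  have "k \<notin> {t (m - 3), t (m - 1), t m}" "k \<noteq> t (m - 2)"
  proof -
    have "m - 3 \<in> {1..m}" "m - 2 \<in> {1..m}" "m - 1 \<in> {1..m}" "m \<in> {1..m}" using m(1) by auto
    from this[THEN tk] show "k \<notin> {t (m - 3), t (m - 1), t m}" "k \<noteq> t (m - 2)" by blast+
  qed
  then have "k \<notin> {n - 3, n - 1, n}" "k \<noteq> n - 2"
    unfolding branch by blast+
  then have kn: "k < n - 3" using k(1) n4 by auto
  have "k = 1"
  proof (rule ccontr)
    assume "k \<noteq> 1"
    have "t i < k \<longleftrightarrow> t j < k" if ij: "i \<in> {1..m}" "j \<in> {1..m}" for i j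
    proof (rule D_edges_connected[where P = "\<lambda>i. t i < k", OF _ _ ij])
      fix i j assume ij: "i \<in> {1..m}" "j \<in> {1..m}" "{i, j} \<in> D_edges m"
      then have "i \<noteq> j" using m(1) by (auto simp: D_edges_symmetric_iff)
      then have "{t i, t j} \<in> D_edges n" using edge[OF ij(1,2)] ij(3) by simp
      then show "t i < k \<longleftrightarrow> t j < k"
        using tk[OF ij(1)] tk[OF ij(2)] kn by (auto simp: D_edges_symmetric_iff)
    qed (use m in auto)
    moreover obtain i where "i \<in> {1..m}" "t i = 1"
      using t_onto[of 1] \<open>k \<noteq> 1\<close> n4 by auto
    moreover have "m - 2 \<in> {1..m}" using m by auto
    ultimately have "t (m - 2) < k" using \<open>k \<noteq> 1\<close> k(1) by force
    then show False using branch(1) kn by simp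
  qed
  then show ?thesis using b k J by blast
qed

end

section \<open>Type E6\<close>

lemma E6_edges_three_neighbours:
  assumes "{i, a} \<in> E6_edges" "{i, b} \<in> E6_edges" "{i, c} \<in> E6_edges" "a \<noteq> b" "a \<noteq> c" "b \<noteq> c"
  shows "i = 4" "{2, 3, 5} \<subseteq> {a, b, c}"
proof -
  let ?k = "if i = 1 then 3 else if i = 3 then 1 else if i = 5 then 6 else 5"
  have nb: "i = 4 \<and> x \<in> {2, 3, 5} \<or> i \<noteq> 4 \<and> x \<in> {4, ?k}" if "{i, x} \<in> E6_edges" for x
    using that by (auto simp: E6_edges_def doubleton_eq_iff)
  note nb3 = nb[OF assms(1)] nb[OF assms(2)] nb[OF assms(3)]
  show i: "i = 4"
  proof (rule ccontr)
    assume "i \<noteq> 4"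
    then have "a \<in> {4, ?k}" "b \<in> {4, ?k}" "c \<in> {4, ?k}" using nb3 by blast+
    then show False using assms(4-6) by blast
  qed
  then have "a \<in> {2, 3, 5}" "b \<in> {2, 3, 5}" "c \<in> {2, 3, 5}" using nb3 by blast+
  then show "{2, 3, 5} \<subseteq> {a, b, c}" using assms(4-6) by blast
qed

locale type_E6_basis = root_basis +
  fixes f :: "nat \<Rightarrow> 'a"
  assumes labelling: "simply_laced_labelling \<Delta> 6 E6_edges f"
begin

lemma node: "i \<in> {1..6} \<Longrightarrow> f i \<in> \<Delta>"
  by (rule labelling_base[OF labelling])

lemma cartan_int_node:
  assumes "i \<in> {1..6}" "j \<in> {1..6}"
  shows "cartan_int (f i) (f j) = (if i = j then 2 else if {i, j} \<in> E6_edges then -1 else 0)"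
  by (rule labelling_cartan_int[OF labelling assms])

lemma base_cases:
  assumes "a \<in> \<Delta>"
  obtains "a = f 1" | "a = f 2" | "a = f 3" | "a = f 4" | "a = f 5" | "a = f 6"
proof -
  obtain i where i: "i \<in> {1..6}" "a = f i" by (rule labelling_onto[OF labelling assms])
  then have "i = 1 \<or> i = 2 \<or> i = 3 \<or> i = 4 \<or> i = 5 \<or> i = 6" by auto
  then show ?thesis using i(2) that by blast
qed

definition vec :: "real \<Rightarrow> real \<Rightarrow> real \<Rightarrow> real \<Rightarrow> real \<Rightarrow> real \<Rightarrow> 'a" where
  "vec a b c d e g = a *\<^sub>R f 1 + b *\<^sub>R f 2 + c *\<^sub>R f 3 + d *\<^sub>R f 4 + e *\<^sub>R f 5 + g *\<^sub>R f 6"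

lemma cartan_int_vec:
  "cartan_int (vec a b c d e g) (f 1) = 2 * a - c"
  "cartan_int (vec a b c d e g) (f 2) = 2 * b - d"
  "cartan_int (vec a b c d e g) (f 3) = 2 * c - a - d"
  "cartan_int (vec a b c d e g) (f 4) = 2 * d - b - c - e"
  "cartan_int (vec a b c d e g) (f 5) = 2 * e - d - g"
  "cartan_int (vec a b c d e g) (f 6) = 2 * g - e"
  by (simp_all add: vec_def cartan_int_add cartan_int_scale cartan_int_node E6_edges_def
      doubleton_eq_iff del: One_nat_def)

lemma vec_eqI:
  assumes "\<And>i. i \<in> {1..6} \<Longrightarrow> cartan_int x (f i) = cartan_int y (f i)"
  shows "x = y"
proof (rule cartan_int_eqI)
  fix a assume "a \<in> \<Delta>"
  then show "cartan_int x a = cartan_int y a"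
    using assms by (cases rule: base_cases) auto
qed

lemma vec_add: "vec a b c d e g + vec a' b' c' d' e' g' = vec (a + a') (b + b') (c + c') (d + d') (e + e') (g + g')"
  by (simp add: vec_def scaleR_add_left)

lemma vec_eq_iff:
  "vec a b c d e g = vec a' b' c' d' e' g' \<longleftrightarrow> a = a' \<and> b = b' \<and> c = c' \<and> d = d' \<and> e = e' \<and> g = g'"
proof
  assume eq: "vec a b c d e g = vec a' b' c' d' e' g'"
  have ne: "f i = f j \<longleftrightarrow> i = j" if "i \<in> {1..6}" "j \<in> {1..6}" for i j
    using labelling_inj[OF labelling that] .
  have dual_f: "inner (dual (f i)) (f j) = (if i = j then 1 else 0)" if "i \<in> {1..6}" "j \<in> {1..6}" for i j
    using inner_dual[OF node[OF that(1)] node[OF that(2)]] ne[OF that] by simp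
  have "inner (dual (f i)) (vec a b c d e g) = inner (dual (f i)) (vec a' b' c' d' e' g')" for i
    using eq by simp
  from this[of 1] this[of 2] this[of 3] this[of 4] this[of 5] this[of 6]
  show "a = a' \<and> b = b' \<and> c = c' \<and> d = d' \<and> e = e' \<and> g = g'"
    by (simp add: vec_def inner_add_right dual_f del: One_nat_def)
qed simp

lemma unit_vec:
  "f 1 = vec 1 0 0 0 0 0" "f 2 = vec 0 1 0 0 0 0" "f 3 = vec 0 0 1 0 0 0"
  "f 4 = vec 0 0 0 1 0 0" "f 5 = vec 0 0 0 0 1 0" "f 6 = vec 0 0 0 0 0 1"
  by (simp_all add: vec_def)

lemma reflection_vec:
  "reflection (f 1) (vec a b c d e g) = vec (c - a) b c d e g"
  "reflection (f 2) (vec a b c d e g) = vec a (d - b) c d e g"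
  "reflection (f 3) (vec a b c d e g) = vec a b (a + d - c) d e g"
  "reflection (f 4) (vec a b c d e g) = vec a b c (b + c + e - d) e g"
  "reflection (f 5) (vec a b c d e g) = vec a b c d (d + g - e) g"
  "reflection (f 6) (vec a b c d e g) = vec a b c d e (e - g)"
  unfolding reflection_def cartan_int_vec by (simp_all add: vec_def algebra_simps flip: scaleR_2)

lemma word_nodes_in_W: "set is \<subseteq> {1..6} \<Longrightarrow> word (map f is) \<in> W"
  using node by (intro refl_groupI) auto

text \<open>The word is a reduced expression of the longest element, which has length 36.\<close>

lemma w0_node:
  "w0 (f 1) = - f 6" "w0 (f 2) = - f 2" "w0 (f 3) = - f 5" "w0 (f 4) = - f 4" "w0 (f 5) = - f 3" "w0 (f 6) = - f 1"
proof -
  let ?w = "word (map f [1, 3, 4, 5, 6, 2, 4, 5, 3, 4, 1, 3, 2, 4, 5, 6, 2, 4, 5, 3, 4, 1, 3, 2, 4, 5,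
    3, 4, 1, 3, 2, 4, 1, 3, 2, 1])"
  have W: "?w \<in> W" by (intro word_nodes_in_W) auto
  have minus: "- f 1 = vec (-1) 0 0 0 0 0" "- f 2 = vec 0 (-1) 0 0 0 0" "- f 3 = vec 0 0 (-1) 0 0 0"
    "- f 4 = vec 0 0 0 (-1) 0 0" "- f 5 = vec 0 0 0 0 (-1) 0" "- f 6 = vec 0 0 0 0 0 (-1)"
    by (simp_all add: vec_def)
  have w: "?w (f 1) = - f 6" "?w (f 2) = - f 2" "?w (f 3) = - f 5"
    "?w (f 4) = - f 4" "?w (f 5) = - f 3" "?w (f 6) = - f 1"
    unfolding minus
    by (simp_all only: unit_vec(1)[THEN arg_cong[where f = ?w]] unit_vec(2)[THEN arg_cong[where f = ?w]]
      unit_vec(3)[THEN arg_cong[where f = ?w]] unit_vec(4)[THEN arg_cong[where f = ?w]]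
      unit_vec(5)[THEN arg_cong[where f = ?w]] unit_vec(6)[THEN arg_cong[where f = ?w]])
      (simp_all add: reflection_vec del: One_nat_def)
  have "- ?w a \<in> pos_roots" if "a \<in> \<Delta>" for a
  proof -
    have "- ?w a \<in> \<Delta>"
      using that w node by (cases rule: base_cases) (simp_all del: One_nat_def word_simps list.map)
    then show ?thesis by (rule base_pos)
  qed
  then have "w0 = ?w" by (rule longest_word_eqI[OF W])
  with w show "w0 (f 1) = - f 6" "w0 (f 2) = - f 2" "w0 (f 3) = - f 5" "w0 (f 4) = - f 4" "w0 (f 5) = - f 3" "w0 (f 6) = - f 1"
    by (simp_all only:)
qed

lemma w0_vec: "w0 (vec a b c d e g) = vec (- g) (- b) (- e) (- d) (- c) (- a)"
  unfolding vec_def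
  by (simp add: linear_add[OF refl_group_linear[OF w0_in_W]] linear_scale[OF refl_group_linear[OF w0_in_W]]
      w0_node del: One_nat_def)

definition sq :: real where "sq = inner (f 1) (f 1)"

lemma sq_pos: "0 < sq"
  using base_nonzero[OF node[of 1]] by (simp add: sq_def)

lemma inner_node_self: "i \<in> {1..6} \<Longrightarrow> inner (f i) (f i) = sq"
proof -
  have eq: "inner (f i) (f i) = inner (f j) (f j)" if "i \<in> {1..6}" "j \<in> {1..6}" "{i, j} \<in> E6_edges" "i \<noteq> j" for i j
  proof -
    have "cartan_int (f i) (f j) = -1" "cartan_int (f j) (f i) = -1"
      using that cartan_int_node[of i j] cartan_int_node[of j i] by (simp_all add: insert_commute)
    moreover have "f i \<noteq> 0" "f j \<noteq> 0" using that node base_nonzero by blast+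
    ultimately have "2 * inner (f i) (f j) = - inner (f j) (f j)" "2 * inner (f j) (f i) = - inner (f i) (f i)"
      unfolding cartan_int_def by (simp_all add: field_simps)
    then show ?thesis by (simp add: inner_commute)
  qed
  have "inner (f 3) (f 3) = sq" using eq[of 1 3] by (simp add: sq_def E6_edges_def)
  moreover from this have "inner (f 4) (f 4) = sq" using eq[of 3 4] by (simp add: E6_edges_def)
  moreover from this have "inner (f 5) (f 5) = sq" using eq[of 4 5] by (simp add: E6_edges_def)
  moreover from this have "inner (f 6) (f 6) = sq" using eq[of 5 6] by (simp add: E6_edges_def)
  moreover have "inner (f 2) (f 2) = sq" using eq[of 2 4] \<open>inner (f 4) (f 4) = sq\<close> by (simp add: E6_edges_def)
  moreover assume "i \<in> {1..6}"
  then have "i = 1 \<or> i = 2 \<or> i = 3 \<or> i = 4 \<or> i = 5 \<or> i = 6" by auto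
  ultimately show ?thesis by (auto simp: sq_def)
qed

lemma inner_vec:
  "inner (vec a b c d e g) (vec a' b' c' d' e' g') =
    sq / 2 * (a * (2 * a' - c') + b * (2 * b' - d') + c * (2 * c' - a' - d') + d * (2 * d' - b' - c' - e') +
      e * (2 * e' - d' - g') + g * (2 * g' - e'))"
proof -
  let ?x = "vec a' b' c' d' e' g'"
  have inner_f: "inner (f i) ?x = sq / 2 * cartan_int ?x (f i)" if "i \<in> {1..6}" for i
    using inner_node_self[OF that] sq_pos by (simp add: cartan_int_def inner_commute)
  have "inner (vec a b c d e g) ?x = a * inner (f 1) ?x + b * inner (f 2) ?x + c * inner (f 3) ?x +
      d * inner (f 4) ?x + e * inner (f 5) ?x + g * inner (f 6) ?x"
    by (simp add: vec_def[of a b c d e g] inner_add_left del: One_nat_def)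
  also have "\<dots> = sq / 2 * (a * cartan_int ?x (f 1) + b * cartan_int ?x (f 2) + c * cartan_int ?x (f 3) +
      d * cartan_int ?x (f 4) + e * cartan_int ?x (f 5) + g * cartan_int ?x (f 6))"
    by (simp add: inner_f distrib_left mult.left_commute del: One_nat_def)
  finally show ?thesis unfolding cartan_int_vec .
qed

text \<open>
The root lattice has index three in the weight lattice of \<open>E\<^sub>6\<close>. Tripling the fundamental weights makes
their coordinates integral.\<close>

definition fw :: "nat \<Rightarrow> 'a" where
  "fw j = (3 * (sq / 2)) *\<^sub>R dual (f j)"

lemma cartan_int_fw:
  assumes "j \<in> {1..6}" "i \<in> {1..6}"
  shows "cartan_int (fw j) (f i) = (if i = j then 3 else 0)"
proof -
  have "fw j = 3 *\<^sub>R ((inner (f j) (f j) / 2) *\<^sub>R dual (f j))"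
    using inner_node_self[OF assms(1)] by (simp add: fw_def)
  then have "cartan_int (fw j) (f i) = 3 * cartan_int ((inner (f j) (f j) / 2) *\<^sub>R dual (f j)) (f i)"
    by (simp only: cartan_int_scale[of 3])
  then show ?thesis
    unfolding cartan_int_dual[OF node[OF assms(1)] node[OF assms(2)]] labelling_inj[OF labelling assms]
    by auto
qed

lemma fw_vec:
  "fw 1 = vec 4 3 5 6 4 2" "fw 2 = vec 3 6 6 9 6 3" "fw 3 = vec 5 6 10 12 8 4"
  "fw 4 = vec 6 9 12 18 12 6" "fw 5 = vec 4 6 8 12 10 5" "fw 6 = vec 2 3 4 6 5 4"
proof -
  have split: "i = 1 \<or> i = 2 \<or> i = 3 \<or> i = 4 \<or> i = 5 \<or> i = 6" if "i \<in> {1..6}" for i :: nat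
    using that by auto
  show "fw 1 = vec 4 3 5 6 4 2" "fw 2 = vec 3 6 6 9 6 3" "fw 3 = vec 5 6 10 12 8 4"
    "fw 4 = vec 6 9 12 18 12 6" "fw 5 = vec 4 6 8 12 10 5" "fw 6 = vec 2 3 4 6 5 4"
    by (rule vec_eqI, drule split, elim disjE; simp add: cartan_int_fw cartan_int_vec del: One_nat_def)+
qed

lemma vec_expansion:
  "x = vec (inner (dual (f 1)) x) (inner (dual (f 2)) x) (inner (dual (f 3)) x)
    (inner (dual (f 4)) x) (inner (dual (f 5)) x) (inner (dual (f 6)) x)"
proof -
  have "{1..6} = {1, 2, 3, 4, 5, 6 :: nat}" by auto
  moreover have "x = (\<Sum>i\<in>{1..6}. inner (dual (f i)) x *\<^sub>R f i)"
    unfolding sum.reindex_bij_betw[OF labelling_bij[OF labelling], of "\<lambda>a. inner (dual a) x *\<^sub>R a"]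
    by (rule base_expansion)
  ultimately show ?thesis by (simp add: vec_def add.assoc del: One_nat_def)
qed

lemma W_fw:
  assumes w: "w \<in> W" and j: "j \<in> {1..6}"
  shows "\<exists>(a::int) (b::int) (c::int) (d::int) (e::int) (g::int). w (fw j) = fw j +
    vec (3 * a) (3 * b) (3 * c) (3 * d) (3 * e) (3 * g)"
proof -
  define x where "x = (1 / 3) *\<^sub>R fw j"
  have "cartan_int x a \<in> \<int>" if a: "a \<in> \<Delta>" for a
  proof -
    obtain i where "i \<in> {1..6}" "a = f i" using a by (rule labelling_onto[OF labelling])
    then show ?thesis using cartan_int_fw[OF j] by (simp add: x_def cartan_int_scale)
  qed
  then have "\<exists>k. inner (dual (f i)) (w x - x) = real_of_int k" if "i \<in> {1..6}" for i
    using weight_shift[OF w _ node[OF that]] Ints_cases by metis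
  from this[of 1] this[of 2] this[of 3] this[of 4] this[of 5] this[of 6]
  obtain a b c d e g :: int where "w x - x = vec a b c d e g"
    using vec_expansion[of "w x - x"] by auto
  moreover have "w (fw j) = fw j + 3 *\<^sub>R (w x - x)"
    by (simp add: x_def linear_scale[OF refl_group_linear[OF w]] algebra_simps)
  moreover have "3 *\<^sub>R vec a b c d e g = vec (3 * real_of_int a) (3 * real_of_int b) (3 * real_of_int c)
      (3 * real_of_int d) (3 * real_of_int e) (3 * real_of_int g)"
    by (simp add: vec_def scaleR_add_right)
  ultimately have "w (fw j) = fw j + vec (3 * real_of_int a) (3 * real_of_int b) (3 * real_of_int c)
      (3 * real_of_int d) (3 * real_of_int e) (3 * real_of_int g)"
    by simp
  then show ?thesis by blast
qed

lemma fixed_vec: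
  assumes "w0 (vec a b c d e g) = vec a b c d e g"
  shows "vec a b c d e g = vec a 0 c 0 (- c) (- a)"
  using assms unfolding w0_vec vec_eq_iff by auto

lemma fixed_norm: "inner (vec a 0 c 0 (- c) (- a)) (vec a 0 c 0 (- c) (- a)) = 2 * sq * (a * a - a * c + c * c)"
  by (simp add: inner_vec algebra_simps)

lemma fixed_fw:
  assumes w: "w \<in> W" "w0 (w (fw j)) = w (fw j)" and j: "j \<in> {1..6}"
    and fw: "fw j = vec (of_int x1) (of_int x2) (of_int x3) (of_int x4) (of_int x5) (of_int x6)"
  obtains a c :: int
  where "w (fw j) = vec a 0 c 0 (- c) (- a)" "a mod 3 = x1 mod 3" "c mod 3 = x3 mod 3"
    "inner (fw j) (fw j) = sq * of_int (2 * (a * a - a * c + c * c))"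
proof -
  obtain a b c d e g :: int
    where eq: "w (fw j) = fw j + vec (3 * real_of_int a) (3 * real_of_int b) (3 * real_of_int c)
      (3 * real_of_int d) (3 * real_of_int e) (3 * real_of_int g)"
    using W_fw[OF w(1) j] by blast
  let ?A = "x1 + 3 * a" and ?C = "x3 + 3 * c"
  have "w (fw j) = vec ?A (x2 + 3 * b) ?C (x4 + 3 * d) (x5 + 3 * e) (x6 + 3 * g)"
    by (rule trans[OF eq]) (simp add: fw vec_add)
  then have wfw: "w (fw j) = vec ?A 0 ?C 0 (- real_of_int ?C) (- real_of_int ?A)"
    using fixed_vec w(2) by metis
  have "inner (fw j) (fw j) = sq * of_int (2 * (?A * ?A - ?A * ?C + ?C * ?C))"
    using refl_group_inner[OF w(1), of "fw j" "fw j"] unfolding wfw fixed_norm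
    by (simp add: algebra_simps)
  moreover have "?A mod 3 = x1 mod 3" "?C mod 3 = x3 mod 3" by simp_all
  ultimately show ?thesis using that[of ?A ?C] wfw by simp
qed

lemma fw_eq_iff:
  assumes "u \<in> W" "v \<in> W"
  shows "u (fw j) = v (fw j) \<longleftrightarrow> u (dual (f j)) = v (dual (f j))"
  using sq_pos unfolding fw_def
  by (simp add: linear_scale[OF refl_group_linear[OF assms(1)]] linear_scale[OF refl_group_linear[OF assms(2)]])

lemma fixed_reps_iff:
  "u \<in> fixed_reps J \<longleftrightarrow> u \<in> W \<and> (\<forall>j\<in>{1..6}. f j \<notin> J \<longrightarrow> w0 (u (fw j)) = u (fw j))"
proof (cases "u \<in> W")
  case True
  have "w0 (u (fw j)) = u (fw j) \<longleftrightarrow> w0 (u (dual (f j))) = u (dual (f j))" for j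
    using fw_eq_iff[OF refl_group_comp[OF w0_in_W True] True, of j] by simp
  moreover have "(\<forall>b\<in>\<Delta> - J. P b) \<longleftrightarrow> (\<forall>j\<in>{1..6}. f j \<notin> J \<longrightarrow> P (f j))" for P
    using node labelling_onto[OF labelling] by (metis DiffD1 DiffD2 DiffI)
  ultimately show ?thesis using True by (simp add: fixed_reps_def)
qed (simp add: fixed_reps_def)

text \<open>Integral vectors in the fixed plane have squared length \<open>2 * (a * a - a * c + c * c)\<close> in units of \<open>sq\<close>.\<close>

lemma even_norm_if_fixed:
  assumes "w \<in> W" "w0 (w (fw j)) = w (fw j)" "j \<in> {1..6}"
    and fw: "fw j = vec (of_int x1) (of_int x2) (of_int x3) (of_int x4) (of_int x5) (of_int x6)"
    and norm: "inner (fw j) (fw j) = sq * of_int q"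
  shows "even q"
proof -
  obtain a c :: int where "inner (fw j) (fw j) = sq * of_int (2 * (a * a - a * c + c * c))"
    using fixed_fw[OF assms(1-3) fw] by blast
  then have "real_of_int q = real_of_int (2 * (a * a - a * c + c * c))"
    using norm sq_pos by simp
  then have "q = 2 * (a * a - a * c + c * c)" by (simp only: of_int_eq_iff)
  then show ?thesis by simp
qed

text \<open>
The squared lengths of the tripled weights at the other nodes are odd multiples of \<open>sq\<close>, namely by 9, 15, 27 and 15.\<close>

lemma missing_node:
  assumes u: "u \<in> fixed_reps J" and j: "j \<in> {1..6}" "f j \<notin> J"
  shows "j = 1 \<or> j = 6"
proof (rule ccontr)
  assume "\<not> (j = 1 \<or> j = 6)"
  then have cases: "j = 2 \<or> j = 3 \<or> j = 4 \<or> j = 5" using j(1) by auto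
  have w: "u \<in> W" "w0 (u (fw j)) = u (fw j)" using u j by (auto simp: fixed_reps_iff)
  have norm: "inner (fw 2) (fw 2) = sq * of_int 9" "inner (fw 3) (fw 3) = sq * of_int 15"
    "inner (fw 4) (fw 4) = sq * of_int 27" "inner (fw 5) (fw 5) = sq * of_int 15"
    by (simp_all add: fw_vec inner_vec)
  note odd = even_norm_if_fixed[OF w j(1)]
  show False
    using cases
  proof (elim disjE)
    assume "j = 2"
    then show False using odd[of 3 6 6 9 6 3 9] norm(1) fw_vec(2) by simp
  next
    assume "j = 3"
    then show False using odd[of 5 6 10 12 8 4 15] norm(2) fw_vec(3) by simp
  next
    assume "j = 4"
    then show False using odd[of 6 9 12 18 12 6 27] norm(3) fw_vec(4) by simp
  next
    assume "j = 5"
    then show False using odd[of 4 6 8 12 10 5 15] norm(4) fw_vec(5) by simp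
  qed
qed

text \<open>The integral points of the plane fixed by \<open>w0\<close>. Those of squared length \<open>6 * sq\<close> form a hexagon.\<close>

definition hex :: "int \<Rightarrow> int \<Rightarrow> 'a" where
  "hex a c = vec a 0 c 0 (- c) (- a)"

lemma hex_eq_iff: "hex a c = hex a' c' \<longleftrightarrow> a = a' \<and> c = c'"
  by (auto simp: hex_def vec_eq_iff)

lemma w0_hex: "w0 (hex a c) = hex a c"
  by (simp add: hex_def w0_vec)

lemma inner_hex: "inner (hex a c) (hex a' c') = sq * of_int (2 * a * a' - a * c' - c * a' + 2 * c * c')"
  by (simp add: hex_def inner_vec algebra_simps)

end

lemma hexagon:
  fixes a c :: int
  assumes "a * a - a * c + c * c = 3"
  shows "(a, c) \<in> {(1, 2), (1, -1), (-2, -1), (2, 1), (-1, 1), (-1, -2)}"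
proof -
  have "(2 * a - c) * (2 * a - c) + 3 * (c * c) = 12" "(2 * c - a) * (2 * c - a) + 3 * (a * a) = 12"
    using assms by (simp_all add: algebra_simps)
  moreover have "0 \<le> (2 * a - c) * (2 * a - c)" "0 \<le> (2 * c - a) * (2 * c - a)" by simp_all
  ultimately have "a * a \<le> 4" "c * c \<le> 4" by linarith+
  then have "\<bar>a\<bar> \<le> 2" "\<bar>c\<bar> \<le> 2"
    using abs_le_square_iff[of a 2] abs_le_square_iff[of c 2] by (simp_all add: power2_eq_square)
  then have "a \<in> {-2, -1, 0, 1, 2}" "c \<in> {-2, -1, 0, 1, 2}" by auto
  then show ?thesis using assms by auto
qed

context type_E6_basis
begin

lemma fixed_hex:
  assumes w: "w \<in> W" "w0 (w (fw j)) = w (fw j)" and j: "j \<in> {1..6}"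
    and fw: "fw j = vec (of_int x1) (of_int x2) (of_int x3) (of_int x4) (of_int x5) (of_int x6)"
    and norm: "inner (fw j) (fw j) = sq * 6"
  obtains a c where "w (fw j) = hex a c" "a mod 3 = x1 mod 3" "c mod 3 = x3 mod 3"
    "(a, c) \<in> {(1, 2), (1, -1), (-2, -1), (2, 1), (-1, 1), (-1, -2)}"
proof -
  obtain a c :: int where ac: "w (fw j) = vec a 0 c 0 (- c) (- a)" "a mod 3 = x1 mod 3" "c mod 3 = x3 mod 3"
    "inner (fw j) (fw j) = sq * of_int (2 * (a * a - a * c + c * c))"
    using fixed_fw[OF w j fw] by blast
  have "real_of_int (2 * (a * a - a * c + c * c)) = real_of_int 6"
    using norm ac(4) sq_pos by simp
  then have "2 * (a * a - a * c + c * c) = 6" by (simp only: of_int_eq_iff)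
  then have "a * a - a * c + c * c = 3" by simp
  from hexagon[OF this] show ?thesis using that[of a c] ac by (simp add: hex_def)
qed

lemma fixed_fw1:
  assumes w: "w \<in> W" "w0 (w (fw 1)) = w (fw 1)"
  shows "w (fw 1) \<in> {hex 1 2, hex 1 (-1), hex (-2) (-1)}"
proof -
  have norm: "inner (fw 1) (fw 1) = sq * 6" unfolding fw_vec by (simp add: inner_vec)
  have "fw 1 = vec (of_int 4) (of_int 3) (of_int 5) (of_int 6) (of_int 4) (of_int 2)"
    unfolding fw_vec by simp
  from fixed_hex[OF w _ this norm] obtain a c where ac: "w (fw 1) = hex a c" "a mod 3 = 4 mod 3" "c mod 3 = 5 mod 3"
    "(a, c) \<in> {(1, 2), (1, -1), (-2, -1), (2, 1), (-1, 1), (-1, -2)}" by auto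
  then show ?thesis by auto
qed

lemma fixed_fw6:
  assumes w: "w \<in> W" "w0 (w (fw 6)) = w (fw 6)"
  shows "w (fw 6) \<in> {hex 2 1, hex (-1) 1, hex (-1) (-2)}"
proof -
  have norm: "inner (fw 6) (fw 6) = sq * 6" unfolding fw_vec by (simp add: inner_vec)
  have "fw 6 = vec (of_int 2) (of_int 3) (of_int 4) (of_int 6) (of_int 5) (of_int 4)"
    unfolding fw_vec by simp
  from fixed_hex[OF w _ this norm] obtain a c where ac: "w (fw 6) = hex a c" "a mod 3 = 2 mod 3" "c mod 3 = 4 mod 3"
    "(a, c) \<in> {(1, 2), (1, -1), (-2, -1), (2, 1), (-1, 1), (-1, -2)}" by auto
  then show ?thesis by auto
qed

text \<open>The words trace paths in the orbit of the pair of weights that end at the pairs of neighbouring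
vertices.\<close>

lemma fixed_pairs:
  "\<exists>w\<in>W. w (fw 1) = hex 1 2 \<and> w (fw 6) = hex (-1) 1"
  "\<exists>w\<in>W. w (fw 1) = hex 1 2 \<and> w (fw 6) = hex 2 1"
  "\<exists>w\<in>W. w (fw 1) = hex 1 (-1) \<and> w (fw 6) = hex (-1) (-2)"
  "\<exists>w\<in>W. w (fw 1) = hex 1 (-1) \<and> w (fw 6) = hex 2 1"
  "\<exists>w\<in>W. w (fw 1) = hex (-2) (-1) \<and> w (fw 6) = hex (-1) (-2)"
  "\<exists>w\<in>W. w (fw 1) = hex (-2) (-1) \<and> w (fw 6) = hex (-1) 1"
proof -
  have ex: "\<exists>w\<in>W. w (fw 1) = x \<and> w (fw 6) = y"
    if "set is \<subseteq> {1..6}" "word (map f is) (fw 1) = x \<and> word (map f is) (fw 6) = y" for "is" x y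
    using that word_nodes_in_W by blast
  show "\<exists>w\<in>W. w (fw 1) = hex 1 2 \<and> w (fw 6) = hex (-1) 1"
    by (rule ex[of "[5, 4, 1, 3, 2, 4, 5, 6, 5, 4, 3, 1]"])
      (simp_all add: hex_def fw_vec reflection_vec del: One_nat_def)
  show "\<exists>w\<in>W. w (fw 1) = hex 1 2 \<and> w (fw 6) = hex 2 1"
    by (rule ex[of "[6, 5, 4, 3, 2, 4, 5, 6, 5, 4, 3, 1]"])
      (simp_all add: hex_def fw_vec reflection_vec del: One_nat_def)
  show "\<exists>w\<in>W. w (fw 1) = hex 1 (-1) \<and> w (fw 6) = hex (-1) (-2)"
    by (rule ex[of "[3, 4, 1, 3, 2, 4, 5, 6, 5, 4, 3, 1]"])
      (simp_all add: hex_def fw_vec reflection_vec del: One_nat_def)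
  show "\<exists>w\<in>W. w (fw 1) = hex 1 (-1) \<and> w (fw 6) = hex 2 1"
    by (rule ex[of "[6, 5, 4, 3, 2, 4, 5, 6, 2, 4, 3, 1]"])
      (simp_all add: hex_def fw_vec reflection_vec del: One_nat_def)
  show "\<exists>w\<in>W. w (fw 1) = hex (-2) (-1) \<and> w (fw 6) = hex (-1) (-2)"
    by (rule ex[of "[3, 4, 1, 3, 2, 4, 5, 6, 2, 4, 3, 1]"])
      (simp_all add: hex_def fw_vec reflection_vec del: One_nat_def)
  show "\<exists>w\<in>W. w (fw 1) = hex (-2) (-1) \<and> w (fw 6) = hex (-1) 1"
    by (rule ex[of "[5, 4, 1, 3, 2, 4, 5, 6, 2, 4, 3, 1]"])
      (simp_all add: hex_def fw_vec reflection_vec del: One_nat_def)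
qed

lemma missing_iff: "f i \<in> \<Delta> - {f j} \<longleftrightarrow> i \<noteq> j" if "i \<in> {1..6}" "j \<in> {1..6}"
  using labelling_inj[OF labelling that] node[OF that(1)] by auto

lemma a_P_D5: "a_P \<Delta> (\<Delta> - {f 1}) = 3"
proof -
  let ?J = "\<Delta> - {f 1}"
  have in6: "(1::nat) \<in> {1..6}" by simp
  have missing: "\<Delta> - ?J = {f 1}" using node[OF in6] by blast
  have reps: "u \<in> fixed_reps ?J \<longleftrightarrow> u \<in> W \<and> w0 (u (fw 1)) = u (fw 1)" for u
  proof -
    have "f j \<notin> ?J \<longleftrightarrow> j = 1" if "j \<in> {1..6}" for j
      using missing_iff[OF that in6] by blast
    then show ?thesis unfolding fixed_reps_iff using in6 by blast
  qed
  have "a_P \<Delta> ?J = card ((\<lambda>u. u (fw 1)) ` fixed_reps ?J)"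
  proof (rule a_P_eq_card)
    fix u v assume "u \<in> fixed_reps ?J" "v \<in> fixed_reps ?J"
    then show "u (fw 1) = v (fw 1) \<longleftrightarrow> (\<forall>b\<in>\<Delta> - ?J. u (dual b) = v (dual b))"
      unfolding missing using fw_eq_iff reps by simp
  qed blast
  also have "(\<lambda>u. u (fw 1)) ` fixed_reps ?J = {hex 1 2, hex 1 (-1), hex (-2) (-1)}"
  proof
    show "(\<lambda>u. u (fw 1)) ` fixed_reps ?J \<subseteq> {hex 1 2, hex 1 (-1), hex (-2) (-1)}"
      using reps fixed_fw1 by blast
    have "hex a c \<in> (\<lambda>u. u (fw 1)) ` fixed_reps ?J" if "\<exists>w\<in>W. w (fw 1) = hex a c \<and> w (fw 6) = y" for a c y
    proof -
      obtain w where "w \<in> W" "w (fw 1) = hex a c" using \<open>\<exists>w\<in>W. _ \<and> _\<close> by blast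
      then show ?thesis using reps w0_hex by (intro image_eqI[of _ _ w]) auto
    qed
    from this[OF fixed_pairs(1)] this[OF fixed_pairs(3)] this[OF fixed_pairs(5)]
    show "{hex 1 2, hex 1 (-1), hex (-2) (-1)} \<subseteq> (\<lambda>u. u (fw 1)) ` fixed_reps ?J" by blast
  qed
  also have "card {hex 1 2, hex 1 (-1), hex (-2) (-1)} = 3"
    by (simp add: hex_eq_iff)
  finally show ?thesis .
qed

lemma a_P_D4: "a_P \<Delta> (\<Delta> - {f 1, f 6}) = 6"
proof -
  let ?J = "\<Delta> - {f 1, f 6}"
  let ?P = "{(hex 1 2, hex (-1) 1), (hex 1 2, hex 2 1), (hex 1 (-1), hex (-1) (-2)),
    (hex 1 (-1), hex 2 1), (hex (-2) (-1), hex (-1) (-2)), (hex (-2) (-1), hex (-1) 1)}"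
  let ?F = "\<lambda>u. (u (fw 1), u (fw 6))"
  have in6: "(1::nat) \<in> {1..6}" "(6::nat) \<in> {1..6}" by simp_all
  have missing: "\<Delta> - ?J = {f 1, f 6}" using in6[THEN node] by blast
  have reps: "u \<in> fixed_reps ?J \<longleftrightarrow> u \<in> W \<and> w0 (u (fw 1)) = u (fw 1) \<and> w0 (u (fw 6)) = u (fw 6)" for u
  proof -
    have "f j \<notin> ?J \<longleftrightarrow> j = 1 \<or> j = 6" if "j \<in> {1..6}" for j
      using missing_iff[OF that in6(1)] missing_iff[OF that in6(2)] by blast
    then show ?thesis unfolding fixed_reps_iff using in6 by blast
  qed
  have "a_P \<Delta> ?J = card (?F ` fixed_reps ?J)"
  proof (rule a_P_eq_card)
    fix u v assume "u \<in> fixed_reps ?J" "v \<in> fixed_reps ?J"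
    then show "?F u = ?F v \<longleftrightarrow> (\<forall>b\<in>\<Delta> - ?J. u (dual b) = v (dual b))"
      unfolding missing using fw_eq_iff reps by simp
  qed blast
  also have "?F ` fixed_reps ?J = ?P"
  proof
    show "?F ` fixed_reps ?J \<subseteq> ?P"
    proof
      fix x assume "x \<in> ?F ` fixed_reps ?J"
      then obtain u where u: "u \<in> W" "w0 (u (fw 1)) = u (fw 1)" "w0 (u (fw 6)) = u (fw 6)" "x = ?F u"
        using reps by blast
      have "inner (u (fw 1)) (u (fw 6)) = 3 * sq"
        unfolding refl_group_inner[OF u(1)] fw_vec by (simp add: inner_vec)
      then show "x \<in> ?P"
        using fixed_fw1[OF u(1,2)] fixed_fw6[OF u(1,3)] sq_pos unfolding u(4)
        by (elim insertE emptyE) (simp_all add: inner_hex)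
    qed
    have "(hex a c, hex a' c') \<in> ?F ` fixed_reps ?J"
      if ex: "\<exists>w\<in>W. w (fw 1) = hex a c \<and> w (fw 6) = hex a' c'" for a c a' c'
    proof -
      obtain w where "w \<in> W" "w (fw 1) = hex a c" "w (fw 6) = hex a' c'" using ex by blast
      then show ?thesis using reps w0_hex by (intro image_eqI[of _ _ w]) auto
    qed
    from fixed_pairs[THEN this] show "?P \<subseteq> ?F ` fixed_reps ?J" by blast
  qed
  also have "card ?P = 6"
    by (simp add: hex_eq_iff)
  finally show ?thesis .
qed

definition flip :: "nat \<Rightarrow> nat" where
  "flip i = (if i = 1 then 6 else if i = 6 then 1 else if i = 3 then 5 else if i = 5 then 3 else i)"

text \<open>The symmetry of the diagram transfers the result for the first node to the sixth.\<close>

lemma labelling_flip: "simply_laced_labelling \<Delta> 6 E6_edges (f \<circ> flip)"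
proof -
  have "bij_betw flip {1..6} {1..6}"
    by (rule bij_betw_byWitness[of _ flip]) (auto simp: flip_def)
  then have "bij_betw (f \<circ> flip) {1..6} \<Delta>"
    using labelling_bij[OF labelling] by (rule bij_betw_trans)
  moreover have "cartan_int (f (flip i)) (f (flip j)) = (if {i, j} \<in> E6_edges then -1 else 0)"
    if "i \<in> {1..6}" "j \<in> {1..6}" "i \<noteq> j" for i j
  proof -
    have 1: "flip i \<in> {1..6}" "flip j \<in> {1..6}" "flip i \<noteq> flip j" using that by (auto simp: flip_def)
    have "{flip i, flip j} \<in> E6_edges \<longleftrightarrow> {i, j} \<in> E6_edges"
      by (auto simp: flip_def E6_edges_def doubleton_eq_iff)
    then show ?thesis using cartan_int_node[OF 1(1,2)] 1(3) by simp
  qed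
  ultimately show ?thesis by (simp add: simply_laced_labelling_def)
qed

lemma a_P_D5': "a_P \<Delta> (\<Delta> - {f 6}) = 3"
proof -
  interpret flipped: type_E6_basis \<Phi> \<Delta> "f \<circ> flip"
    by unfold_locales (rule labelling_flip)
  show ?thesis using flipped.a_P_D5 by (simp add: flip_def)
qed

text \<open>The branch point of the subdiagram has to be node 4, and its neighbours nodes 2, 3 and 5.\<close>

lemma missing_if_type_D:
  assumes J: "J \<subseteq> \<Delta>" and type: "type_D m J" and m: "4 \<le> m"
  shows "\<Delta> - J \<subseteq> {f 1, f 6}" "card (\<Delta> - J) = 6 - m"
proof -
  obtain g where "simply_laced_labelling J m (D_edges m) g"
    using type by (auto simp: type_D_def)
  then obtain t where Jt: "J = f ` t ` {1..m}"
    and tinj: "\<And>i j. i \<in> {1..m} \<Longrightarrow> j \<in> {1..m} \<Longrightarrow> t i = t j \<longleftrightarrow> i = j"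
    and edge: "\<And>i j. i \<in> {1..m} \<Longrightarrow> j \<in> {1..m} \<Longrightarrow> i \<noteq> j \<Longrightarrow> {i, j} \<in> D_edges m \<longleftrightarrow> {t i, t j} \<in> E6_edges"
    and "card (\<Delta> - J) = 6 - m"
    using labelled_subset[OF labelling J] by metis
  then show "card (\<Delta> - J) = 6 - m" by blast
  have in_m: "m - 3 \<in> {1..m}" "m - 2 \<in> {1..m}" "m - 1 \<in> {1..m}" "m \<in> {1..m}"
    and ne: "m - 2 \<noteq> m - 3" "m - 2 \<noteq> m - 1" "m - 2 \<noteq> m" "m - 3 \<noteq> m - 1" "m - 3 \<noteq> m" "m - 1 \<noteq> m"
    using m by auto
  have edges: "{m - 2, m - 3} \<in> D_edges m" "{m - 2, m - 1} \<in> D_edges m" "{m - 2, m} \<in> D_edges m"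
    unfolding D_edges_symmetric_iff using m by arith+
  have "{t (m - 2), t (m - 3)} \<in> E6_edges" "{t (m - 2), t (m - 1)} \<in> E6_edges" "{t (m - 2), t m} \<in> E6_edges"
    using edge[OF in_m(2,1) ne(1)] edge[OF in_m(2,3) ne(2)] edge[OF in_m(2,4) ne(3)] edges by auto
  moreover have "t (m - 3) \<noteq> t (m - 1)" "t (m - 3) \<noteq> t m" "t (m - 1) \<noteq> t m"
    using tinj[OF in_m(1,3)] tinj[OF in_m(1,4)] tinj[OF in_m(3,4)] ne by auto
  ultimately have "t (m - 2) = 4" "{2, 3, 5} \<subseteq> {t (m - 3), t (m - 1), t m}"
    using E6_edges_three_neighbours by blast+
  then have "{2, 3, 4, 5} \<subseteq> t ` {1..m}" using in_m by auto
  then have sub: "f ` {2, 3, 4, 5} \<subseteq> J" unfolding Jt by (rule image_mono)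
  show "\<Delta> - J \<subseteq> {f 1, f 6}"
  proof
    fix a assume a: "a \<in> \<Delta> - J"
    then have "a \<in> \<Delta>" by blast
    then show "a \<in> {f 1, f 6}" using a sub by (cases rule: base_cases) auto
  qed
qed

lemma a_P_type_D5:
  assumes J: "J \<subseteq> \<Delta>" and type: "type_D 5 J"
  shows "a_P \<Delta> J = 3"
proof -
  have "\<Delta> - J \<subseteq> {f 1, f 6}" "card (\<Delta> - J) = 1"
    using missing_if_type_D[OF J type] by auto
  then have "\<Delta> - J = {f 1} \<or> \<Delta> - J = {f 6}" by (auto simp: card_1_singleton_iff)
  then have "J = \<Delta> - {f 1} \<or> J = \<Delta> - {f 6}" using J by blast
  then show ?thesis using a_P_D5 a_P_D5' by auto
qed

lemma a_P_type_D4: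
  assumes J: "J \<subseteq> \<Delta>" and type: "type_D 4 J"
  shows "a_P \<Delta> J = 6"
proof -
  have "\<Delta> - J \<subseteq> {f 1, f 6}" "card (\<Delta> - J) = 2"
    using missing_if_type_D[OF J type] by auto
  moreover have "card {f 1, f 6} \<le> 2" by (simp add: card_insert_if)
  ultimately have "\<Delta> - J = {f 1, f 6}" by (intro card_seteq) auto
  then have "J = \<Delta> - {f 1, f 6}" using J by blast
  then show ?thesis using a_P_D4 by simp
qed

lemma sub_labelling:
  assumes L: "distinct L" "set L \<subseteq> {1..6}" and J: "J = f ` set L"
    and edges: "\<And>i j. i \<in> {1..length L} \<Longrightarrow> j \<in> {1..length L} \<Longrightarrow> i \<noteq> j \<Longrightarrow>
      {L ! (i - 1), L ! (j - 1)} \<in> E6_edges \<longleftrightarrow> {i, j} \<in> E"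
  shows "simply_laced_labelling J (length L) E (\<lambda>i. f (L ! (i - 1)))"
  unfolding simply_laced_labelling_def
proof (intro conjI ballI impI)
  have "bij_betw ((!) L) {..<length L} (set L)" using L(1) by (intro bij_betw_nth) auto
  moreover have "bij_betw (\<lambda>i. i - 1) {1..length L} {..<length L}"
    by (rule bij_betw_byWitness[of _ Suc]) auto
  moreover have "bij_betw f (set L) J"
    using bij_betw_subset[OF labelling_bij[OF labelling] L(2)] J by blast
  ultimately have "bij_betw (f \<circ> ((!) L \<circ> (\<lambda>i. i - 1))) {1..length L} J"
    by (meson bij_betw_trans)
  then show "bij_betw (\<lambda>i. f (L ! (i - 1))) {1..length L} J" by (simp only: comp_def)
  fix i j assume ij: "i \<in> {1..length L}" "j \<in> {1..length L}" "i \<noteq> j"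
  have "i - 1 < length L" "j - 1 < length L" "i - 1 \<noteq> j - 1" using ij by auto
  then have "L ! (i - 1) \<in> {1..6}" "L ! (j - 1) \<in> {1..6}" "L ! (i - 1) \<noteq> L ! (j - 1)"
    using L nth_mem by (blast, blast, simp add: nth_eq_iff_index_eq)
  then show "cartan_int (f (L ! (i - 1))) (f (L ! (j - 1))) = (if {i, j} \<in> E then -1 else 0)"
    using cartan_int_node edges[OF ij] by simp
qed

lemma type_D_if_fixed_reps:
  assumes J: "J \<subseteq> \<Delta>" "J \<noteq> \<Delta>" and reps: "fixed_reps J \<noteq> {}"
  shows "type_D 5 J \<or> type_D 4 J"
proof -
  obtain u where u: "u \<in> fixed_reps J" using reps by blast
  have missing: "a \<in> {f 1, f 6}" if a: "a \<in> \<Delta> - J" for a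
  proof -
    have "a \<in> \<Delta>" using a by blast
    then obtain j where "j \<in> {1..6}" "a = f j" by (rule labelling_onto[OF labelling])
    then show ?thesis using missing_node[OF u] a by auto
  qed
  have \<Delta>: "\<Delta> = f ` {1, 2, 3, 4, 5, 6}"
    using base_cases node by (auto elim!: base_cases)
  have inj: "f i = f j \<longleftrightarrow> i = j" if "i \<in> {1..6}" "j \<in> {1..6}" for i j
    by (rule labelling_inj[OF labelling that])
  have "\<Delta> - J = {f 1} \<or> \<Delta> - J = {f 6} \<or> \<Delta> - J = {f 1, f 6}" using missing J by blast
  then consider "J = \<Delta> - {f 1}" | "J = \<Delta> - {f 6}" | "J = \<Delta> - {f 1, f 6}" using J by blast
  then show ?thesis
  proof cases
    case 1
    let ?L = "[6, 5, 4, 2, 3] :: nat list"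
    have "simply_laced_labelling J (length ?L) (D_edges 5) (\<lambda>i. f (?L ! (i - 1)))"
    proof (rule sub_labelling)
      show "J = f ` set ?L" unfolding 1 \<Delta> by (auto simp: inj)
      fix i j assume "i \<in> {1..length ?L}" "j \<in> {1..length ?L}" "i \<noteq> j"
      then have "i \<in> {1, 2, 3, 4, 5}" "j \<in> {1, 2, 3, 4, 5}" "i \<noteq> j" by auto
      then show "{?L ! (i - 1), ?L ! (j - 1)} \<in> E6_edges \<longleftrightarrow> {i, j} \<in> D_edges 5"
        by (elim insertE emptyE; simp add: E6_edges_def D_edges_symmetric_iff doubleton_eq_iff)
    qed auto
    moreover have "length ?L = 5" by simp
    ultimately have "type_D 5 J" unfolding type_D_def by metis
    then show ?thesis ..
  next
    case 2
    let ?L = "[1, 3, 4, 2, 5] :: nat list"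
    have "simply_laced_labelling J (length ?L) (D_edges 5) (\<lambda>i. f (?L ! (i - 1)))"
    proof (rule sub_labelling)
      show "J = f ` set ?L" unfolding 2 \<Delta> by (auto simp: inj)
      fix i j assume "i \<in> {1..length ?L}" "j \<in> {1..length ?L}" "i \<noteq> j"
      then have "i \<in> {1, 2, 3, 4, 5}" "j \<in> {1, 2, 3, 4, 5}" "i \<noteq> j" by auto
      then show "{?L ! (i - 1), ?L ! (j - 1)} \<in> E6_edges \<longleftrightarrow> {i, j} \<in> D_edges 5"
        by (elim insertE emptyE; simp add: E6_edges_def D_edges_symmetric_iff doubleton_eq_iff)
    qed auto
    moreover have "length ?L = 5" by simp
    ultimately have "type_D 5 J" unfolding type_D_def by metis
    then show ?thesis ..
  next
    case 3
    let ?L = "[2, 4, 3, 5] :: nat list"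
    have "simply_laced_labelling J (length ?L) (D_edges 4) (\<lambda>i. f (?L ! (i - 1)))"
    proof (rule sub_labelling)
      show "J = f ` set ?L" unfolding 3 \<Delta> by (auto simp: inj)
      fix i j assume "i \<in> {1..length ?L}" "j \<in> {1..length ?L}" "i \<noteq> j"
      then have "i \<in> {1, 2, 3, 4}" "j \<in> {1, 2, 3, 4}" "i \<noteq> j" by auto
      then show "{?L ! (i - 1), ?L ! (j - 1)} \<in> E6_edges \<longleftrightarrow> {i, j} \<in> D_edges 4"
        by (elim insertE emptyE; simp add: E6_edges_def D_edges_symmetric_iff doubleton_eq_iff)
    qed auto
    moreover have "length ?L = 4" by simp
    ultimately have "type_D 4 J" unfolding type_D_def by metis
    then show ?thesis ..
  qed
qed

end

section \<open>The theorem\<close>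

theorem proposition4:
  fixes \<Phi> \<Delta> J :: "'a::euclidean_space set"
  assumes "irreducible_root_system \<Phi>"
    and "root_base \<Phi> \<Delta>"
    and "J \<subseteq> \<Delta>"
  shows
    "(\<forall>ns. type_A_with_blocks \<Delta> J ns \<and> admissible_blocks ns \<longrightarrow>
        real (a_P \<Delta> J) = fact (sum_list ns div 2) / (\<Prod>m\<leftarrow>ns. fact (m div 2))) \<and>
     (\<forall>n\<ge>2. type_D (2 * n + 1) \<Delta> \<and> type_D (2 * n) J \<longrightarrow> a_P \<Delta> J = 2) \<and>
     (type_E6 \<Delta> \<and> type_D 5 J \<longrightarrow> a_P \<Delta> J = 3) \<and>
     (type_E6 \<Delta> \<and> type_D 4 J \<longrightarrow> a_P \<Delta> J = 6) \<and>
     (J \<noteq> \<Delta> \<and>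
      \<not> (\<exists>ns. type_A_with_blocks \<Delta> J ns \<and> admissible_blocks ns) \<and>
      \<not> (\<exists>n\<ge>2. type_D (2 * n + 1) \<Delta> \<and> type_D (2 * n) J) \<and>
      \<not> (type_E6 \<Delta> \<and> type_D 5 J) \<and>
      \<not> (type_E6 \<Delta> \<and> type_D 4 J) \<longrightarrow> a_P \<Delta> J = 0)"
proof -
  interpret root_basis \<Phi> \<Delta>
    using assms(1,2) by unfold_locales (simp_all add: irreducible_root_system_def)
  note J = assms(3)
  have D: "a_P \<Delta> J = 2" if n: "2 \<le> n" and type: "type_D (2 * n + 1) \<Delta>" "type_D (2 * n) J" for n
  proof -
    obtain f where "simply_laced_labelling \<Delta> (2 * n + 1) (D_edges (2 * n + 1)) f"
      using type(1) unfolding type_D_def by blast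
    then interpret type_D_basis \<Phi> \<Delta> "2 * n + 1" f
      using n by unfold_locales simp_all
    have "J = \<Delta> - {f 1}"
      using J_if_type_D[OF J] type(2) n by simp
    then show ?thesis using a_P_remove_first by simp
  qed
  have E6: "a_P \<Delta> J = 3" if E: "type_E6 \<Delta>" "type_D 5 J"
  proof -
    obtain f where "simply_laced_labelling \<Delta> 6 E6_edges f"
      using E(1) unfolding type_E6_def by blast
    then interpret type_E6_basis \<Phi> \<Delta> f by unfold_locales
    show ?thesis using J E(2) by (rule a_P_type_D5)
  qed
  have E6': "a_P \<Delta> J = 6" if E: "type_E6 \<Delta>" "type_D 4 J"
  proof -
    obtain f where "simply_laced_labelling \<Delta> 6 E6_edges f"
      using E(1) unfolding type_E6_def by blast
    then interpret type_E6_basis \<Phi> \<Delta> f by unfold_locales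
    show ?thesis using J E(2) by (rule a_P_type_D4)
  qed
  have exceptional: "(\<exists>ns. type_A_with_blocks \<Delta> J ns \<and> admissible_blocks ns) \<or>
      (\<exists>n\<ge>2. type_D (2 * n + 1) \<Delta> \<and> type_D (2 * n) J) \<or>
      type_E6 \<Delta> \<and> type_D 5 J \<or> type_E6 \<Delta> \<and> type_D 4 J"
    if ne: "J \<noteq> \<Delta>" and nonzero: "a_P \<Delta> J \<noteq> 0"
  proof -
    have reps: "fixed_reps J \<noteq> {}" by (rule a_P_nonzero[OF J nonzero])
    then have "\<not> (\<forall>x. w0 x = - x)"
      using no_fixed_reps_if_minus[OF _ J ne] by blast
    then consider (A) f where "simply_laced_labelling \<Delta> (card \<Delta>) (A_edges (card \<Delta>)) f"
      | (D) n where "4 \<le> n" "type_D n \<Delta>" | (E6) "type_E6 \<Delta>"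
      using type_if_not_minus[OF assms(1)] by blast
    then show ?thesis
    proof cases
      case A
      then show ?thesis using blocks_if_fixed_reps[OF J _ reps] by blast
    next
      case D
      obtain f where "simply_laced_labelling \<Delta> n (D_edges n) f"
        using D(2) unfolding type_D_def by blast
      then interpret type_D_basis \<Phi> \<Delta> n f
        using D(1) by unfold_locales
      have odd: "odd n"
        using w0_even \<open>\<not> (\<forall>x. w0 x = - x)\<close> by blast
      then obtain m where m: "n = 2 * m + 1" by (elim oddE)
      have "J = \<Delta> - {f 1}" by (rule J_if_fixed_reps[OF odd reps J ne])
      then have "type_D (2 * m) J" using type_D_remove_first m by simp
      then show ?thesis using D m by auto
    next
      case E6
      then obtain f where "simply_laced_labelling \<Delta> 6 E6_edges f"
        unfolding type_E6_def by blast
      then interpret type_E6_basis \<Phi> \<Delta> f by unfold_locales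
      show ?thesis using type_D_if_fixed_reps[OF J ne reps] E6 by blast
    qed
  qed
  show ?thesis
    using a_P_type_A[OF J] D E6 E6' exceptional by blast
qed

end
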